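(* Let $T>0$ and $n\in\mathbb{N}$. Let $a\in\Lambda_n$ and let $u$ be any nontrivial solution of the periodic problem $u''(x)+a(x)u(x)=0$, $x\in(0,T)$, $u(0)-u(T)=u'(0)-u'(T)=0$, such that $u(0)=u(T)=0$. Denote the zeros of $u$ in $[0,T]$ by $0=x_0<x_2<\dots<x_{2m}=T$ and the zeros of $u'$ in $(0,T)$ by $x_1<x_3<\dots<x_{2m-1}$ (the zeros of $u$ and of $u'$ alternate, so that $x_0<x_1<x_2<\dots<x_{2m}$). Then: (1) $x_{i+1}-x_i\le \frac{T}{4n}$ for all $i$ with $0\le i\le 2m-1$, and at least one of these inequalities is strict. (2) $m$ is an even number and $m\ge 2(n+1)$. Any even value $m\ge 2(n+1)$ is possible (that is, it occurs for some $a\in\Lambda_n$ and some such $u$). (3) For $0\le i\le 2m-1$, $$\|a-\lambda_{2n-1}\|_{L^1(x_i,x_{i+1})}\ \ge\ \frac{2n\pi}{T}\cot\Big(\frac{2n\pi}{T}(x_{i+1}-x_i)\Big).$$ Moreover: (4) $$\beta_{1,n}:=\inf_{a\in\Lambda_n}\|a-\lambda_{2n-1}\|_{L^1(0,T)}=\frac{8\pi n(n+1)}{T}\cot\frac{n\pi}{2(n+1)},$$ and the infimum $\beta_{1,n}$ is not attained. (5) If $a\in L_T(\mathbb{R},\mathbb{R})$ satisfies $\lambda_{2n-1}\prec a$ and $\|a\|_{L^1(0,T)}\le\gamma_{1,n}$, where $\gamma_{1,n}:=T\lambda_{2n-1}+\beta_{1,n}$, then $$\lambda_{2n}(a)<0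<\lambda_{2n+1}(a).$$
   Context: $\mathbb{N}=\{1,2,\dots\}$. $L_T(\mathbb{R},\mathbb{R})$ is the set of $T$-periodic functions $a:\mathbb{R}\to\mathbb{R}$ with $a|_{[0,T]}\in L^1(0,T)$. For $c,d\in L^1(0,T)$, $c\prec d$ means $c(x)\le d(x)$ for a.e. $x\in[0,T]$ and $c(x)<d(x)$ on a set of positive measure (constants are regarded as constant functions). Solutions are $C^1$ functions with absolutely continuous derivative satisfying the equation a.e. For $a\in L_T(\mathbb{R},\mathbb{R})$, the eigenvalues $\lambda$ of $u''(x)+(\lambda+a(x))u(x)=0$, $x\in(0,T)$, $u(0)-u(T)=u'(0)-u'(T)=0$, counted with multiplicity, form a sequence $\lambda_0(a)<\lambda_1(a)\le\lambda_2(a)<\dots<\lambda_{2n-1}(a)\le\lambda_{2n}(a)<\dots$. Write $\lambda_i=\lambda_i(0)$; thus $\lambda_0=0$ and $\lambda_{2n-1}=\lambda_{2n}=(2n)^2\pi^2/T^2$ for $n\in\mathbb{N}$. $\Lambda_n$ is the set of all $a\in L_T(\mathbb{R},\mathbb{R})$ such that $\lambda_{2n-1}\prec a$ and the problem $u''(x)+a(x)u(x)=0$, $x\in(0,T)$, $u(0)-u(T)=u'(0)-u'(T)=0$, has nontrivial solutions. *)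

theory Defs
  imports "HOL-Analysis.Analysis" "HOL-Library.Function_Algebras"
begin

definition L_per :: "real \<Rightarrow> (real \<Rightarrow> real) set" where
  "L_per T = {a. (\<forall>x. a (x + T) = a x) \<and> a absolutely_integrable_on {0..T}}"

definition L1_norm :: "real set \<Rightarrow> (real \<Rightarrow> real) \<Rightarrow> real" where
  "L1_norm S f = set_lebesgue_integral lebesgue S (\<lambda>x. \<bar>f x\<bar>)"

definition strictly_below :: "real \<Rightarrow> (real \<Rightarrow> real) \<Rightarrow> (real \<Rightarrow> real) \<Rightarrow> bool" where
  "strictly_below T c d \<longleftrightarrow>
     (AE x in lebesgue. x \<in> {0..T} \<longrightarrow> c x \<le> d x) \<and>
     emeasure lebesgue {x \<in> {0..T}. c x < d x} > 0"

text \<open>Absolute continuity on a compact interval. A finite family of non-overlapping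
  subintervals is given as a finite set of pairs of end points.\<close>

definition abs_continuous_on :: "real \<Rightarrow> real \<Rightarrow> (real \<Rightarrow> real) \<Rightarrow> bool" where
  "abs_continuous_on a b f \<longleftrightarrow>
     (\<forall>\<epsilon>>0. \<exists>\<delta>>0. \<forall>D :: (real \<times> real) set.
        finite D \<longrightarrow>
        (\<forall>(s, t)\<in>D. a \<le> s \<and> s \<le> t \<and> t \<le> b) \<longrightarrow>
        pairwise (\<lambda>(s, t) (s', t'). disjnt {s<..<t} {s'<..<t'}) D \<longrightarrow>
        (\<Sum>(s, t)\<in>D. t - s) < \<delta> \<longrightarrow>
        (\<Sum>(s, t)\<in>D. \<bar>f t - f s\<bar>) < \<epsilon>)"

text \<open>The derivative of \<open>u\<close> on \<open>[0, T]\<close>, one-sided at the end points; values of \<open>u\<close> outside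
  \<open>[0, T]\<close> are irrelevant.\<close>

definition D_on :: "real \<Rightarrow> (real \<Rightarrow> real) \<Rightarrow> real \<Rightarrow> real" where
  "D_on T u x = vector_derivative u (at x within {0..T})"

text \<open>Solutions on \<open>[0, T]\<close> of \<open>u'' + q u = 0\<close>.\<close>

definition is_solution :: "real \<Rightarrow> (real \<Rightarrow> real) \<Rightarrow> (real \<Rightarrow> real) \<Rightarrow> bool" where
  "is_solution T q u \<longleftrightarrow>
     u differentiable_on {0..T} \<and>
     continuous_on {0..T} (D_on T u) \<and>
     abs_continuous_on 0 T (D_on T u) \<and>
     (AE x in lebesgue. x \<in> {0<..<T} \<longrightarrow>
        (\<exists>w. (D_on T u has_real_derivative w) (at x) \<and> w + q x * u x = 0))"

definition is_periodic_solution :: "real \<Rightarrow> (real \<Rightarrow> real) \<Rightarrow> (real \<Rightarrow> real) \<Rightarrow> bool" where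
  "is_periodic_solution T q u \<longleftrightarrow>
     is_solution T q u \<and> u 0 - u T = 0 \<and> D_on T u 0 - D_on T u T = 0"

definition nontrivial_on :: "real \<Rightarrow> (real \<Rightarrow> real) \<Rightarrow> bool" where
  "nontrivial_on T u \<longleftrightarrow> (\<exists>x\<in>{0..T}. u x \<noteq> 0)"

text \<open>Functions on \<open>[0, T]\<close> are represented by their extension by \<open>0\<close>, so that the dimension of
  the solution space is not affected by values outside \<open>[0, T]\<close>.\<close>

definition eigenspace :: "real \<Rightarrow> (real \<Rightarrow> real) \<Rightarrow> real \<Rightarrow> (real \<Rightarrow> real) set" where
  "eigenspace T a \<mu> =
     {u. is_periodic_solution T (\<lambda>x. \<mu> + a x) u \<and> (\<forall>x. x \<notin> {0..T} \<longrightarrow> u x = 0)}"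

global_interpretation real_fun: vector_space "\<lambda>(c::real) (f::real \<Rightarrow> real) x. c * f x"
  by unfold_locales (auto simp: fun_eq_iff algebra_simps)

definition eigenvalue_mult :: "real \<Rightarrow> (real \<Rightarrow> real) \<Rightarrow> real \<Rightarrow> nat" where
  "eigenvalue_mult T a \<mu> = real_fun.dim (eigenspace T a \<mu>)"

text \<open>\<open>l\<close> lists all eigenvalues in nondecreasing order, each repeated according to its
  multiplicity; non-eigenvalues have multiplicity \<open>0\<close> and hence do not occur.\<close>

definition is_eigenvalue_sequence :: "real \<Rightarrow> (real \<Rightarrow> real) \<Rightarrow> (nat \<Rightarrow> real) \<Rightarrow> bool" where
  "is_eigenvalue_sequence T a l \<longleftrightarrow>
     mono l \<and> (\<forall>\<mu>. finite {k. l k = \<mu>} \<and> card {k. l k = \<mu>} = eigenvalue_mult T a \<mu>)"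

definition eigenvalue :: "real \<Rightarrow> (real \<Rightarrow> real) \<Rightarrow> nat \<Rightarrow> real" where
  "eigenvalue T a = (THE l. is_eigenvalue_sequence T a l)"

abbreviation eigenvalue0 :: "real \<Rightarrow> nat \<Rightarrow> real" where
  "eigenvalue0 T k \<equiv> eigenvalue T (\<lambda>_. 0) k"

definition Lambda_set :: "real \<Rightarrow> nat \<Rightarrow> (real \<Rightarrow> real) set" where
  "Lambda_set T n =
     {a \<in> L_per T. strictly_below T (\<lambda>_. eigenvalue0 T (2 * n - 1)) a \<and>
        (\<exists>u. is_periodic_solution T a u \<and> nontrivial_on T u)}"

definition beta1 :: "real \<Rightarrow> nat \<Rightarrow> real" where
  "beta1 T n =
     (INF a\<in>Lambda_set T n. L1_norm {0<..<T} (\<lambda>x. a x - eigenvalue0 T (2 * n - 1)))"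

definition gamma1 :: "real \<Rightarrow> nat \<Rightarrow> real" where
  "gamma1 T n = T * eigenvalue0 T (2 * n - 1) + beta1 T n"

text \<open>\<open>x\<^sub>0 < x\<^sub>1 < \<dots> < x\<^sub>2\<^sub>m\<close>, where the even-indexed points are the zeros of \<open>u\<close> in \<open>[0, T]\<close>
  and the odd-indexed ones are the zeros of \<open>u'\<close> in \<open>(0, T)\<close>.\<close>

definition interlaced_zeros :: "real \<Rightarrow> (real \<Rightarrow> real) \<Rightarrow> nat \<Rightarrow> (nat \<Rightarrow> real) \<Rightarrow> bool" where
  "interlaced_zeros T u m x \<longleftrightarrow>
     strict_mono_on {..2 * m} x \<and> x 0 = 0 \<and> x (2 * m) = T \<and>
     {t \<in> {0..T}. u t = 0} = x ` {i. i \<le> 2 * m \<and> even i} \<and>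
     {t \<in> {0<..<T}. D_on T u t = 0} = x ` {i. i \<le> 2 * m \<and> odd i}"

end

theory Submission
  imports Defs
begin

text \<open>Everything is read off from the Pruefer angle. For a solution of \<open>u'' + q u = 0\<close> write
  \<open>u = \<rho> sin \<theta>\<close> and \<open>u' = \<sigma> \<rho> cos \<theta>\<close> with a fixed scale \<open>\<sigma> > 0\<close>. Then
  \<open>\<theta>' = \<sigma> + (q/\<sigma> - \<sigma>) sin\<^sup>2 \<theta>\<close> almost everywhere: a scalar equation with a global Lipschitz
  bound, for which existence, comparison and continuous dependence in \<open>L\<^sup>1\<close> are elementary.
  Zeros of \<open>u\<close> and \<open>u'\<close> are the points where \<open>\<theta>\<close> is a multiple of \<open>\<pi>/2\<close>. The rotation
  \<open>\<theta>(T) - \<theta>(0)\<close>, as a function of \<open>\<theta>(0)\<close>, oscillates by less than \<open>\<pi>\<close>.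

  Eigenvalues: a nontrivial periodic solution exists if and only if the maximum or the minimum of
  the rotation is a multiple of \<open>2 \<pi>\<close> (\<open>extremal_rotation_periodic\<close>,
  \<open>periodic_rotation_extremal\<close>), because the monodromy matrix has determinant \<open>1\<close> and the sine of
  the rotation has the opposite sign of a quadratic form in the initial data. For \<open>q = \<mu> + a\<close> both
  extrema are continuous and strictly increasing in \<open>\<mu>\<close>. Hence \<open>\<lambda>\<^sub>2\<^sub>k\<close> is the value of \<open>\<mu>\<close> at
  which the minimum is \<open>2 \<pi> k\<close>, and \<open>\<lambda>\<^sub>2\<^sub>k\<^sub>-\<^sub>1\<close> the one at which the maximum is \<open>2 \<pi> k\<close>,
  including multiplicities (\<open>eigenvalue_characterization\<close>).

  Estimates: take \<open>\<sigma> = 2 \<pi> n / T\<close>, so that \<open>\<lambda>\<^sub>2\<^sub>n\<^sub>-\<^sub>1(0) = \<sigma>\<^sup>2\<close> and the potential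
  \<open>\<sigma>\<^sup>2\<close> rotates by \<open>\<sigma> T = 2 \<pi> n\<close>. For \<open>a \<ge> \<sigma>\<^sup>2\<close> put \<open>r = (a - \<sigma>\<^sup>2)/\<sigma>\<close>. On a quarter turn of
  length \<open>L\<close> the quantity \<open>\<theta> - \<sigma> t\<close> increases at the rate \<open>r sin\<^sup>2 \<theta>\<close>. This gives
  \<open>\<sigma> L \<le> \<pi>/2\<close>; and replacing \<open>\<theta>(t)\<close> inside the sine by the phase that free motion, forward or
  backward, from \<open>\<theta>(t)\<close> reaches at the maximum of \<open>\<bar>u\<bar>\<close> gives
  \<open>\<integral> r \<ge> cot (\<sigma> L)\<close> (\<open>quarter_turn\<close>), strictly unless \<open>\<sigma> L = \<pi>/2\<close>. A periodic solution
  for \<open>a\<close> in \<open>\<Lambda>\<^sub>n\<close> makes at least \<open>4 (n + 1)\<close> quarter turns, and convexity of the cotangent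
  then bounds the norm below by the claimed infimum (\<open>excess_lower_bound\<close>). It is approached by
  potentials whose excess is concentrated at the maxima of \<open>\<bar>u\<bar>\<close> (\<open>near_minimal_potential\<close>).

  The statement on \<open>\<lambda>\<^sub>2\<^sub>n(a)\<close> and \<open>\<lambda>\<^sub>2\<^sub>n\<^sub>+\<^sub>1(a)\<close> says that the rotation for \<open>a\<close> lies strictly
  between \<open>2 \<pi> n\<close> and \<open>2 \<pi> (n + 1)\<close>. The lower bound is comparison with \<open>\<sigma>\<^sup>2\<close>. If the upper
  bound failed, the intermediate value theorem on the segment from \<open>\<sigma>\<^sup>2\<close> to \<open>a\<close> would give a
  potential with rotation exactly \<open>2 \<pi> (n + 1)\<close> and with excess at most the infimum, against the
  strict lower bound.\<close>

section \<open>Absolutely continuous functions\<close>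

text \<open>Absolute continuity in integrated form. Differential equations are stated with it, so that
  the definition by families of intervals occurs only where solutions are translated into it.\<close>

definition primitive_on :: "real \<Rightarrow> real \<Rightarrow> (real \<Rightarrow> real) \<Rightarrow> (real \<Rightarrow> real) \<Rightarrow> bool" where
  "primitive_on c d f g \<longleftrightarrow>
     g absolutely_integrable_on {c..d} \<and> (\<forall>x\<in>{c..d}. f x = f c + integral {c..x} g)"

lemma primitive_onD:
  assumes "primitive_on c d f g" "x \<in> {c..d}"
  shows "f x = f c + integral {c..x} g"
  using assms unfolding primitive_on_def by blast

lemma abs_int_imp_int:
  fixes g :: "real \<Rightarrow> real"
  shows "g absolutely_integrable_on S \<Longrightarrow> g integrable_on S"
  by (rule set_lebesgue_integral_eq_integral(1))

lemma abs_int_subinterval: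
  fixes g :: "real \<Rightarrow> real"
  assumes "g absolutely_integrable_on {c..d}" "c \<le> s" "t \<le> d"
  shows "g absolutely_integrable_on {s..t}"
  using assms absolutely_integrable_on_subinterval[of "{c..d}" g s t] by auto

lemma primitive_on_abs_int: "primitive_on c d f g \<Longrightarrow> g absolutely_integrable_on {c..d}"
  by (simp only: primitive_on_def)

lemma primitive_on_diff:
  assumes "primitive_on c d f g" "c \<le> s" "s \<le> t" "t \<le> d"
  shows "f t - f s = integral {s..t} g"
proof -
  have "g integrable_on {c..t}"
    using assms abs_int_subinterval[of c d g c t] by (auto dest!: primitive_on_abs_int intro: abs_int_imp_int)
  then have "integral {c..s} g + integral {s..t} g = integral {c..t} g"
    using assms by (intro Henstock_Kurzweil_Integration.integral_combine) auto
  moreover have "f s = f c + integral {c..s} g" "f t = f c + integral {c..t} g"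
    by (rule primitive_onD[OF assms(1)], use assms in simp)+
  ultimately show ?thesis by simp
qed

lemma primitive_on_subinterval:
  assumes "primitive_on c d f g" "c \<le> s" "s \<le> t" "t \<le> d"
  shows "primitive_on s t f g"
  unfolding primitive_on_def
proof (intro conjI ballI)
  show "g absolutely_integrable_on {s..t}"
    using assms abs_int_subinterval primitive_on_abs_int by blast
  fix x assume "x \<in> {s..t}"
  then show "f x = f s + integral {s..x} g"
    using primitive_on_diff[OF assms(1), of s x] assms by auto
qed

lemma primitive_on_continuous:
  assumes "primitive_on c d f g"
  shows "continuous_on {c..d} f"
proof -
  have "continuous_on {c..d} (\<lambda>x. f c + integral {c..x} g)"
    using assms by (intro continuous_intros indefinite_integral_continuous_1)
      (auto dest!: primitive_on_abs_int intro: abs_int_imp_int)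
  then show ?thesis
    by (rule continuous_on_eq) (rule primitive_onD[OF assms, symmetric])
qed

text \<open>Lebesgue differentiation: the one-sided statement of the library is applied to the integrand
  and to its reflection.\<close>

lemma integral_has_derivative_ae:
  fixes g :: "real \<Rightarrow> real"
  assumes g: "g absolutely_integrable_on {c..d}"
  obtains N where "negligible N"
    "\<And>x. x \<in> {c<..<d} - N \<Longrightarrow> ((\<lambda>x. integral {c..x} g) has_real_derivative g x) (at x)"
proof -
  define h where "h = (\<lambda>x. if x \<in> {c..d} then g x else 0)"
  have hint: "h integrable_on {a..b}" for a b
  proof -
    have "h integrable_on UNIV"
      unfolding h_def integrable_restrict_UNIV using g by (rule abs_int_imp_int)
    then show ?thesis
      using integrable_on_subinterval by blast
  qed
  have hrint: "(\<lambda>x. h (- x)) integrable_on {a..b}" for a b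
    using hint[of "-b" "-a"] Henstock_Kurzweil_Integration.integrable_reflect_real[where f=h and a="-b" and b="-a"] by simp
  obtain N1 where N1: "negligible N1" "\<And>x e. \<lbrakk>x \<notin> N1; 0 < e\<rbrakk> \<Longrightarrow>
      \<exists>d>0. \<forall>k. 0 < k \<and> k < d \<longrightarrow> norm(integral (cbox x (x + k *\<^sub>R One)) h /\<^sub>R k ^ DIM(real) - h x) < e"
    using integrable_ccontinuous_explicit[of h] hint by auto
  obtain N2 where N2: "negligible N2" "\<And>x e. \<lbrakk>x \<notin> N2; 0 < e\<rbrakk> \<Longrightarrow>
      \<exists>d>0. \<forall>k. 0 < k \<and> k < d \<longrightarrow> norm(integral (cbox x (x + k *\<^sub>R One)) (\<lambda>x. h (-x)) /\<^sub>R k ^ DIM(real) - h (-x)) < e"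
    using integrable_ccontinuous_explicit[of "\<lambda>x. h (- x)"] hrint by auto
  have N1': "\<exists>d>0. \<forall>k. 0 < k \<and> k < d \<longrightarrow> \<bar>integral {x..x+k} h / k - h x\<bar> < e" if "x \<notin> N1" "0 < e" for x e
    using N1(2)[OF that] by (simp add: divide_inverse mult.commute)
  \<comment> \<open>left-hand difference quotients are right-hand ones of the reflected integrand\<close>
  have N2': "\<exists>d>0. \<forall>k. 0 < k \<and> k < d \<longrightarrow> \<bar>integral {x-k..x} h / k - h x\<bar> < e" if "-x \<notin> N2" "0 < e" for x e
  proof -
    have "integral {-x..-x+k} (\<lambda>x. h (-x)) = integral {x-k..x} h" for k
      using Henstock_Kurzweil_Integration.integral_reflect_real[where f=h and a="x-k" and b=x] by simp
    then show ?thesis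
      using N2(2)[OF that] by (simp add: divide_inverse mult.commute)
  qed
  define N where "N = N1 \<union> uminus ` N2"
  have "negligible (uminus ` N2)"
    using N2(1) by (intro negligible_differentiable_image_negligible)
      (auto intro!: derivative_intros simp: differentiable_on_def)
  then have "negligible N" using N1 by (simp add: N_def)
  moreover have "((\<lambda>x. integral {c..x} g) has_real_derivative g x) (at x)" if x: "x \<in> {c<..<d} - N" for x
  proof -
    have xN: "x \<notin> N1" "-x \<notin> N2" using x by (auto simp: N_def image_iff)
    have comb: "integral {c..s} g + integral {s..t} h = integral {c..t} g" if "c \<le> s" "s \<le> t" "t \<le> d" for s t
    proof -
      have "integral {s..t} h = integral {s..t} g" 
        by (rule integral_cong) (use that in \<open>auto simp: h_def\<close>)
      moreover have "g integrable_on {c..t}"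
        using abs_int_subinterval[OF g, of c t] that by (auto intro: abs_int_imp_int)
      ultimately show ?thesis using that by (simp add: Henstock_Kurzweil_Integration.integral_combine)
    qed
    have hx: "h x = g x" using x by (auto simp: h_def)
    show ?thesis
      unfolding has_field_derivative_iff LIM_def
    proof (intro allI impI)
      fix r :: real assume "r > 0"
      obtain d1 where d1: "d1 > 0" "\<And>k. 0 < k \<Longrightarrow> k < d1 \<Longrightarrow> \<bar>integral {x..x+k} h / k - h x\<bar> < r"
        using N1'[OF xN(1) \<open>r>0\<close>] by blast
      obtain d2 where d2: "d2 > 0" "\<And>k. 0 < k \<Longrightarrow> k < d2 \<Longrightarrow> \<bar>integral {x-k..x} h / k - h x\<bar> < r"
        using N2'[OF xN(2) \<open>r>0\<close>] by blast
      define s where "s = Min {d1, d2, x - c, d - x}"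
      have s: "s > 0" "s \<le> d1" "s \<le> d2" "s \<le> x - c" "s \<le> d - x" using d1 d2 x by (auto simp: s_def)
      show "\<exists>s>0. \<forall>y. y \<noteq> x \<and> dist y x < s \<longrightarrow>
             dist ((integral {c..y} g - integral {c..x} g) / (y - x)) (g x) < r"
      proof (intro exI conjI allI impI)
        show "s > 0" by fact
        fix y assume y: "y \<noteq> x \<and> dist y x < s"
        show "dist ((integral {c..y} g - integral {c..x} g) / (y - x)) (g x) < r"
        proof (cases "y > x")
          case True
          have "integral {c..y} g - integral {c..x} g = integral {x..x + (y-x)} h"
            using comb[of x y] True y s x by (auto simp: dist_real_def)
          then show ?thesis
            using d1(2)[of "y-x"] True y s hx by (auto simp: dist_real_def)
        next
          case False
          have "integral {c..y} g - integral {c..x} g = - integral {x - (x-y)..x} h"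
            using comb[of y x] False y s x by (auto simp: dist_real_def)
          then have "(integral {c..y} g - integral {c..x} g) / (y - x) = integral {x - (x-y)..x} h / (x - y)"
            by (metis minus_diff_eq minus_divide_divide)
          then show ?thesis
            using d2(2)[of "x-y"] False y s hx by (auto simp: dist_real_def)
        qed
      qed
    qed
  qed
  ultimately show ?thesis using that by blast
qed

lemma primitive_on_derivative:
  assumes p: "primitive_on c d f g"
  obtains N where "negligible N" "\<And>x. x \<in> {c<..<d} - N \<Longrightarrow> (f has_real_derivative g x) (at x)"
proof -
  have "g absolutely_integrable_on {c..d}" using p by (rule primitive_on_abs_int)
  then obtain N where N: "negligible N"
    "\<And>x. x \<in> {c<..<d} - N \<Longrightarrow> ((\<lambda>x. integral {c..x} g) has_real_derivative g x) (at x)"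
    by (rule integral_has_derivative_ae) auto
  show ?thesis
  proof (rule that[OF N(1)])
    fix x assume x: "x \<in> {c<..<d} - N"
    have "((\<lambda>x. f c + integral {c..x} g) has_real_derivative g x) (at x)"
      using N(2)[OF x] by (auto intro!: derivative_eq_intros)
    then show "(f has_real_derivative g x) (at x)"
    proof (rule has_field_derivative_transform_within_open[of _ _ _ "{c<..<d}"])
      show "f c + integral {c..y} g = f y" if "y \<in> {c<..<d}" for y
        using primitive_onD[OF p, of y] that by simp
    qed (use x in auto)
  qed
qed

lemma negligible_Int_intervals:
  fixes s t s' t' :: real
  assumes "disjnt {s<..<t} {s'<..<t'}"
  shows "negligible ({s..t} \<inter> {s'..t'})"
proof -
  have "{s..t} \<inter> {s'..t'} \<subseteq> {s,t,s',t'}"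
    using assms by (auto simp: disjnt_def)
  then show ?thesis
    by (rule negligible_subset[rotated]) auto
qed

lemma sum_integral_le_disjoint:
  fixes h :: "real \<Rightarrow> real"
  assumes D: "finite D" "\<forall>(s,t)\<in>D. c \<le> s \<and> s \<le> t \<and> t \<le> d"
    "pairwise (\<lambda>(s, t) (s', t'). disjnt {s<..<t} {s'<..<t'}) D"
    and h: "h absolutely_integrable_on {c..d}" "\<And>x. x \<in> {c..d} \<Longrightarrow> 0 \<le> h x"
  shows "(\<Sum>(s,t)\<in>D. integral {s..t} h) \<le> integral {c..d} h"
proof -
  let ?T = "\<lambda>p. {fst p..snd p} :: real set"
  have 1: "(h has_integral (\<Sum>p\<in>D. integral (?T p) h)) (\<Union>p\<in>D. ?T p)"
  proof (rule has_integral_UN)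
    show "finite D" by fact
    show "(h has_integral integral (?T p) h) (?T p)" if "p \<in> D" for p
      using that D abs_int_subinterval[OF h(1), of "fst p" "snd p"]
      by (intro integrable_integral abs_int_imp_int) auto
    show "pairwise (\<lambda>i i'. negligible (?T i \<inter> ?T i')) D"
      using D(3) by (rule pairwise_mono)
        (auto simp del: Int_atLeastAtMost intro!: negligible_Int_intervals)
  qed
  have "(\<Sum>p\<in>D. integral (?T p) h) \<le> integral {c..d} h"
  proof (rule has_integral_subset_le[OF _ 1 integrable_integral])
    show "(\<Union>p\<in>D. ?T p) \<subseteq> {c..d}" using D by fastforce
    show "h integrable_on {c..d}" using h by (intro abs_int_imp_int)
    show "\<forall>x\<in>{c..d}. 0 \<le> h x" using h by auto
  qed
  then show ?thesis by (simp add: case_prod_beta)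
qed

text \<open>An integrable function is the sum of a bounded function and one with a small integral.\<close>

lemma integral_truncation_tendsto:
  fixes g :: "real \<Rightarrow> real"
  assumes g: "g absolutely_integrable_on {c..d}"
  shows "(\<lambda>n. integral {c..d} (\<lambda>x. max (\<bar>g x\<bar> - real n) 0)) \<longlonglongrightarrow> 0"
    and "(\<lambda>x. max (\<bar>g x\<bar> - real n) 0) absolutely_integrable_on {c..d}"
proof -
  have ga: "(\<lambda>x. \<bar>g x\<bar>) absolutely_integrable_on {c..d}"
    using g by (rule set_integrable_abs)
  show ai: "(\<lambda>x. max (\<bar>g x\<bar> - real n) 0) absolutely_integrable_on {c..d}" for n
    using ga by (intro absolutely_integrable_max_1 set_integral_diff) (auto simp: ga)
  have "(\<lambda>n. integral {c..d} (\<lambda>x. max (\<bar>g x\<bar> - real n) 0)) \<longlonglongrightarrow> integral {c..d} (\<lambda>x. 0)"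
  proof (rule dominated_convergence(2))
    show "(\<lambda>x. max (\<bar>g x\<bar> - real n) 0) integrable_on {c..d}" for n
      using ai by (rule abs_int_imp_int)
    show "(\<lambda>x. \<bar>g x\<bar>) integrable_on {c..d}" using ga by (rule abs_int_imp_int)
    show "norm (max (\<bar>g x\<bar> - real n) 0) \<le> \<bar>g x\<bar>" for n x by auto
    show "(\<lambda>n. max (\<bar>g x\<bar> - real n) 0) \<longlonglongrightarrow> 0" for x
    proof (rule tendsto_eventually)
      obtain m :: nat where "\<bar>g x\<bar> \<le> real m" using real_arch_simple by blast
      then show "\<forall>\<^sub>F n in sequentially. max (\<bar>g x\<bar> - real n) 0 = 0"
        by (intro eventually_sequentiallyI[of m]) (auto simp: max_def)
    qed
  qed
  then show "(\<lambda>n. integral {c..d} (\<lambda>x. max (\<bar>g x\<bar> - real n) 0)) \<longlonglongrightarrow> 0" by simp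
qed

text \<open>The increments of the bounded part are controlled by the total length of the intervals, those
  of the remainder by its integral over the whole interval.\<close>

lemma primitive_on_imp_abs_continuous:
  assumes p: "primitive_on c d f g"
  shows "abs_continuous_on c d f"
  unfolding abs_continuous_on_def
proof (intro allI impI)
  fix \<epsilon> :: real assume "\<epsilon> > 0"
  have g: "g absolutely_integrable_on {c..d}" using p by (rule primitive_on_abs_int)
  have "eventually (\<lambda>n. integral {c..d} (\<lambda>x. max (\<bar>g x\<bar> - real n) 0) < \<epsilon>/2) sequentially"
    using order_tendstoD(2)[OF integral_truncation_tendsto(1)[OF g], of "\<epsilon>/2"] \<open>\<epsilon>>0\<close> by simp
  then obtain n where n: "integral {c..d} (\<lambda>x. max (\<bar>g x\<bar> - real n) 0) < \<epsilon>/2"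
    by (auto simp: eventually_sequentially)
  define h where "h = (\<lambda>x. max (\<bar>g x\<bar> - real n) 0)"
  have h: "h absolutely_integrable_on {c..d}" "\<And>x. 0 \<le> h x"
    using integral_truncation_tendsto(2)[OF g] by (auto simp: h_def)
  show "\<exists>\<delta>>0. \<forall>D. finite D \<longrightarrow> (\<forall>(s, t)\<in>D. c \<le> s \<and> s \<le> t \<and> t \<le> d) \<longrightarrow>
      pairwise (\<lambda>(s, t) (s', t'). disjnt {s<..<t} {s'<..<t'}) D \<longrightarrow>
      (\<Sum>(s, t)\<in>D. t - s) < \<delta> \<longrightarrow> (\<Sum>(s, t)\<in>D. \<bar>f t - f s\<bar>) < \<epsilon>"
  proof (rule exI[of _ "\<epsilon> / (2 * (real n + 1))"], intro conjI allI impI)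
    show "0 < \<epsilon> / (2 * (real n + 1))" using \<open>\<epsilon>>0\<close> by simp
    fix D :: "(real \<times> real) set"
    assume D: "finite D" "\<forall>(s,t)\<in>D. c \<le> s \<and> s \<le> t \<and> t \<le> d"
      "pairwise (\<lambda>(s, t) (s', t'). disjnt {s<..<t} {s'<..<t'}) D"
      and small: "(\<Sum>(s, t)\<in>D. t - s) < \<epsilon> / (2 * (real n + 1))"
    have "\<bar>f t - f s\<bar> \<le> real n * (t - s) + integral {s..t} h" if "(s,t) \<in> D" for s t
    proof -
      have st: "c \<le> s" "s \<le> t" "t \<le> d" using that D by auto
      have gi: "g absolutely_integrable_on {s..t}" and hi: "h absolutely_integrable_on {s..t}"
        using abs_int_subinterval g h st by auto
      have "\<bar>f t - f s\<bar> = norm (integral {s..t} g)"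
        using primitive_on_diff[OF p st] by simp
      also have "\<dots> \<le> integral {s..t} (\<lambda>x. real n + h x)"
        by (rule integral_norm_bound_integral)
          (use gi hi in \<open>auto intro!: integrable_add abs_int_imp_int simp: h_def\<close>)
      also have "\<dots> = real n * (t - s) + integral {s..t} h"
        using hi st by (subst integral_add) (auto intro: abs_int_imp_int)
      finally show ?thesis .
    qed
    then have "(\<Sum>(s, t)\<in>D. \<bar>f t - f s\<bar>) \<le> (\<Sum>(s, t)\<in>D. real n * (t - s) + integral {s..t} h)"
      by (intro sum_mono) auto
    also have "\<dots> = real n * (\<Sum>(s, t)\<in>D. t - s) + (\<Sum>(s, t)\<in>D. integral {s..t} h)"
      by (simp add: case_prod_beta sum.distrib sum_distrib_left)
    also have "\<dots> \<le> real n * (\<epsilon> / (2 * (real n + 1))) + integral {c..d} h"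
      using small sum_integral_le_disjoint[OF D h(1)] h(2)
      by (intro add_mono mult_left_mono) auto
    also have "\<dots> < \<epsilon>/2 + \<epsilon>/2"
    proof (rule add_le_less_mono)
      show "real n * (\<epsilon> / (2 * (real n + 1))) \<le> \<epsilon> / 2"
        using \<open>\<epsilon>>0\<close> by (simp add: field_simps)
      show "integral {c..d} h < \<epsilon> / 2" using n by (simp add: h_def)
    qed
    finally show "(\<Sum>(s, t)\<in>D. \<bar>f t - f s\<bar>) < \<epsilon>" by simp
  qed
qed


text \<open>The fundamental theorem of calculus for absolutely continuous functions. Over the
  tags outside the exceptional null set the derivative controls the Riemann sum; the intervals
  tagged inside the null set have small total length, and there absolute continuity controls the
  increments.\<close>

lemma abs_continuous_has_integral:
  assumes ac: "abs_continuous_on c d f" and "c \<le> d" and N: "negligible N"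
    and der: "\<And>x. x \<in> {c<..<d} - N \<Longrightarrow> (f has_real_derivative g x) (at x)"
  shows "((\<lambda>x. if x \<in> N \<union> {c,d} then 0 else g x) has_integral (f d - f c)) {c..d}"
  unfolding has_integral_real
proof (intro allI impI)
  fix e :: real assume "e > 0"
  define N' where "N' = N \<union> {c,d}"
  have N': "negligible N'" using N by (auto simp: N'_def)
  define e' where "e' = e / (2 * (d - c + 1))"
  have e': "e' > 0" using \<open>e > 0\<close> \<open>c \<le> d\<close> by (auto simp: e'_def)
  have "e / 2 > 0" using \<open>e > 0\<close> by simp
  then obtain \<delta> where \<delta>: "\<delta> > 0" and ac': "\<And>D. finite D \<Longrightarrow> (\<forall>(s, t)\<in>D. c \<le> s \<and> s \<le> t \<and> t \<le> d) \<Longrightarrow>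
        pairwise (\<lambda>(s, t) (s', t'). disjnt {s<..<t} {s'<..<t'}) D \<Longrightarrow>
        (\<Sum>(s, t)\<in>D. t - s) < \<delta> \<Longrightarrow> (\<Sum>(s, t)\<in>D. \<bar>f t - f s\<bar>) < e / 2"
    using ac unfolding abs_continuous_on_def by meson
  obtain U where U: "open U" "N' \<subseteq> U" "U - N' \<in> lmeasurable" "emeasure lebesgue (U - N') < ennreal \<delta>"
    using sets_lebesgue_outer_open[OF negligible_imp_sets[OF N'] \<delta>] by blast
  have U_meas: "U \<in> lmeasurable" "measure lebesgue U < \<delta>"
  proof -
    have eq: "U = (U - N') \<union> N'" using U by auto
    have N'm: "N' \<in> lmeasurable" using N' by (rule negligible_imp_measurable)
    show "U \<in> lmeasurable" using eq U(3) N'm by (metis fmeasurable.Un)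
    have "measure lebesgue U \<le> measure lebesgue (U - N') + measure lebesgue N'"
      using eq U(3) N'm by (metis measure_Un_le fmeasurableD)
    also have "measure lebesgue N' = 0" using N' by (rule negligible_imp_measure0)
    also have "measure lebesgue (U - N') < \<delta>"
      using U(3,4) \<delta> by (simp add: emeasure_eq_measure2 ennreal_less_iff)
    finally show "measure lebesgue U < \<delta>" by simp
  qed
  have "\<exists>r>0. (x \<in> N' \<longrightarrow> ball x r \<subseteq> U) \<and>
      (x \<in> {c..d} - N' \<longrightarrow> (\<forall>y. \<bar>y - x\<bar> < r \<longrightarrow> \<bar>f y - f x - g x * (y - x)\<bar> \<le> e' * \<bar>y - x\<bar>))" for x
  proof -
    consider "x \<in> N'" | "x \<in> {c..d} - N'" | "x \<notin> N'" "x \<notin> {c..d}" by auto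
    then show ?thesis
    proof cases
      case 1
      then have "x \<in> U" using U by auto
      with U(1) obtain r where "r > 0" "ball x r \<subseteq> U" using openE by blast
      with 1 show ?thesis by (intro exI[of _ r]) auto
    next
      case 2
      then have "(f has_real_derivative g x) (at x)"
        by (intro der) (auto simp: N'_def)
      then have "(f has_derivative (\<lambda>h. g x * h)) (at x)"
        by (simp add: has_field_derivative_def)
      then obtain r where "r > 0" "\<forall>y. norm (y - x) < r \<longrightarrow> norm (f y - f x - g x * (y - x)) \<le> e' * norm (y - x)"
        using e' unfolding has_derivative_at_alt by meson
      with 2 show ?thesis by (intro exI[of _ r]) auto
    next
      case 3
      then show ?thesis by (intro exI[of _ 1]) auto
    qed
  qed
  then obtain r where r: "\<And>x. r x > 0" "\<And>x. x \<in> N' \<Longrightarrow> ball x (r x) \<subseteq> U"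
      "\<And>x y. x \<in> {c..d} - N' \<Longrightarrow> \<bar>y - x\<bar> < r x \<Longrightarrow> \<bar>f y - f x - g x * (y - x)\<bar> \<le> e' * \<bar>y - x\<bar>"
    by metis
  define \<gamma> where "\<gamma> = (\<lambda>x. ball x (r x))"
  have "gauge \<gamma>" using r(1) by (auto simp: \<gamma>_def intro!: gauge_ball_dependent)
  let ?g = "\<lambda>x. if x \<in> N' then 0 else g x"
  have main: "norm ((\<Sum>(x,K)\<in>p. measure lborel K *\<^sub>R ?g x) - (f d - f c)) < e"
    if p: "p tagged_division_of {c..d}" "\<gamma> fine p" for p
  proof -
    have fin: "finite p" using p by auto
    have K: "K = {Inf K..Sup K} \<and> Inf K \<le> x \<and> x \<le> Sup K \<and> c \<le> Inf K \<and> Sup K \<le> d \<and> measure lborel K = Sup K - Inf K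
       \<and> K \<subseteq> ball x (r x)" if xK: "(x,K) \<in> p" for x K
    proof -
      obtain a b where ab: "K = {a..b}" using tagged_division_ofD(4)[OF p(1) xK] by auto
      have "x \<in> K" "K \<subseteq> {c..d}" using tagged_division_ofD(2,3)[OF p(1) xK] by auto
      moreover have "K \<subseteq> ball x (r x)" using fineD[OF p(2) xK] by (simp add: \<gamma>_def)
      ultimately show ?thesis using ab by auto
    qed
    define p1 where "p1 = {q\<in>p. fst q \<in> N' \<and> Inf (snd q) < Sup (snd q)}"
    define err where "err = (\<lambda>q. measure lborel (snd q) * ?g (fst q) - (f (Sup (snd q)) - f (Inf (snd q))))"
    have "(\<Sum>(x,K)\<in>p. measure lborel K *\<^sub>R ?g x) - (f d - f c) = (\<Sum>q\<in>p. err q)"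
      using additive_tagged_division_1[OF \<open>c \<le> d\<close> p(1), of f]
      by (simp add: err_def sum_subtractf case_prod_beta)
    also have "\<bar>\<dots>\<bar> \<le> (\<Sum>q\<in>p. \<bar>err q\<bar>)" by (rule sum_abs)
    also have "\<dots> \<le> (\<Sum>q\<in>p. e' * measure lborel (snd q) + (if q \<in> p1 then \<bar>f (Sup (snd q)) - f (Inf (snd q))\<bar> else 0))"
    proof (rule sum_mono)
      fix q assume q: "q \<in> p"
      obtain x K' where qx: "q = (x,K')" by (cases q)
      note k = K[OF q[unfolded qx]]
      define a b where "a = Inf K'" and "b = Sup K'"
      have K': "K' = {a..b}" "a \<le> x" "x \<le> b" "measure lborel K' = b - a" "{a..b} \<subseteq> ball x (r x)" "c \<le> a" "b \<le> d"
        using k by (auto simp: a_def b_def)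
      show "\<bar>err q\<bar> \<le> e' * measure lborel (snd q) + (if q \<in> p1 then \<bar>f (Sup (snd q)) - f (Inf (snd q))\<bar> else 0)"
      proof (cases "x \<in> N'")
        case True
        show ?thesis
        proof (cases "a < b")
          case True
          then show ?thesis using \<open>x \<in> N'\<close> q e' K'
            by (auto simp: err_def p1_def qx a_def[symmetric] b_def[symmetric] abs_minus_commute)
        next
          case False
          then have "a = b" using K' by auto
          then show ?thesis using \<open>x \<in> N'\<close> K' by (auto simp: err_def qx p1_def a_def[symmetric] b_def[symmetric])
        qed
      next
        case False
        have "a \<in> {a..b}" "b \<in> {a..b}" using K' by auto
        then have "\<bar>a - x\<bar> < r x" "\<bar>b - x\<bar> < r x" using K'(5) by (auto simp: dist_real_def abs_minus_commute)
        then have 1: "\<bar>f a - f x - g x * (a - x)\<bar> \<le> e' * \<bar>a - x\<bar>" "\<bar>f b - f x - g x * (b - x)\<bar> \<le> e' * \<bar>b - x\<bar>"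
          using r(3)[of x a] r(3)[of x b] False K' by auto
        have "err q = (f a - f x - g x * (a - x)) - (f b - f x - g x * (b - x))"
          using False K' by (simp add: err_def qx a_def[symmetric] b_def[symmetric] algebra_simps)
        then have "\<bar>err q\<bar> \<le> e' * \<bar>a - x\<bar> + e' * \<bar>b - x\<bar>" using 1 by linarith
        also have "\<dots> = e' * (b - a)" using K' by (simp add: algebra_simps)
        finally show ?thesis using K' False by (auto simp: qx p1_def)
      qed
    qed
    also have "\<dots> = e' * (\<Sum>q\<in>p. measure lborel (snd q)) + (\<Sum>q\<in>p1. \<bar>f (Sup (snd q)) - f (Inf (snd q))\<bar>)"
    proof -
      have "p1 = p \<inter> p1" by (auto simp: p1_def)
      moreover have "(\<Sum>q\<in>p. if q \<in> p1 then \<bar>f (Sup (snd q)) - f (Inf (snd q))\<bar> else 0)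
        = (\<Sum>q\<in>p \<inter> p1. \<bar>f (Sup (snd q)) - f (Inf (snd q))\<bar>)"
        by (rule sum.inter_restrict[symmetric]) (rule fin)
      ultimately show ?thesis by (simp add: sum.distrib sum_distrib_left)
    qed
    also have "(\<Sum>q\<in>p. measure lborel (snd q)) = d - c"
      using additive_content_tagged_division[of p c d] p(1) \<open>c \<le> d\<close> by (simp add: case_prod_beta)
    also have "(\<Sum>q\<in>p1. \<bar>f (Sup (snd q)) - f (Inf (snd q))\<bar>) < e / 2"
    proof -
      let ?h = "\<lambda>q. (Inf (snd q), Sup (snd q)) :: real \<times> real"
      have disj: "disjnt {Inf (snd q)<..<Sup (snd q)} {Inf (snd q')<..<Sup (snd q')}"
        if "q \<in> p" "q' \<in> p" "q \<noteq> q'" for q q'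
      proof -
        obtain x K1 x' K2 where qq: "q = (x,K1)" "q' = (x',K2)" by (cases q, cases q')
        have "interior K1 \<inter> interior K2 = {}"
          using tagged_division_ofD(5)[OF p(1)] that qq by auto
        moreover have "interior K1 = {Inf K1<..<Sup K1}" "interior K2 = {Inf K2<..<Sup K2}"
          using K[of x K1] K[of x' K2] that qq by (metis interior_atLeastAtMost_real)+
        ultimately show ?thesis by (simp add: qq disjnt_def)
      qed
      have inj: "inj_on ?h p1"
      proof (rule inj_onI, rule ccontr)
        fix q q' assume q: "q \<in> p1" "q' \<in> p1" "?h q = ?h q'" "q \<noteq> q'"
        then have "disjnt {Inf (snd q)<..<Sup (snd q)} {Inf (snd q)<..<Sup (snd q)}"
          using disj[of q q'] by (auto simp: p1_def)
        then show False using q by (auto simp: p1_def)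
      qed
      have fin1: "finite p1" using fin by (auto simp: p1_def)
      have "(\<Sum>(s,t)\<in>?h ` p1. \<bar>f t - f s\<bar>) < e / 2"
      proof (rule ac')
        show "finite (?h ` p1)" using fin1 by simp
        show "\<forall>(s, t)\<in>?h ` p1. c \<le> s \<and> s \<le> t \<and> t \<le> d"
          using K by (fastforce simp: p1_def)
        show "pairwise (\<lambda>(s, t) (s', t'). disjnt {s<..<t} {s'<..<t'}) (?h ` p1)"
        proof (rule pairwiseI)
          fix y y' assume y: "y \<in> ?h ` p1" "y' \<in> ?h ` p1" "y \<noteq> y'"
          then obtain q q' where "y = ?h q" "y' = ?h q'" "q \<in> p1" "q' \<in> p1" by blast
          moreover from this y have "q \<noteq> q'" by blast
          ultimately show "(\<lambda>(s, t) (s', t'). disjnt {s<..<t} {s'<..<t'}) y y'"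
            using disj[of q q'] by (simp add: p1_def)
        qed
        have "(\<Sum>(s, t)\<in>?h ` p1. t - s) = (\<Sum>q\<in>p1. Sup (snd q) - Inf (snd q))"
          using inj by (simp add: sum.reindex)
        also have "\<dots> = (\<Sum>q\<in>p1. measure lebesgue {Inf (snd q)<..<Sup (snd q)})"
          by (intro sum.cong) (auto simp: p1_def)
        also have "\<dots> = measure lebesgue (\<Union>q\<in>p1. {Inf (snd q)<..<Sup (snd q)})"
          by (rule measure_negligible_finite_Union_image[symmetric])
            (use fin1 disj in \<open>auto simp: pairwise_def p1_def disjnt_def simp del: Int_greaterThanLessThan\<close>)
        also have "\<dots> \<le> measure lebesgue U"
        proof (rule measure_mono_fmeasurable[OF _ _ U_meas(1)])
          have "{Inf (snd q)<..<Sup (snd q)} \<subseteq> U" if q: "q \<in> p1" for q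
          proof -
            obtain x K1 where qq: "q = (x,K1)" by (cases q)
            have "x \<in> N'" "(x,K1) \<in> p" using q by (auto simp: p1_def qq)
            then have "K1 \<subseteq> U" "K1 = {Inf K1..Sup K1}" using K[of x K1] r(2)[of x] by auto
            then show ?thesis by (auto simp: qq)
          qed
          then show "(\<Union>q\<in>p1. {Inf (snd q)<..<Sup (snd q)}) \<subseteq> U" by blast
          show "(\<Union>q\<in>p1. {Inf (snd q)<..<Sup (snd q)}) \<in> sets lebesgue"
            using fin1 by (intro sets.finite_UN) auto
        qed
        also have "\<dots> < \<delta>" by (rule U_meas)
        finally show "(\<Sum>(s, t)\<in>?h ` p1. t - s) < \<delta>" .
      qed
      then show ?thesis using inj by (simp add: sum.reindex)
    qed
    also have "e' * (d - c) \<le> e / 2"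
    proof -
      have "e' * (d - c) \<le> e' * (d - c + 1)" using e' by simp
      also have "\<dots> = e / 2"
      proof -
        have "d - c + 1 \<noteq> 0" using \<open>c \<le> d\<close> by simp
        then show ?thesis unfolding e'_def by (simp add: divide_simps)
      qed
      finally show ?thesis .
    qed
    finally show ?thesis by simp
  qed
  show "\<exists>\<gamma>. gauge \<gamma> \<and> (\<forall>p. p tagged_division_of {c..d} \<and> \<gamma> fine p \<longrightarrow>
      norm ((\<Sum>(x,K)\<in>p. measure lborel K *\<^sub>R (if x \<in> N \<union> {c,d} then 0 else g x)) - (f d - f c)) < e)"
    using \<open>gauge \<gamma>\<close> main unfolding N'_def[symmetric] by (intro exI[of _ \<gamma>]) simp
qed

lemma abs_continuous_imp_primitive_on:
  assumes ac: "abs_continuous_on c d f" and N: "negligible N"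
    and der: "\<And>x. x \<in> {c<..<d} - N \<Longrightarrow> (f has_real_derivative g x) (at x)"
    and g: "g absolutely_integrable_on {c..d}"
  shows "primitive_on c d f g"
  unfolding primitive_on_def
proof (intro conjI ballI)
  fix x assume x: "x \<in> {c..d}"
  have acx: "abs_continuous_on c x f"
    unfolding abs_continuous_on_def
  proof (intro allI impI)
    fix e :: real assume "e > 0"
    then obtain \<delta> where "\<delta> > 0" and \<delta>: "\<And>D. finite D \<Longrightarrow> (\<forall>(s, t)\<in>D. c \<le> s \<and> s \<le> t \<and> t \<le> d) \<Longrightarrow>
        pairwise (\<lambda>(s, t) (s', t'). disjnt {s<..<t} {s'<..<t'}) D \<Longrightarrow>
        (\<Sum>(s, t)\<in>D. t - s) < \<delta> \<Longrightarrow> (\<Sum>(s, t)\<in>D. \<bar>f t - f s\<bar>) < e"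
      using ac unfolding abs_continuous_on_def by meson
    show "\<exists>\<delta>>0. \<forall>D. finite D \<longrightarrow> (\<forall>(s, t)\<in>D. c \<le> s \<and> s \<le> t \<and> t \<le> x) \<longrightarrow>
      pairwise (\<lambda>(s, t) (s', t'). disjnt {s<..<t} {s'<..<t'}) D \<longrightarrow>
      (\<Sum>(s, t)\<in>D. t - s) < \<delta> \<longrightarrow> (\<Sum>(s, t)\<in>D. \<bar>f t - f s\<bar>) < e"
      using \<open>\<delta> > 0\<close> x by (intro exI[of _ \<delta>] conjI allI impI \<delta>) fastforce+
  qed
  have "((\<lambda>y. if y \<in> N \<union> {c,x} then 0 else g y) has_integral (f x - f c)) {c..x}"
    using x by (intro abs_continuous_has_integral acx N der) auto
  then have "(g has_integral (f x - f c)) {c..x}"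
    by (rule has_integral_spike[of "N \<union> {c,x}", rotated 2]) (use N in auto)
  then show "f x = f c + integral {c..x} g" by (simp add: integral_unique)
qed (rule g)

lemma abs_int_mult_continuous:
  fixes g u :: "real \<Rightarrow> real"
  assumes "continuous_on {c..d} u" "g absolutely_integrable_on {c..d}"
  shows "(\<lambda>x. u x * g x) absolutely_integrable_on {c..d}"
  by (rule absolutely_integrable_bounded_measurable_product_real)
    (use assms in \<open>auto intro!: continuous_imp_measurable_on_sets_lebesgue compact_imp_bounded
      compact_continuous_image\<close>)

text \<open>A \<open>C\<^sup>1\<close> function is Lipschitz on the range, so the composition is again absolutely
  continuous, and its derivative is known almost everywhere.\<close>

lemma primitive_on_compose:
  assumes p: "primitive_on c d f g"
    and der: "\<And>y. y \<in> {A..B} \<Longrightarrow> (\<phi> has_real_derivative \<phi>' y) (at y)"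
    and cont: "continuous_on {A..B} \<phi>'"
    and range: "\<And>x. x \<in> {c..d} \<Longrightarrow> f x \<in> {A..B}"
  shows "primitive_on c d (\<lambda>x. \<phi> (f x)) (\<lambda>x. \<phi>' (f x) * g x)"
proof -
  obtain N where N: "negligible N" "\<And>x. x \<in> {c<..<d} - N \<Longrightarrow> (f has_real_derivative g x) (at x)"
    using primitive_on_derivative[OF p] by blast
  have fc: "continuous_on {c..d} f" using p by (rule primitive_on_continuous)
  have "bounded (\<phi>' ` {A..B})"
    using cont by (intro compact_imp_bounded compact_continuous_image) auto
  then obtain M where M: "M > 0" "\<And>y. y \<in> {A..B} \<Longrightarrow> \<bar>\<phi>' y\<bar> \<le> M"
    unfolding bounded_pos by auto
  have Lip: "\<bar>\<phi> y - \<phi> z\<bar> \<le> M * \<bar>y - z\<bar>" if "y \<in> {A..B}" "z \<in> {A..B}" for y z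
    using field_differentiable_bound[of "{A..B}" \<phi> \<phi>' M y z] that M der
    by (auto intro: has_field_derivative_at_within)
  show ?thesis
  proof (rule abs_continuous_imp_primitive_on[OF _ N(1)])
    show "abs_continuous_on c d (\<lambda>x. \<phi> (f x))"
      unfolding abs_continuous_on_def
    proof (intro allI impI)
      fix e :: real assume "e > 0"
      then have "e / M > 0" using M by simp
      then obtain \<delta> where "\<delta> > 0" and \<delta>: "\<And>D. finite D \<Longrightarrow> (\<forall>(s, t)\<in>D. c \<le> s \<and> s \<le> t \<and> t \<le> d) \<Longrightarrow>
          pairwise (\<lambda>(s, t) (s', t'). disjnt {s<..<t} {s'<..<t'}) D \<Longrightarrow>
          (\<Sum>(s, t)\<in>D. t - s) < \<delta> \<Longrightarrow> (\<Sum>(s, t)\<in>D. \<bar>f t - f s\<bar>) < e / M"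
        using primitive_on_imp_abs_continuous[OF p] unfolding abs_continuous_on_def by meson
      have "(\<Sum>(s, t)\<in>D. \<bar>\<phi> (f t) - \<phi> (f s)\<bar>) < e"
        if D: "finite D" "\<forall>(s, t)\<in>D. c \<le> s \<and> s \<le> t \<and> t \<le> d"
          "pairwise (\<lambda>(s, t) (s', t'). disjnt {s<..<t} {s'<..<t'}) D" "(\<Sum>(s, t)\<in>D. t - s) < \<delta>" for D
      proof -
        have "(\<Sum>(s, t)\<in>D. \<bar>\<phi> (f t) - \<phi> (f s)\<bar>) \<le> (\<Sum>(s, t)\<in>D. M * \<bar>f t - f s\<bar>)"
          using D(2) by (intro sum_mono) (auto intro!: Lip range)
        also have "\<dots> = M * (\<Sum>(s, t)\<in>D. \<bar>f t - f s\<bar>)"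
          by (simp add: sum_distrib_left case_prod_beta)
        also have "\<dots> < M * (e / M)"
          using \<delta>[OF D] M by (intro mult_strict_left_mono) auto
        finally show ?thesis using M by simp
      qed
      then show "\<exists>\<delta>>0. \<forall>D. finite D \<longrightarrow> (\<forall>(s, t)\<in>D. c \<le> s \<and> s \<le> t \<and> t \<le> d) \<longrightarrow>
        pairwise (\<lambda>(s, t) (s', t'). disjnt {s<..<t} {s'<..<t'}) D \<longrightarrow>
        (\<Sum>(s, t)\<in>D. t - s) < \<delta> \<longrightarrow> (\<Sum>(s, t)\<in>D. \<bar>\<phi> (f t) - \<phi> (f s)\<bar>) < e"
        using \<open>\<delta> > 0\<close> by blast
    qed
    show "((\<lambda>x. \<phi> (f x)) has_real_derivative \<phi>' (f x) * g x) (at x)" if "x \<in> {c<..<d} - N" for x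
      using DERIV_chain2[OF der N(2)[OF that]] range[of x] that by simp
    show "(\<lambda>x. \<phi>' (f x) * g x) absolutely_integrable_on {c..d}"
      by (rule abs_int_mult_continuous)
        (use primitive_on_abs_int[OF p] range in \<open>auto intro: continuous_on_compose2[OF cont fc]\<close>)
  qed
qed

lemma primitive_on_compose_UNIV:
  assumes p: "primitive_on c d f g"
    and der: "\<And>y. (\<phi> has_real_derivative \<phi>' y) (at y)"
    and cont: "continuous_on UNIV \<phi>'"
  shows "primitive_on c d (\<lambda>x. \<phi> (f x)) (\<lambda>x. \<phi>' (f x) * g x)"
proof -
  have "bounded (f ` {c..d})"
    using primitive_on_continuous[OF p] by (intro compact_imp_bounded compact_continuous_image) auto
  then obtain M where M: "\<And>x. x \<in> {c..d} \<Longrightarrow> \<bar>f x\<bar> \<le> M"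
    unfolding bounded_iff by (metis imageI real_norm_def)
  show ?thesis
  proof (rule primitive_on_compose[OF p, of "-M" M])
    show "f x \<in> {-M..M}" if "x \<in> {c..d}" for x
      using M[OF that] by auto
    show "continuous_on {-M..M} \<phi>'" using cont continuous_on_subset by blast
  qed (rule der)
qed

lemma primitive_on_cong:
  assumes "primitive_on c d f g" "\<And>x. x \<in> {c..d} \<Longrightarrow> f x = f' x" "\<And>x. x \<in> {c..d} \<Longrightarrow> g x = g' x"
  shows "primitive_on c d f' g'"
  unfolding primitive_on_def
proof (intro conjI ballI)
  have "g absolutely_integrable_on {c..d}" using assms(1) by (rule primitive_on_abs_int)
  then show "g' absolutely_integrable_on {c..d}"
    by (rule absolutely_integrable_spike[of _ _ "{}"]) (use assms in auto)
  fix x assume x: "x \<in> {c..d}"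
  have "integral {c..x} g = integral {c..x} g'"
    by (rule integral_cong) (use assms x in auto)
  then show "f' x = f' c + integral {c..x} g'"
    using primitive_onD[OF assms(1) x] assms(2)[of x] assms(2)[of c] x by simp
qed

lemma primitive_on_spike:
  assumes p: "primitive_on c d f g" and ae: "AE x in lebesgue. x \<in> {c..d} \<longrightarrow> g x = g' x"
  shows "primitive_on c d f g'"
proof -
  obtain N where N: "N \<in> null_sets lebesgue" "{x. \<not> (x \<in> {c..d} \<longrightarrow> g x = g' x)} \<subseteq> N"
    using ae by (auto simp: eventually_ae_filter)
  then have Nn: "negligible N" by (simp add: negligible_iff_null_sets)
  show ?thesis
    unfolding primitive_on_def
  proof (intro conjI ballI)
    have "g absolutely_integrable_on {c..d}" using p by (rule primitive_on_abs_int)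
    then show "g' absolutely_integrable_on {c..d}"
      by (rule absolutely_integrable_spike[OF _ Nn]) (use N in force)
    fix x assume x: "x \<in> {c..d}"
    have "integral {c..x} g = integral {c..x} g'"
      by (rule integral_spike[OF Nn]) (use N x in force)
    then show "f x = f c + integral {c..x} g'"
      using primitive_onD[OF p x] by simp
  qed
qed

lemma primitive_on_const: "primitive_on c d (\<lambda>_. k) (\<lambda>_. 0)"
  by (simp add: primitive_on_def)

lemma primitive_on_ident: "primitive_on c d (\<lambda>x. x) (\<lambda>_. 1)"
  by (auto simp: primitive_on_def)

lemma primitive_on_cmult:
  assumes "primitive_on c d f g"
  shows "primitive_on c d (\<lambda>x. k * f x) (\<lambda>x. k * g x)"
  using primitive_on_compose_UNIV[OF assms, of "\<lambda>y. k * y" "\<lambda>_. k"]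
  by (auto intro!: derivative_eq_intros)

lemma primitive_on_add:
  assumes f: "primitive_on c d f f'" and g: "primitive_on c d g g'"
  shows "primitive_on c d (\<lambda>x. f x + g x) (\<lambda>x. f' x + g' x)"
  unfolding primitive_on_def
proof (intro conjI ballI)
  have a: "f' absolutely_integrable_on {c..d}" "g' absolutely_integrable_on {c..d}"
    using primitive_on_abs_int[OF f] primitive_on_abs_int[OF g] by simp_all
  then show "(\<lambda>x. f' x + g' x) absolutely_integrable_on {c..d}"
    by (rule set_integral_add(1))
  fix x assume x: "x \<in> {c..d}"
  have "f' integrable_on {c..x}" "g' integrable_on {c..x}"
    using abs_int_imp_int[OF abs_int_subinterval[OF a(1)], of c x]
      abs_int_imp_int[OF abs_int_subinterval[OF a(2)], of c x] x by simp_all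
  then show "f x + g x = f c + g c + integral {c..x} (\<lambda>x. f' x + g' x)"
    using integral_add[of f' "{c..x}" g'] primitive_onD[OF f x] primitive_onD[OF g x] by linarith
qed

lemma primitive_on_diff_fun:
  assumes f: "primitive_on c d f f'" and g: "primitive_on c d g g'"
  shows "primitive_on c d (\<lambda>x. f x - g x) (\<lambda>x. f' x - g' x)"
  using primitive_on_add[OF f primitive_on_cmult[OF g, of "-1"]] by simp

text \<open>The product rule follows from the chain rule for the square by polarisation.\<close>

lemma primitive_on_mult:
  assumes f: "primitive_on c d f f'" and g: "primitive_on c d g g'"
  shows "primitive_on c d (\<lambda>x. f x * g x) (\<lambda>x. f' x * g x + f x * g' x)"
proof -
  have sq: "primitive_on c d (\<lambda>x. (h x)^2) (\<lambda>x. 2 * h x * h' x)" if "primitive_on c d h h'" for h h'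
  proof (rule primitive_on_compose_UNIV[OF that])
    show "((\<lambda>y. y^2) has_real_derivative 2 * y) (at y)" for y :: real
      by (auto intro!: derivative_eq_intros)
  qed (intro continuous_intros)
  have "primitive_on c d (\<lambda>x. (1/4) * ((f x + g x)^2 - (f x - g x)^2))
    (\<lambda>x. (1/4) * (2 * (f x + g x) * (f' x + g' x) - 2 * (f x - g x) * (f' x - g' x)))"
    by (intro primitive_on_cmult primitive_on_diff_fun sq primitive_on_add f g)
  then show ?thesis
    by (rule primitive_on_cong) (auto simp: field_simps power2_eq_square)
qed

lemma primitive_on_integral:
  assumes "g absolutely_integrable_on {c..d}"
  shows "primitive_on c d (\<lambda>x. k + integral {c..x} g) g"
  using assms by (auto simp: primitive_on_def)

lemma primitive_on_of_continuous_derivative: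
  assumes "\<And>x. x \<in> {c..d} \<Longrightarrow> (f has_vector_derivative g x) (at x within {c..d})" "continuous_on {c..d} g"
  shows "primitive_on c d f g"
  unfolding primitive_on_def
proof (intro conjI ballI)
  show "g absolutely_integrable_on {c..d}"
    using assms(2) by (rule absolutely_integrable_continuous_real)
  fix x assume x: "x \<in> {c..d}"
  have "(g has_integral (f x - f c)) {c..x}"
    by (rule fundamental_theorem_of_calculus)
      (use x in \<open>auto intro!: has_vector_derivative_within_subset[OF assms(1)]\<close>)
  then show "f x = f c + integral {c..x} g" by (simp add: integral_unique)
qed

lemma primitive_on_shift:
  assumes "primitive_on (c + k) (d + k) f g"
  shows "primitive_on c d (\<lambda>x. f (x + k)) (\<lambda>x. g (x + k))"
proof -
  have sh: "integral {c..x} (\<lambda>x. h (x + k)) = integral {c+k..x+k} h" for x and h :: "real \<Rightarrow> real"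
    using integral_shift_Icc_real[of c x h k] by (simp add: o_def add.commute)
  show ?thesis
    unfolding primitive_on_def
  proof (intro conjI ballI)
    have "g absolutely_integrable_on {c+k..d+k}" using assms by (rule primitive_on_abs_int)
    then show "(\<lambda>x. g (x + k)) absolutely_integrable_on {c..d}"
      using integrable_on_shift_Icc_real[of g k c d] integrable_on_shift_Icc_real[of "\<lambda>x. norm (g x)" k c d]
      by (simp add: absolutely_integrable_on_def o_def add.commute)
    fix x assume x: "x \<in> {c..d}"
    then show "f (x + k) = f (c + k) + integral {c..x} (\<lambda>x. g (x + k))"
      using primitive_onD[OF assms, of "x+k"] sh[of x g] by simp
  qed
qed

lemma primitive_on_mono:
  assumes p: "primitive_on c d f g" and nn: "AE x in lebesgue. x \<in> {c..d} \<longrightarrow> 0 \<le> g x"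
    and st: "c \<le> s" "s \<le> t" "t \<le> d"
  shows "f s \<le> f t"
proof -
  obtain N where N: "N \<in> null_sets lebesgue" "{x. \<not> (x \<in> {c..d} \<longrightarrow> 0 \<le> g x)} \<subseteq> N"
    using nn unfolding eventually_ae_filter by auto
  have Nn: "negligible N" using N by (simp add: negligible_iff_null_sets)
  have gi: "g integrable_on {s..t}"
    using abs_int_imp_int[OF abs_int_subinterval[OF primitive_on_abs_int[OF p]], of s t] st by simp
  let ?g = "\<lambda>x. if x \<in> N then 0 else g x"
  have "integral {s..t} g = integral {s..t} ?g"
    by (rule integral_spike[OF Nn]) auto
  moreover have "0 \<le> integral {s..t} ?g"
  proof (rule Henstock_Kurzweil_Integration.integral_nonneg)
    show "?g integrable_on {s..t}" by (rule integrable_spike[OF gi Nn]) auto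
    show "0 \<le> ?g x" if "x \<in> {s..t}" for x
    proof (cases "x \<in> N")
      case False
      then have "x \<in> {c..d} \<longrightarrow> 0 \<le> g x" using N(2) by blast
      then show ?thesis using False that st by simp
    qed simp
  qed
  ultimately have "0 \<le> integral {s..t} g" by simp
  then show ?thesis using primitive_on_diff[OF p st] by simp
qed

section \<open>The Pruefer angle equation\<close>

text \<open>For the Pruefer angle of \<open>u'' + q u = 0\<close> in the scale \<open>\<sigma>\<close> one takes \<open>P = \<sigma>\<close> and
  \<open>Q = q/\<sigma> - \<sigma>\<close>, since \<open>\<sigma> cos\<^sup>2 \<theta> + (q/\<sigma>) sin\<^sup>2 \<theta> = \<sigma> + (q/\<sigma> - \<sigma>) sin\<^sup>2 \<theta>\<close>. The constant
  \<open>P\<close> is kept free because multiples of \<open>\<pi>\<close> are constant solutions for \<open>P = 0\<close>.\<close>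

definition angle_solution ::
    "real \<Rightarrow> real \<Rightarrow> real \<Rightarrow> (real \<Rightarrow> real) \<Rightarrow> (real \<Rightarrow> real) \<Rightarrow> bool" where
  "angle_solution c d P Q \<theta> \<longleftrightarrow> primitive_on c d \<theta> (\<lambda>t. P + Q t * (sin (\<theta> t))\<^sup>2)"

lemma angle_solution_continuous: "angle_solution c d P Q \<theta> \<Longrightarrow> continuous_on {c..d} \<theta>"
  unfolding angle_solution_def by (rule primitive_on_continuous)

lemma sin_squared_diff: "(sin a)\<^sup>2 - (sin b)\<^sup>2 = sin (a + b) * sin (a - b)" for a b :: real
proof -
  have "sin (a + b) * sin (a - b) = (sin a * cos b)\<^sup>2 - (cos a * sin b)\<^sup>2"
    by (simp add: sin_add sin_diff power2_eq_square algebra_simps)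
  also have "\<dots> = (sin a)\<^sup>2 * (1 - (sin b)\<^sup>2) - (1 - (sin a)\<^sup>2) * (sin b)\<^sup>2"
    by (simp add: power_mult_distrib cos_squared_eq)
  finally show ?thesis by (simp add: algebra_simps)
qed

lemma sin_squared_lipschitz: "\<bar>(sin a)\<^sup>2 - (sin b)\<^sup>2\<bar> \<le> \<bar>a - b\<bar>" for a b :: real
proof -
  have "\<bar>sin (a + b)\<bar> * \<bar>sin (a - b)\<bar> \<le> 1 * \<bar>a - b\<bar>"
    by (intro mult_mono abs_sin_x_le_abs_x) auto
  then show ?thesis by (simp add: sin_squared_diff abs_mult)
qed

lemma angle_rhs_abs_int:
  fixes Q \<theta> :: "real \<Rightarrow> real"
  assumes "Q absolutely_integrable_on {c..d}" "continuous_on {c..d} \<theta>"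
  shows "(\<lambda>t. P + Q t * (sin (\<theta> t))\<^sup>2) absolutely_integrable_on {c..d}"
proof -
  have "(\<lambda>t. (sin (\<theta> t))\<^sup>2 * Q t) absolutely_integrable_on {c..d}"
    using assms by (intro abs_int_mult_continuous continuous_intros)
  then have "(\<lambda>t. Q t * (sin (\<theta> t))\<^sup>2) absolutely_integrable_on {c..d}"
    by (simp add: mult.commute)
  then show ?thesis by (intro set_integral_add(1)) auto
qed

text \<open>Picard iteration. With the weight \<open>exp (- 2 \<integral>\<bar>Q\<bar>)\<close> the integral operator contracts
  by the factor \<open>1/2\<close> on the whole interval.\<close>

lemma angle_solution_exists:
  assumes Q: "Q absolutely_integrable_on {c..d}" and "c \<le> d"
  obtains \<theta> where "angle_solution c d P Q \<theta>" "\<theta> c = \<theta>0"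
proof -
  define K where "K = (\<lambda>x. integral {c..x} (\<lambda>t. \<bar>Q t\<bar>))"
  define w where "w = (\<lambda>x. exp (- 2 * K x))"
  \<comment> \<open>retraction onto the interval, so that the iteration acts on bounded continuous functions on
    the whole line; the unknown \<open>z\<close> stands for \<open>w \<theta>\<close>\<close>
  define cl where "cl = (\<lambda>x. max c (min d x))"
  have cl: "cl x \<in> {c..d}" "x \<in> {c..d} \<Longrightarrow> cl x = x" for x
    using \<open>c \<le> d\<close> by (auto simp: cl_def)
  have cl_cont: "continuous_on UNIV cl" unfolding cl_def by (intro continuous_intros)
  have aQ: "(\<lambda>t. \<bar>Q t\<bar>) absolutely_integrable_on {c..d}" using Q by (rule set_integrable_abs)
  have Kp: "primitive_on c d K (\<lambda>t. \<bar>Q t\<bar>)"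
    using primitive_on_integral[OF aQ, of 0] by (simp add: K_def)
  have Kc: "continuous_on {c..d} K" using Kp by (rule primitive_on_continuous)
  have wc: "continuous_on {c..d} w" unfolding w_def by (intro continuous_intros Kc)
  have wpos: "w x > 0" for x by (simp add: w_def)
  define F where "F = (\<lambda>(z::real \<Rightarrow> real) t. P + Q t * (sin (z t / w t))\<^sup>2)"
  define G where "G = (\<lambda>z x. w x * (\<theta>0 + integral {c..x} (F z)))"
  have Fint: "F z absolutely_integrable_on {c..d}" if "continuous_on {c..d} z" for z
    unfolding F_def using Q
    by (rule angle_rhs_abs_int) (intro continuous_intros that wc, use wpos in \<open>auto simp: less_imp_neq[symmetric]\<close>)
  have Gcont: "continuous_on {c..d} (G z)" if "continuous_on {c..d} z" for z
    unfolding G_def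
    by (intro continuous_intros wc indefinite_integral_continuous_1 abs_int_imp_int Fint that)
  have Gb: "(\<lambda>x. G z (cl x)) \<in> bcontfun" if "continuous_on {c..d} z" for z
    unfolding bcontfun_def
  proof (intro CollectI conjI)
    show "continuous_on UNIV (\<lambda>x. G z (cl x))"
      by (rule continuous_on_compose2[OF Gcont[OF that] cl_cont]) (use cl in auto)
    have "bounded (G z ` {c..d})"
      using Gcont[OF that] by (intro compact_imp_bounded compact_continuous_image) auto
    then show "bounded (range (\<lambda>x. G z (cl x)))"
      by (rule bounded_subset) (use cl in auto)
  qed
  define \<Phi> where "\<Phi> = (\<lambda>z :: real \<Rightarrow>\<^sub>C real. Bcontfun (\<lambda>x. G (apply_bcontfun z) (cl x)))"
  have ap: "apply_bcontfun (\<Phi> z) = (\<lambda>x. G (apply_bcontfun z) (cl x))" for z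
    unfolding \<Phi>_def by (rule Bcontfun_inverse) (intro Gb continuous_on_apply_bcontfun)
  have contr: "dist (\<Phi> z1) (\<Phi> z2) \<le> 1/2 * dist z1 z2" for z1 z2
  proof (rule dist_bound)
    fix x'
    define x where "x = cl x'"
    have x: "x \<in> {c..d}" using cl by (simp add: x_def)
    let ?D = "dist z1 z2"
    have i: "F z integrable_on {c..x}" if "z = apply_bcontfun z1 \<or> z = apply_bcontfun z2" for z
      using abs_int_imp_int[OF abs_int_subinterval[OF Fint[of z]], of c x] x that by auto
    have Ep: "primitive_on c d (\<lambda>t. exp (2 * K t) / 2) (\<lambda>t. exp (2 * K t) * \<bar>Q t\<bar>)"
    proof (rule primitive_on_compose_UNIV[OF Kp])
      show "((\<lambda>y. exp (2 * y) / 2) has_real_derivative exp (2 * y)) (at y)" for y :: real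
        by (auto intro!: derivative_eq_intros)
    qed (intro continuous_intros)
    have Ei: "(\<lambda>t. exp (2 * K t) * \<bar>Q t\<bar>) integrable_on {c..x}"
      using abs_int_imp_int[OF abs_int_subinterval[OF primitive_on_abs_int[OF Ep]], of c x] x by simp
    have Fdiff: "\<bar>F z1 t - F z2 t\<bar> \<le> ?D * (exp (2 * K t) * \<bar>Q t\<bar>)" for t
    proof -
      have "\<bar>z1 t / w t - z2 t / w t\<bar> = exp (2 * K t) * \<bar>z1 t - z2 t\<bar>"
      proof -
        have "z1 t / w t - z2 t / w t = (z1 t - z2 t) * exp (2 * K t)"
          by (simp add: w_def exp_minus divide_inverse algebra_simps)
        then show ?thesis by (simp add: abs_mult)
      qed
      also have "\<dots> \<le> exp (2 * K t) * ?D"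
        using dist_bounded[of z1 t z2] by (simp add: dist_real_def)
      finally have 1: "\<bar>z1 t / w t - z2 t / w t\<bar> \<le> exp (2 * K t) * ?D" .
      have "F z1 t - F z2 t = Q t * ((sin (z1 t / w t))\<^sup>2 - (sin (z2 t / w t))\<^sup>2)"
        by (simp add: F_def algebra_simps)
      then have "\<bar>F z1 t - F z2 t\<bar> = \<bar>Q t\<bar> * \<bar>(sin (z1 t / w t))\<^sup>2 - (sin (z2 t / w t))\<^sup>2\<bar>"
        by (simp add: abs_mult)
      also have "\<dots> \<le> \<bar>Q t\<bar> * (exp (2 * K t) * ?D)"
        using order_trans[OF sin_squared_lipschitz 1] by (intro mult_left_mono) auto
      finally show ?thesis by (simp add: mult_ac)
    qed
    have "\<bar>integral {c..x} (F z1) - integral {c..x} (F z2)\<bar> = norm (integral {c..x} (\<lambda>t. F z1 t - F z2 t))"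
      using integral_diff[OF i i] by simp
    also have "\<dots> \<le> integral {c..x} (\<lambda>t. ?D * (exp (2 * K t) * \<bar>Q t\<bar>))"
      using Fdiff by (intro integral_norm_bound_integral integrable_diff i integrable_on_mult_right Ei) auto
    also have "\<dots> = ?D * integral {c..x} (\<lambda>t. exp (2 * K t) * \<bar>Q t\<bar>)" by simp
    also have "integral {c..x} (\<lambda>t. exp (2 * K t) * \<bar>Q t\<bar>) = exp (2 * K x) / 2 - 1 / 2"
    proof -
      have "K c = 0" by (simp add: K_def)
      then show ?thesis using primitive_onD[OF Ep x] by (simp add: add_divide_distrib)
    qed
    finally have "\<bar>integral {c..x} (F z1) - integral {c..x} (F z2)\<bar> \<le> ?D * (exp (2 * K x) / 2)"
    proof -
      assume *: "\<bar>integral {c..x} (F z1) - integral {c..x} (F z2)\<bar> \<le> ?D * (exp (2 * K x) / 2 - 1 / 2)"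
      have "?D * (exp (2 * K x) / 2 - 1 / 2) \<le> ?D * (exp (2 * K x) / 2)"
        by (intro mult_left_mono) auto
      with * show ?thesis by linarith
    qed
    then have "w x * \<bar>integral {c..x} (F z1) - integral {c..x} (F z2)\<bar> \<le> w x * (?D * (exp (2 * K x) / 2))"
      using wpos[of x] by (intro mult_left_mono) auto
    also have "\<dots> = 1/2 * ?D" by (simp add: w_def exp_minus)
    finally show "dist (\<Phi> z1 x') (\<Phi> z2 x') \<le> 1/2 * dist z1 z2"
      using wpos[of x] unfolding ap x_def[symmetric]
      by (simp add: G_def dist_real_def abs_mult right_diff_distrib[symmetric])
  qed
  have "\<exists>!z. \<Phi> z = z"
    by (rule banach_fix_type[of "1/2"]) (use contr in auto)
  then obtain z where z: "\<Phi> z = z" by blast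
  have zx: "z x = w x * (\<theta>0 + integral {c..x} (F z))" if "x \<in> {c..d}" for x
    using fun_cong[OF ap[of z], of x] cl(2)[OF that] by (simp add: z G_def)
  define \<theta> where "\<theta> = (\<lambda>x. \<theta>0 + integral {c..x} (F z))"
  have "primitive_on c d \<theta> (F z)"
    unfolding \<theta>_def by (intro primitive_on_integral Fint continuous_on_apply_bcontfun)
  then have "primitive_on c d \<theta> (\<lambda>t. P + Q t * (sin (\<theta> t))\<^sup>2)"
  proof (rule primitive_on_cong)
    fix x assume "x \<in> {c..d}"
    then have "z x / w x = \<theta> x" using zx[of x] wpos[of x] by (simp add: \<theta>_def)
    then show "F z x = P + Q x * (sin (\<theta> x))\<^sup>2" by (simp add: F_def)
  qed simp
  moreover have "\<theta> c = \<theta>0" by (simp add: \<theta>_def)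
  ultimately show ?thesis using that by (simp add: angle_solution_def)
qed

text \<open>The difference of two angles satisfies a scalar linear equation \<open>\<delta>' = k \<delta> + g\<close> with
  \<open>\<bar>k\<bar> \<le> \<bar>Q1\<bar>\<close>; uniqueness, monotonicity and continuous dependence are all read off
  from its integrating factor.\<close>

lemma angle_difference:
  assumes s1: "angle_solution c d P1 Q1 \<theta>1" and s2: "angle_solution c d P2 Q2 \<theta>2"
    and Q1: "Q1 absolutely_integrable_on {c..d}" and "c \<le> d"
  obtains K where "continuous_on {c..d} K" "K c = 0"
    "\<And>x. x \<in> {c..d} \<Longrightarrow> \<bar>K x\<bar> \<le> integral {c..d} (\<lambda>t. \<bar>Q1 t\<bar>)"
    "primitive_on c d (\<lambda>x. (\<theta>2 x - \<theta>1 x) * exp (- K x))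
       (\<lambda>x. ((P2 - P1) + (Q2 x - Q1 x) * (sin (\<theta>2 x))\<^sup>2) * exp (- K x))"
proof -
  note c1 = angle_solution_continuous[OF s1] and c2 = angle_solution_continuous[OF s2]
  \<comment> \<open>where the angles agree, \<open>m\<close> is \<open>0 / 0 = 0\<close>, which is harmless since \<open>m\<close> is multiplied by
    their difference\<close>
  define m where "m = (\<lambda>t. ((sin (\<theta>2 t))\<^sup>2 - (sin (\<theta>1 t))\<^sup>2) / (\<theta>2 t - \<theta>1 t))"
  define k where "k = (\<lambda>t. m t * Q1 t)"
  have m1: "\<bar>m t\<bar> \<le> 1" for t
  proof (cases "\<theta>2 t = \<theta>1 t")
    case False
    then have "\<bar>\<theta>2 t - \<theta>1 t\<bar> > 0" by simp
    then show ?thesis using sin_squared_lipschitz[of "\<theta>2 t" "\<theta>1 t"]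
      by (simp add: m_def abs_divide)
  qed (simp add: m_def)
  have m2: "m t * (\<theta>2 t - \<theta>1 t) = (sin (\<theta>2 t))\<^sup>2 - (sin (\<theta>1 t))\<^sup>2" for t
    by (cases "\<theta>2 t = \<theta>1 t") (auto simp: m_def)
  have mm: "m \<in> borel_measurable (lebesgue_on {c..d})"
    unfolding m_def
    by (intro borel_measurable_divide continuous_imp_measurable_on_sets_lebesgue continuous_intros c1 c2) auto
  have k: "k absolutely_integrable_on {c..d}"
    unfolding k_def
    by (rule absolutely_integrable_bounded_measurable_product_real[OF mm _ _ Q1])
      (use m1 in \<open>auto simp: bounded_iff\<close>)
  define K where "K = (\<lambda>x. 0 + integral {c..x} k)"
  have Kp: "primitive_on c d K k" unfolding K_def using k by (rule primitive_on_integral)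
  have aQ: "(\<lambda>t. \<bar>Q1 t\<bar>) absolutely_integrable_on {c..d}" using Q1 by (rule set_integrable_abs)
  show ?thesis
  proof (rule that)
    show "continuous_on {c..d} K" using Kp by (rule primitive_on_continuous)
    show "K c = 0" by (simp add: K_def)
    show "\<bar>K x\<bar> \<le> integral {c..d} (\<lambda>t. \<bar>Q1 t\<bar>)" if x: "x \<in> {c..d}" for x
    proof -
      have ki: "k integrable_on {c..x}" and qi: "(\<lambda>t. \<bar>Q1 t\<bar>) integrable_on {c..x}"
        using abs_int_imp_int[OF abs_int_subinterval[OF k], of c x] 
          abs_int_imp_int[OF abs_int_subinterval[OF aQ], of c x] x by simp_all
      have "\<bar>K x\<bar> = norm (integral {c..x} k)" by (simp add: K_def)
      also have "\<dots> \<le> integral {c..x} (\<lambda>t. \<bar>Q1 t\<bar>)"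
        using m1 by (intro integral_norm_bound_integral ki qi) (auto simp: k_def abs_mult intro: mult_left_le_one_le)
      also have "\<dots> \<le> integral {c..d} (\<lambda>t. \<bar>Q1 t\<bar>)"
        using x by (intro integral_subset_le qi abs_int_imp_int[OF aQ]) auto
      finally show ?thesis .
    qed
    have Ep: "primitive_on c d (\<lambda>x. exp (- K x)) (\<lambda>x. - exp (- K x) * k x)"
    proof (rule primitive_on_compose_UNIV[OF Kp])
      show "((\<lambda>y. exp (- y)) has_real_derivative - exp (- y)) (at y)" for y :: real
        by (auto intro!: derivative_eq_intros)
    qed (intro continuous_intros)
    have "primitive_on c d (\<lambda>x. (\<theta>2 x - \<theta>1 x) * exp (- K x))
       (\<lambda>x. ((P2 + Q2 x * (sin (\<theta>2 x))\<^sup>2) - (P1 + Q1 x * (sin (\<theta>1 x))\<^sup>2)) * exp (- K x)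
          + (\<theta>2 x - \<theta>1 x) * (- exp (- K x) * k x))"
      using s1 s2 unfolding angle_solution_def by (intro primitive_on_mult primitive_on_diff_fun Ep)
    then show "primitive_on c d (\<lambda>x. (\<theta>2 x - \<theta>1 x) * exp (- K x))
       (\<lambda>x. ((P2 - P1) + (Q2 x - Q1 x) * (sin (\<theta>2 x))\<^sup>2) * exp (- K x))"
    proof (rule primitive_on_cong)
      fix x
      have "(\<theta>2 x - \<theta>1 x) * (exp (- K x) * k x) = exp (- K x) * Q1 x * (m x * (\<theta>2 x - \<theta>1 x))"
        by (simp add: k_def)
      also have "\<dots> = exp (- K x) * Q1 x * ((sin (\<theta>2 x))\<^sup>2 - (sin (\<theta>1 x))\<^sup>2)" by (simp only: m2)
      finally show "((P2 + Q2 x * (sin (\<theta>2 x))\<^sup>2) - (P1 + Q1 x * (sin (\<theta>1 x))\<^sup>2)) * exp (- K x)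
          + (\<theta>2 x - \<theta>1 x) * (- exp (- K x) * k x) =
          ((P2 - P1) + (Q2 x - Q1 x) * (sin (\<theta>2 x))\<^sup>2) * exp (- K x)"
        by (simp add: algebra_simps)
    qed simp
  qed
qed

lemma angle_solution_strict_order:
  assumes "angle_solution c d P Q \<theta>1" "angle_solution c d P Q \<theta>2"
    "Q absolutely_integrable_on {c..d}" "\<theta>1 c < \<theta>2 c" "x \<in> {c..d}"
  shows "\<theta>1 x < \<theta>2 x"
proof -
  obtain K where K: "K c = 0" "primitive_on c d (\<lambda>x. (\<theta>2 x - \<theta>1 x) * exp (- K x))
       (\<lambda>x. ((P - P) + (Q x - Q x) * (sin (\<theta>2 x))\<^sup>2) * exp (- K x))"
    using angle_difference[OF assms(1,2,3)] assms(5) by auto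
  have "(\<theta>2 x - \<theta>1 x) * exp (- K x) = \<theta>2 c - \<theta>1 c"
    using primitive_onD[OF K(2) assms(5)] K(1) by simp
  then have "(\<theta>2 x - \<theta>1 x) * exp (- K x) > 0" using assms by simp
  then show ?thesis by (simp add: zero_less_mult_iff)
qed

lemma angle_solution_unique:
  assumes "angle_solution c d P Q \<theta>1" "angle_solution c d P Q \<theta>2"
    "Q absolutely_integrable_on {c..d}" "\<theta>1 c = \<theta>2 c" "x \<in> {c..d}"
  shows "\<theta>1 x = \<theta>2 x"
proof -
  obtain K where K: "K c = 0" "primitive_on c d (\<lambda>x. (\<theta>2 x - \<theta>1 x) * exp (- K x))
       (\<lambda>x. ((P - P) + (Q x - Q x) * (sin (\<theta>2 x))\<^sup>2) * exp (- K x))"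
    using angle_difference[OF assms(1,2,3)] assms(5) by auto
  have "(\<theta>2 x - \<theta>1 x) * exp (- K x) = \<theta>2 c - \<theta>1 c"
    using primitive_onD[OF K(2) assms(5)] K(1) by simp
  then show ?thesis using assms by simp
qed

lemma angle_solution_stable:
  assumes s1: "angle_solution c d P Q1 \<theta>1" and s2: "angle_solution c d P Q2 \<theta>2"
    and Q1: "Q1 absolutely_integrable_on {c..d}" and Q2: "Q2 absolutely_integrable_on {c..d}"
    and x: "x \<in> {c..d}"
  defines "M \<equiv> integral {c..d} (\<lambda>t. \<bar>Q1 t\<bar>)"
  shows "\<bar>\<theta>2 x - \<theta>1 x\<bar> \<le> exp (2 * M) * (\<bar>\<theta>2 c - \<theta>1 c\<bar> + integral {c..d} (\<lambda>t. \<bar>Q2 t - Q1 t\<bar>))"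
proof -
  obtain K where K: "K c = 0" "\<And>x. x \<in> {c..d} \<Longrightarrow> \<bar>K x\<bar> \<le> M"
    "primitive_on c d (\<lambda>x. (\<theta>2 x - \<theta>1 x) * exp (- K x))
       (\<lambda>x. ((P - P) + (Q2 x - Q1 x) * (sin (\<theta>2 x))\<^sup>2) * exp (- K x))"
    using angle_difference[OF s1 s2 Q1] x unfolding M_def by auto
  define g where "g = (\<lambda>x. (Q2 x - Q1 x) * (sin (\<theta>2 x))\<^sup>2 * exp (- K x))"
  have Kp: "primitive_on c d (\<lambda>x. (\<theta>2 x - \<theta>1 x) * exp (- K x)) g"
    using K(3) by (simp add: g_def)
  have M0: "M \<ge> 0" using K(2)[OF x] by linarith
  have D: "(\<lambda>t. \<bar>Q2 t - Q1 t\<bar>) absolutely_integrable_on {c..d}"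
    using Q1 Q2 by (intro set_integrable_abs set_integral_diff(1))
  have gi: "g integrable_on {c..x}" and Di: "(\<lambda>t. \<bar>Q2 t - Q1 t\<bar>) integrable_on {c..x}"
    using abs_int_imp_int[OF abs_int_subinterval[OF primitive_on_abs_int[OF Kp]], of c x] 
          abs_int_imp_int[OF abs_int_subinterval[OF D], of c x] x by simp_all
  have gb: "\<bar>g t\<bar> \<le> exp M * \<bar>Q2 t - Q1 t\<bar>" if "t \<in> {c..x}" for t
  proof -
    have "\<bar>g t\<bar> = \<bar>Q2 t - Q1 t\<bar> * ((sin (\<theta>2 t))\<^sup>2 * exp (- K t))"
      by (simp add: g_def abs_mult)
    also have "(sin (\<theta>2 t))\<^sup>2 * exp (- K t) \<le> 1 * exp M"
      using K(2)[of t] that x by (intro mult_mono) (auto simp: abs_square_le_1)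
    finally show ?thesis by (simp add: mult_left_mono mult.commute[of "exp M"])
  qed
  have "\<bar>integral {c..x} g\<bar> \<le> integral {c..x} (\<lambda>t. exp M * \<bar>Q2 t - Q1 t\<bar>)"
    using integral_norm_bound_integral[OF gi integrable_on_mult_right[OF Di], of "exp M"] gb by simp
  also have "\<dots> \<le> integral {c..d} (\<lambda>t. exp M * \<bar>Q2 t - Q1 t\<bar>)"
    using x by (intro integral_subset_le integrable_on_mult_right Di abs_int_imp_int[OF D]) auto
  also have "\<dots> = exp M * integral {c..d} (\<lambda>t. \<bar>Q2 t - Q1 t\<bar>)" by simp
  finally have gI: "\<bar>integral {c..x} g\<bar> \<le> exp M * integral {c..d} (\<lambda>t. \<bar>Q2 t - Q1 t\<bar>)" .
  have "(\<theta>2 x - \<theta>1 x) * exp (- K x) = \<theta>2 c - \<theta>1 c + integral {c..x} g"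
    using primitive_onD[OF Kp x] K(1) by simp
  then have "\<theta>2 x - \<theta>1 x = exp (K x) * (\<theta>2 c - \<theta>1 c + integral {c..x} g)"
    by (simp add: exp_minus field_simps)
  then have "\<bar>\<theta>2 x - \<theta>1 x\<bar> = exp (K x) * \<bar>\<theta>2 c - \<theta>1 c + integral {c..x} g\<bar>"
    by (simp add: abs_mult)
  also have "\<dots> \<le> exp M * (exp M * (\<bar>\<theta>2 c - \<theta>1 c\<bar> + integral {c..d} (\<lambda>t. \<bar>Q2 t - Q1 t\<bar>)))"
  proof (rule mult_mono)
    show "exp (K x) \<le> exp M" using K(2)[OF x] by simp
    have "\<bar>\<theta>2 c - \<theta>1 c\<bar> \<le> exp M * \<bar>\<theta>2 c - \<theta>1 c\<bar>"
      using M0 by (simp add: mult_le_cancel_right1)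
    then show "\<bar>\<theta>2 c - \<theta>1 c + integral {c..x} g\<bar> \<le> exp M * (\<bar>\<theta>2 c - \<theta>1 c\<bar> + integral {c..d} (\<lambda>t. \<bar>Q2 t - Q1 t\<bar>))"
      using gI by (simp add: distrib_left)
  qed auto
  finally show ?thesis by (simp add: mult_exp_exp mult.assoc[symmetric] exp_add[symmetric])
qed

lemma angle_solution_mono:
  assumes s1: "angle_solution c d P1 Q1 \<theta>1" and s2: "angle_solution c d P2 Q2 \<theta>2"
    and Q1: "Q1 absolutely_integrable_on {c..d}"
    and le: "P1 \<le> P2" "AE t in lebesgue. t \<in> {c..d} \<longrightarrow> Q1 t \<le> Q2 t" "\<theta>1 c \<le> \<theta>2 c"
    and x: "x \<in> {c..d}"
  shows "\<theta>1 x \<le> \<theta>2 x"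
proof -
  obtain K where K: "K c = 0" "primitive_on c d (\<lambda>x. (\<theta>2 x - \<theta>1 x) * exp (- K x))
       (\<lambda>x. ((P2 - P1) + (Q2 x - Q1 x) * (sin (\<theta>2 x))\<^sup>2) * exp (- K x))"
    using angle_difference[OF s1 s2 Q1] x by auto
  have "(\<theta>2 c - \<theta>1 c) * exp (- K c) \<le> (\<theta>2 x - \<theta>1 x) * exp (- K x)"
    by (rule primitive_on_mono[OF K(2)]) (use le x in \<open>auto elim!: eventually_mono\<close>)
  then have "0 \<le> (\<theta>2 x - \<theta>1 x) * exp (- K x)" using K(1) le by simp
  then show ?thesis by (simp add: zero_le_mult_iff)
qed

text \<open>Where \<open>sin \<theta>\<close> vanishes the angle has slope \<open>P \<noteq> 0\<close>, so these points are isolated up to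
  a null set.\<close>

lemma angle_solution_zeros_negligible:
  assumes s: "angle_solution c d P Q \<theta>" and "P \<noteq> 0"
  shows "negligible {x \<in> {c..d}. sin (\<theta> x) = 0}"
proof -
  obtain N where N: "negligible N"
    "\<And>x. x \<in> {c<..<d} - N \<Longrightarrow> (\<theta> has_real_derivative P + Q x * (sin (\<theta> x))\<^sup>2) (at x)"
    using primitive_on_derivative[OF s[unfolded angle_solution_def]] by blast
  let ?S = "{x \<in> {c<..<d} - N. sin (\<theta> x) = 0}"
  have "negligible {x \<in> ?S. sin (\<theta> x) \<in> {0}}"
  proof (rule negligible_differentiable_vimage[where f' = "\<lambda>x h. cos (\<theta> x) * P * h"])
    fix x assume x: "x \<in> ?S"
    then have "cos (\<theta> x) \<noteq> 0" using sin_cos_squared_add[of "\<theta> x"] by auto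
    then show "inj (\<lambda>h. cos (\<theta> x) * P * h)" using \<open>P \<noteq> 0\<close> by (auto intro!: injI)
    have "((\<lambda>x. sin (\<theta> x)) has_real_derivative cos (\<theta> x) * P) (at x)"
      using N(2)[of x] x by (auto intro!: derivative_eq_intros)
    then show "((\<lambda>x. sin (\<theta> x)) has_derivative (\<lambda>h. cos (\<theta> x) * P * h)) (at x within ?S)"
      by (simp add: has_field_derivative_def has_derivative_at_withinI)
  qed simp
  then have "negligible (?S \<union> (N \<union> {c,d}))" using N(1) by simp
  then show ?thesis by (rule negligible_subset) auto
qed

text \<open>A nondecreasing function with equal end values is constant, so its derivative is zero.\<close>

lemma primitive_on_strict_growth:
  assumes p: "primitive_on c d f g" and "c \<le> d"
    and nn: "AE x in lebesgue. x \<in> {c..d} \<longrightarrow> 0 \<le> g x"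
    and pos: "\<not> (AE x in lebesgue. x \<in> {c..d} \<longrightarrow> g x = 0)"
  shows "f c < f d"
proof (rule ccontr)
  assume "\<not> f c < f d"
  moreover have mono: "f s \<le> f t" if "c \<le> s" "s \<le> t" "t \<le> d" for s t
    using primitive_on_mono[OF p nn that] .
  ultimately have eq: "f x = f c" if "x \<in> {c..d}" for x
  proof -
    have "f c \<le> f x" "f x \<le> f d" using mono that by simp_all
    with \<open>\<not> f c < f d\<close> show ?thesis by linarith
  qed
  obtain N where N: "negligible N" "\<And>x. x \<in> {c<..<d} - N \<Longrightarrow> (f has_real_derivative g x) (at x)"
    using primitive_on_derivative[OF p] by blast
  have "g x = 0" if x: "x \<in> {c<..<d} - N" for x
  proof (rule DERIV_unique[OF N(2)[OF x]])
    have "((\<lambda>_. f c) has_real_derivative 0) (at x)" by simp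
    then show "(f has_real_derivative 0) (at x)"
    proof (rule has_field_derivative_transform_within_open[of _ _ _ "{c<..<d}"])
      show "f c = f y" if "y \<in> {c<..<d}" for y using eq[of y] that by simp
    qed (use x in auto)
  qed
  moreover have "N \<union> {c,d} \<in> null_sets lebesgue"
    using N(1) by (simp add: negligible_iff_null_sets[symmetric])
  moreover have "{c..d} - (N \<union> {c,d}) \<subseteq> {c<..<d} - N" by auto
  ultimately have "AE x in lebesgue. x \<in> {c..d} \<longrightarrow> g x = 0"
    by (intro AE_I'[of "N \<union> {c,d}"]) blast+
  then show False using pos by simp
qed

lemma interval_not_null:
  fixes c d :: real
  assumes "c < d"
  shows "\<not> (AE t in lebesgue. t \<notin> {c..d})"
proof
  assume "AE t in lebesgue. t \<notin> {c..d}"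
  then have "{c..d} \<in> null_sets lebesgue" by (subst (asm) AE_iff_null_sets[symmetric]) auto
  then show False using assms negligible_interval(1)[of c d] by (simp add: negligible_iff_null_sets[symmetric])
qed

text \<open>The inhomogeneity \<open>(Q2 - Q1) sin\<^sup>2 \<theta>2\<close> of the difference equation vanishes almost
  everywhere only if \<open>Q1 = Q2\<close> almost everywhere, since the zeros of \<open>sin \<theta>2\<close> form a null set.\<close>

lemma angle_solution_strict_mono_potential:
  assumes s1: "angle_solution c d P Q1 \<theta>1" and s2: "angle_solution c d P Q2 \<theta>2"
    and Q1: "Q1 absolutely_integrable_on {c..d}" and "P \<noteq> 0" "c \<le> d"
    and le: "AE t in lebesgue. t \<in> {c..d} \<longrightarrow> Q1 t \<le> Q2 t" "\<theta>1 c \<le> \<theta>2 c"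
    and ne: "\<not> (AE t in lebesgue. t \<in> {c..d} \<longrightarrow> Q1 t = Q2 t)"
  shows "\<theta>1 d < \<theta>2 d"
proof -
  obtain K where K: "K c = 0" "primitive_on c d (\<lambda>x. (\<theta>2 x - \<theta>1 x) * exp (- K x))
       (\<lambda>x. ((P - P) + (Q2 x - Q1 x) * (sin (\<theta>2 x))\<^sup>2) * exp (- K x))"
    using angle_difference[OF s1 s2 Q1 \<open>c \<le> d\<close>] by blast
  have "(\<theta>2 c - \<theta>1 c) * exp (- K c) < (\<theta>2 d - \<theta>1 d) * exp (- K d)"
  proof (rule primitive_on_strict_growth[OF K(2) \<open>c \<le> d\<close>])
    show "AE x in lebesgue. x \<in> {c..d} \<longrightarrow> 0 \<le> ((P - P) + (Q2 x - Q1 x) * (sin (\<theta>2 x))\<^sup>2) * exp (- K x)"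
      using le(1) by eventually_elim auto
    have Z: "AE x in lebesgue. x \<in> {c..d} \<longrightarrow> sin (\<theta>2 x) \<noteq> 0"
      using angle_solution_zeros_negligible[OF s2 \<open>P \<noteq> 0\<close>]
      by (intro AE_I'[of "{x \<in> {c..d}. sin (\<theta>2 x) = 0}"]) (auto simp: negligible_iff_null_sets)
    show "\<not> (AE x in lebesgue. x \<in> {c..d} \<longrightarrow> ((P - P) + (Q2 x - Q1 x) * (sin (\<theta>2 x))\<^sup>2) * exp (- K x) = 0)"
    proof
      assume "AE x in lebesgue. x \<in> {c..d} \<longrightarrow> ((P - P) + (Q2 x - Q1 x) * (sin (\<theta>2 x))\<^sup>2) * exp (- K x) = 0"
      with Z have "AE x in lebesgue. x \<in> {c..d} \<longrightarrow> Q1 x = Q2 x"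
        by eventually_elim auto
      then show False using ne by simp
    qed
  qed
  then have "0 < (\<theta>2 d - \<theta>1 d) * exp (- K d)"
    using K(1) le(2) by simp
  then show ?thesis by (simp add: zero_less_mult_iff)
qed

lemma angle_solution_add_pi:
  assumes "angle_solution c d P Q \<theta>"
  shows "angle_solution c d P Q (\<lambda>x. \<theta> x + of_int j * pi)"
proof -
  have "(sin (y + of_int j * pi))\<^sup>2 = (sin y)\<^sup>2" for y :: real
  proof -
    have "sin (of_int j * pi) = 0" by (simp add: sin_zero_iff_int2)
    moreover from this have "(cos (of_int j * pi))\<^sup>2 = 1" using sin_cos_squared_add[of "of_int j * pi"] by simp
    ultimately show ?thesis by (simp add: sin_add power_mult_distrib)
  qed
  then show ?thesis
    using primitive_on_add[OF assms[unfolded angle_solution_def] primitive_on_const[of c d "of_int j * pi"]]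
    by (simp add: angle_solution_def)
qed

lemma angle_solution_cong_AE:
  assumes "angle_solution c d P Q \<theta>" "AE t in lebesgue. t \<in> {c..d} \<longrightarrow> Q t = Q' t"
  shows "angle_solution c d P Q' \<theta>"
  using assms unfolding angle_solution_def by (auto elim!: primitive_on_spike eventually_mono)

text \<open>Multiples of \<open>\<pi>\<close> are crossed upwards only: the constant \<open>0\<close> solves the equation with
  \<open>P = 0\<close>, and the larger \<open>P\<close> makes the difference grow strictly.\<close>

lemma angle_solution_positive:
  assumes s: "angle_solution c d P Q \<theta>" and Q: "Q absolutely_integrable_on {c..d}"
    and "P > 0" "\<theta> c = 0" "c < d"
  shows "\<theta> d > 0"
proof -
  have s0: "angle_solution c d 0 Q (\<lambda>_. 0)"
    using primitive_on_const[of c d 0] by (simp add: angle_solution_def)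
  obtain K where K: "continuous_on {c..d} K" "K c = 0" "primitive_on c d (\<lambda>x. (\<theta> x - 0) * exp (- K x))
       (\<lambda>x. ((P - 0) + (Q x - Q x) * (sin (\<theta> x))\<^sup>2) * exp (- K x))"
    using angle_difference[OF s0 s Q] \<open>c < d\<close> by auto
  have "(\<theta> c - 0) * exp (- K c) < (\<theta> d - 0) * exp (- K d)"
  proof (rule primitive_on_strict_growth[OF K(3)])
    show "\<not> (AE x in lebesgue. x \<in> {c..d} \<longrightarrow> ((P - 0) + (Q x - Q x) * (sin (\<theta> x))\<^sup>2) * exp (- K x) = 0)"
      using interval_not_null[OF \<open>c < d\<close>] \<open>P > 0\<close> by simp
  qed (use \<open>c < d\<close> \<open>P > 0\<close> in auto)
  then show ?thesis using \<open>\<theta> c = 0\<close> by (simp add: zero_less_mult_iff)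
qed

section \<open>The linear equation and the Pruefer transformation\<close>

definition lin_solution ::
    "real \<Rightarrow> real \<Rightarrow> (real \<Rightarrow> real) \<Rightarrow> (real \<Rightarrow> real) \<Rightarrow> (real \<Rightarrow> real) \<Rightarrow> bool" where
  "lin_solution c d q u v \<longleftrightarrow> primitive_on c d u v \<and> primitive_on c d v (\<lambda>t. - q t * u t)"

lemma lin_solution_combination:
  assumes "lin_solution c d q u1 v1" "lin_solution c d q u2 v2"
  shows "lin_solution c d q (\<lambda>t. \<alpha> * u1 t + \<beta> * u2 t) (\<lambda>t. \<alpha> * v1 t + \<beta> * v2 t)"
proof -
  have "primitive_on c d (\<lambda>t. \<alpha> * v1 t + \<beta> * v2 t) (\<lambda>t. \<alpha> * (- q t * u1 t) + \<beta> * (- q t * u2 t))"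
    using assms unfolding lin_solution_def by (intro primitive_on_add primitive_on_cmult) auto
  then have "primitive_on c d (\<lambda>t. \<alpha> * v1 t + \<beta> * v2 t) (\<lambda>t. - q t * (\<alpha> * u1 t + \<beta> * u2 t))"
    by (rule primitive_on_cong) (auto simp: algebra_simps)
  then show ?thesis
    using assms unfolding lin_solution_def by (intro conjI primitive_on_add primitive_on_cmult) auto
qed

lemma wronskian_constant:
  assumes "lin_solution c d q u1 v1" "lin_solution c d q u2 v2" "x \<in> {c..d}"
  shows "u1 x * v2 x - v1 x * u2 x = u1 c * v2 c - v1 c * u2 c"
proof -
  have "primitive_on c d (\<lambda>x. u1 x * v2 x - v1 x * u2 x)
    (\<lambda>x. (v1 x * v2 x + u1 x * (- q x * u2 x)) - ((- q x * u1 x) * u2 x + v1 x * v2 x))"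
    using assms unfolding lin_solution_def by (intro primitive_on_mult primitive_on_diff_fun) auto
  then have "primitive_on c d (\<lambda>x. u1 x * v2 x - v1 x * u2 x) (\<lambda>x. 0)"
    by (rule primitive_on_cong) (auto simp: algebra_simps)
  from primitive_onD[OF this assms(3)] show ?thesis by simp
qed

lemma plane_basis:
  fixes a\<^sub>1 b\<^sub>1 a\<^sub>2 b\<^sub>2 x y :: real
  assumes "a\<^sub>1 * b\<^sub>2 - b\<^sub>1 * a\<^sub>2 \<noteq> 0"
  obtains \<alpha> \<beta> where "x = \<alpha> * a\<^sub>1 + \<beta> * a\<^sub>2" "y = \<alpha> * b\<^sub>1 + \<beta> * b\<^sub>2"
proof -
  define w where "w = a\<^sub>1 * b\<^sub>2 - b\<^sub>1 * a\<^sub>2"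
  have "w * x = (x * b\<^sub>2 - y * a\<^sub>2) * a\<^sub>1 + (a\<^sub>1 * y - b\<^sub>1 * x) * a\<^sub>2"
    "w * y = (x * b\<^sub>2 - y * a\<^sub>2) * b\<^sub>1 + (a\<^sub>1 * y - b\<^sub>1 * x) * b\<^sub>2"
    by (simp_all add: w_def algebra_simps)
  then have "w * x / w = (x * b\<^sub>2 - y * a\<^sub>2) / w * a\<^sub>1 + (a\<^sub>1 * y - b\<^sub>1 * x) / w * a\<^sub>2"
    "w * y / w = (x * b\<^sub>2 - y * a\<^sub>2) / w * b\<^sub>1 + (a\<^sub>1 * y - b\<^sub>1 * x) / w * b\<^sub>2"
    by (simp_all only: add_divide_distrib times_divide_eq_left)
  moreover have "w \<noteq> 0" using assms by (simp add: w_def)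
  ultimately show ?thesis
    by (intro that[of "(x * b\<^sub>2 - y * a\<^sub>2) / w" "(a\<^sub>1 * y - b\<^sub>1 * x) / w"]) simp_all
qed

text \<open>The scale \<open>\<sigma>\<close> of the angle is a free parameter. Whether the rotation of a solution is a
  multiple of \<open>\<pi>\<close> does not depend on it, but each estimate has a scale that suits it: the potential
  \<open>\<sigma>\<^sup>2\<close> turns the angle of scale \<open>\<sigma>\<close> at constant speed.\<close>

locale angle_scale =
  fixes T \<sigma> :: real
  assumes T_pos: "T > 0" and \<sigma>_pos: "\<sigma> > 0"
begin

abbreviation coeff :: "(real \<Rightarrow> real) \<Rightarrow> real \<Rightarrow> real" where
  "coeff q \<equiv> \<lambda>t. q t / \<sigma> - \<sigma>"

definition pruefer_angle :: "real \<Rightarrow> real \<Rightarrow> (real \<Rightarrow> real) \<Rightarrow> (real \<Rightarrow> real) \<Rightarrow> bool" where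
  "pruefer_angle c d q \<theta> \<longleftrightarrow> angle_solution c d \<sigma> (coeff q) \<theta>"

lemma coeff_abs_int:
  assumes "q absolutely_integrable_on {c..d}"
  shows "coeff q absolutely_integrable_on {c..d}"
  using assms \<sigma>_pos by (intro set_integral_diff(1)) auto

text \<open>The amplitude satisfies \<open>\<rho>'/\<rho> = (\<sigma> - q/\<sigma>) sin \<theta> cos \<theta>\<close>, so it is the exponential of an
  integral.\<close>

lemma angle_to_solution:
  assumes s: "pruefer_angle c d q \<theta>" and q: "q absolutely_integrable_on {c..d}"
  obtains \<rho> where "\<And>x. \<rho> x > 0" "\<rho> c = 1"
    "lin_solution c d q (\<lambda>x. \<rho> x * sin (\<theta> x)) (\<lambda>x. \<sigma> * \<rho> x * cos (\<theta> x))"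
proof -
  have th: "primitive_on c d \<theta> (\<lambda>t. \<sigma> + coeff q t * (sin (\<theta> t))\<^sup>2)"
    using s by (simp add: pruefer_angle_def angle_solution_def)
  note \<theta>c = primitive_on_continuous[OF th]
  define g where "g = (\<lambda>t. (- (sin (\<theta> t) * cos (\<theta> t))) * coeff q t)"
  have g: "g absolutely_integrable_on {c..d}"
    unfolding g_def
    by (intro abs_int_mult_continuous continuous_intros \<theta>c coeff_abs_int q)
  define L where "L = (\<lambda>x. 0 + integral {c..x} g)"
  have L: "primitive_on c d L g" unfolding L_def by (rule primitive_on_integral) (rule g)
  define \<rho> where "\<rho> = (\<lambda>x. exp (L x))"
  have \<rho>: "primitive_on c d \<rho> (\<lambda>x. exp (L x) * g x)"
    unfolding \<rho>_def by (rule primitive_on_compose_UNIV[OF L])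
      (auto intro!: derivative_eq_intros continuous_intros)
  have S: "primitive_on c d (\<lambda>x. sin (\<theta> x)) (\<lambda>x. cos (\<theta> x) * (\<sigma> + coeff q x * (sin (\<theta> x))\<^sup>2))"
    by (rule primitive_on_compose_UNIV[OF th]) (auto intro!: derivative_eq_intros continuous_intros)
  have C: "primitive_on c d (\<lambda>x. cos (\<theta> x)) (\<lambda>x. - sin (\<theta> x) * (\<sigma> + coeff q x * (sin (\<theta> x))\<^sup>2))"
    by (rule primitive_on_compose_UNIV[OF th]) (auto intro!: derivative_eq_intros continuous_intros)
  have sq: "(cos y)\<^sup>2 = 1 - (sin y)\<^sup>2" for y :: real by (rule cos_squared_eq)
  have "primitive_on c d (\<lambda>x. \<rho> x * sin (\<theta> x)) (\<lambda>x. \<sigma> * \<rho> x * cos (\<theta> x))"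
  proof (rule primitive_on_cong[OF primitive_on_mult[OF \<rho> S]])
    fix x
    have "g x * sin (\<theta> x) + cos (\<theta> x) * (\<sigma> + coeff q x * (sin (\<theta> x))\<^sup>2) = \<sigma> * cos (\<theta> x)"
      by (simp add: g_def power2_eq_square algebra_simps)
    then have "exp (L x) * (g x * sin (\<theta> x) + cos (\<theta> x) * (\<sigma> + coeff q x * (sin (\<theta> x))\<^sup>2)) = exp (L x) * (\<sigma> * cos (\<theta> x))"
      by (simp only:)
    then show "exp (L x) * g x * sin (\<theta> x) + \<rho> x * (cos (\<theta> x) * (\<sigma> + coeff q x * (sin (\<theta> x))\<^sup>2)) = \<sigma> * \<rho> x * cos (\<theta> x)"
      by (simp add: \<rho>_def algebra_simps)
  qed simp
  moreover have "primitive_on c d (\<lambda>x. \<sigma> * \<rho> x * cos (\<theta> x)) (\<lambda>x. - q x * (\<rho> x * sin (\<theta> x)))"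
  proof (rule primitive_on_cong[OF primitive_on_cmult[OF primitive_on_mult[OF \<rho> C], of \<sigma>]])
    fix x
    have alg: "- (s * c) * Q * c + - s * (\<sigma> + Q * s\<^sup>2) = - s * (Q * (c\<^sup>2 + s\<^sup>2) + \<sigma>)" for s c Q :: real
      by (simp add: power2_eq_square algebra_simps)
    have "g x * cos (\<theta> x) + - sin (\<theta> x) * (\<sigma> + coeff q x * (sin (\<theta> x))\<^sup>2)
      = - sin (\<theta> x) * (coeff q x * ((cos (\<theta> x))\<^sup>2 + (sin (\<theta> x))\<^sup>2) + \<sigma>)"
      unfolding g_def by (rule alg)
    also have "\<dots> = - sin (\<theta> x) * (q x / \<sigma>)" by simp
    finally have *: "g x * cos (\<theta> x) + - sin (\<theta> x) * (\<sigma> + coeff q x * (sin (\<theta> x))\<^sup>2) = - sin (\<theta> x) * (q x / \<sigma>)" .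
    have "\<sigma> * (exp (L x) * g x * cos (\<theta> x) + \<rho> x * (- sin (\<theta> x) * (\<sigma> + coeff q x * (sin (\<theta> x))\<^sup>2)))
      = \<sigma> * exp (L x) * (g x * cos (\<theta> x) + - sin (\<theta> x) * (\<sigma> + coeff q x * (sin (\<theta> x))\<^sup>2))"
      by (simp add: \<rho>_def algebra_simps)
    also have "\<dots> = \<sigma> * exp (L x) * (- sin (\<theta> x) * (q x / \<sigma>))" by (simp only: *)
    also have "\<dots> = - q x * (\<rho> x * sin (\<theta> x))" using \<sigma>_pos by (simp add: \<rho>_def)
    finally show "\<sigma> * (exp (L x) * g x * cos (\<theta> x) + \<rho> x * (- sin (\<theta> x) * (\<sigma> + coeff q x * (sin (\<theta> x))\<^sup>2)))
      = - q x * (\<rho> x * sin (\<theta> x))" .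
  qed simp
  ultimately have "lin_solution c d q (\<lambda>x. \<rho> x * sin (\<theta> x)) (\<lambda>x. \<sigma> * \<rho> x * cos (\<theta> x))"
    by (simp add: lin_solution_def)
  moreover have "\<rho> c = 1" by (simp add: \<rho>_def L_def)
  moreover have "\<rho> x > 0" for x by (simp add: \<rho>_def)
  ultimately show ?thesis using that by blast
qed

lemma pruefer_angle_exists:
  assumes "q absolutely_integrable_on {c..d}" "c \<le> d"
  obtains \<theta> where "pruefer_angle c d q \<theta>" "\<theta> c = \<theta>0"
  using angle_solution_exists[OF coeff_abs_int[OF assms(1)] assms(2)] unfolding pruefer_angle_def by blast

lemma lin_solution_with_angle:
  assumes "q absolutely_integrable_on {c..d}" "c \<le> d"
  obtains u v where "lin_solution c d q u v" "u c = sin \<phi>" "v c = \<sigma> * cos \<phi>"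
proof -
  obtain \<theta> where "pruefer_angle c d q \<theta>" "\<theta> c = \<phi>" using pruefer_angle_exists[OF assms] .
  with angle_to_solution[OF this(1) assms(1)] show ?thesis using that by (metis mult.right_neutral mult_1)
qed

text \<open>The Wronskians with two independent solutions vanish.\<close>

lemma lin_solution_zero_unique:
  assumes s: "lin_solution c d q u v" and q: "q absolutely_integrable_on {c..d}"
    and "u c = 0" "v c = 0" "x \<in> {c..d}"
  shows "u x = 0 \<and> v x = 0"
proof -
  have cd: "c \<le> d" using assms by auto
  obtain u1 v1 where s1: "lin_solution c d q u1 v1" "u1 c = sin 0" "v1 c = \<sigma> * cos 0"
    using lin_solution_with_angle[OF q cd, of 0] .
  obtain u2 v2 where s2: "lin_solution c d q u2 v2" "u2 c = sin (pi/2)" "v2 c = \<sigma> * cos (pi/2)"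
    using lin_solution_with_angle[OF q cd, of "pi/2"] .
  have w: "u1 x * v2 x - v1 x * u2 x = - \<sigma>"
    using wronskian_constant[OF s1(1) s2(1) assms(5)] s1 s2 by simp
  have w1: "u1 x * v x - v1 x * u x = 0" and w2: "u2 x * v x - v2 x * u x = 0"
    using wronskian_constant[OF s1(1) s assms(5)] wronskian_constant[OF s2(1) s assms(5)] assms by auto
  have "u x * (u1 x * v2 x - v1 x * u2 x) = u2 x * (u1 x * v x - v1 x * u x) - u1 x * (u2 x * v x - v2 x * u x)"
    by (simp add: algebra_simps)
  then have "u x = 0" using w w1 w2 \<sigma>_pos by simp
  moreover have "v x * (u1 x * v2 x - v1 x * u2 x) = v2 x * (u1 x * v x - v1 x * u x) - v1 x * (u2 x * v x - v2 x * u x)"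
    by (simp add: algebra_simps)
  then have "v x = 0" using w w1 w2 \<sigma>_pos by simp
  ultimately show ?thesis by simp
qed

lemma lin_solution_unique:
  assumes "lin_solution c d q u1 v1" "lin_solution c d q u2 v2" "q absolutely_integrable_on {c..d}"
    and "u1 c = u2 c" "v1 c = v2 c" "x \<in> {c..d}"
  shows "u1 x = u2 x \<and> v1 x = v2 x"
  using lin_solution_zero_unique[OF lin_solution_combination[OF assms(1,2), of 1 "-1"] assms(3) _ _ assms(6)] assms(4,5)
  by simp

lemma polar_coordinates:
  assumes "a \<noteq> 0 \<or> b \<noteq> 0"
  obtains r \<phi> where "r > 0" "a = r * sin \<phi>" "b = \<sigma> * (r * cos \<phi>)"
proof -
  define r where "r = sqrt (a\<^sup>2 + (b / \<sigma>)\<^sup>2)"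
  have pos: "a\<^sup>2 + (b / \<sigma>)\<^sup>2 > 0"
    using assms \<sigma>_pos by (auto simp: sum_power2_gt_zero_iff)
  then have r: "r > 0" "r\<^sup>2 = a\<^sup>2 + (b / \<sigma>)\<^sup>2" by (auto simp: r_def)
  have "((b / \<sigma>) / r)\<^sup>2 + (a / r)\<^sup>2 = (a\<^sup>2 + (b / \<sigma>)\<^sup>2) / r\<^sup>2"
    by (simp only: power_divide add_divide_distrib add.commute)
  also have "\<dots> = 1" using pos unfolding r(2) by (metis divide_self less_irrefl)
  finally obtain \<phi> where "(b / \<sigma>) / r = cos \<phi>" "a / r = sin \<phi>" using sincos_total_2pi by metis
  then have "a = r * sin \<phi>" "b = \<sigma> * (r * cos \<phi>)" using r(1) \<sigma>_pos by (auto simp: field_simps)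
  with r(1) show ?thesis using that by blast
qed

text \<open>By uniqueness it suffices to match the initial data.\<close>

lemma solution_to_angle:
  assumes s: "lin_solution c d q u v" and q: "q absolutely_integrable_on {c..d}" and "c \<le> d"
    and \<phi>: "r > 0" "u c = r * sin \<phi>" "v c = \<sigma> * (r * cos \<phi>)"
  obtains \<theta> \<rho> where "pruefer_angle c d q \<theta>" "\<theta> c = \<phi>" "\<And>x. \<rho> x > 0"
    "\<And>x. x \<in> {c..d} \<Longrightarrow> u x = \<rho> x * sin (\<theta> x)" "\<And>x. x \<in> {c..d} \<Longrightarrow> v x = \<sigma> * (\<rho> x * cos (\<theta> x))"
proof -
  obtain \<theta> where \<theta>: "pruefer_angle c d q \<theta>" "\<theta> c = \<phi>" using pruefer_angle_exists[OF q \<open>c \<le> d\<close>] .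
  obtain \<rho> where \<rho>: "\<And>x. \<rho> x > 0" "\<rho> c = 1"
    "lin_solution c d q (\<lambda>x. \<rho> x * sin (\<theta> x)) (\<lambda>x. \<sigma> * \<rho> x * cos (\<theta> x))"
    using angle_to_solution[OF \<theta>(1) q] by metis
  have 2: "lin_solution c d q (\<lambda>x. r * (\<rho> x * sin (\<theta> x)) + 0 * (\<rho> x * sin (\<theta> x)))
       (\<lambda>x. r * (\<sigma> * \<rho> x * cos (\<theta> x)) + 0 * (\<sigma> * \<rho> x * cos (\<theta> x)))"
    by (rule lin_solution_combination[OF \<rho>(3) \<rho>(3)])
  have "u x = r * \<rho> x * sin (\<theta> x) \<and> v x = \<sigma> * (r * \<rho> x * cos (\<theta> x))" if "x \<in> {c..d}" for x
    using lin_solution_unique[OF s 2 q _ _ that] \<phi> \<rho>(2) \<theta>(2) by (simp add: mult_ac)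
  then show ?thesis
    using that[OF \<theta>, of "\<lambda>x. r * \<rho> x"] \<rho>(1) \<phi>(1) by auto
qed

subsection \<open>The rotation over one period\<close>

text \<open>The increase over \<open>[0, T]\<close> of the angle that starts at \<open>\<phi>\<close>. Existence and uniqueness of that
  angle for integrable \<open>q\<close> make the choice harmless.\<close>

definition rot :: "(real \<Rightarrow> real) \<Rightarrow> real \<Rightarrow> real" where
  "rot q \<phi> = (SOME \<theta>. pruefer_angle 0 T q \<theta> \<and> \<theta> 0 = \<phi>) T - \<phi>"

lemma rot_eq:
  assumes "pruefer_angle 0 T q \<theta>" "q absolutely_integrable_on {0..T}"
  shows "rot q (\<theta> 0) = \<theta> T - \<theta> 0"
proof -
  define \<theta>' where "\<theta>' = (SOME \<theta>'. pruefer_angle 0 T q \<theta>' \<and> \<theta>' 0 = \<theta> 0)"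
  have *: "pruefer_angle 0 T q \<theta>' \<and> \<theta>' 0 = \<theta> 0"
    unfolding \<theta>'_def by (rule someI[of _ \<theta>]) (use assms in simp)
  then have "\<theta>' T = \<theta> T"
    using angle_solution_unique[OF _ _ coeff_abs_int[OF assms(2)], of \<sigma> \<theta>' \<theta> T] assms(1) T_pos
    by (simp add: pruefer_angle_def)
  then show ?thesis by (simp add: rot_def \<theta>'_def)
qed

lemma rot_witness:
  assumes "q absolutely_integrable_on {0..T}"
  obtains \<theta> where "pruefer_angle 0 T q \<theta>" "\<theta> 0 = \<phi>" "\<theta> T = \<phi> + rot q \<phi>"
proof -
  obtain \<theta> where \<theta>: "pruefer_angle 0 T q \<theta>" "\<theta> 0 = \<phi>" using pruefer_angle_exists[OF assms] T_pos by auto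
  then show ?thesis using that[OF \<theta>] rot_eq[OF \<theta>(1) assms] by simp
qed

lemma rot_add_pi:
  assumes q: "q absolutely_integrable_on {0..T}"
  shows "rot q (\<phi> + of_int j * pi) = rot q \<phi>"
proof -
  obtain \<theta> where \<theta>: "pruefer_angle 0 T q \<theta>" "\<theta> 0 = \<phi>" "\<theta> T = \<phi> + rot q \<phi>" using rot_witness[OF q] .
  have "pruefer_angle 0 T q (\<lambda>x. \<theta> x + of_int j * pi)"
    using \<theta>(1) unfolding pruefer_angle_def by (rule angle_solution_add_pi)
  from rot_eq[OF this q] \<theta> show ?thesis by simp
qed

lemma reduce_mod_pi:
  fixes \<phi> :: real
  obtains j :: int where "\<phi> - of_int j * pi \<in> {0..<pi}"
proof
  have "of_int \<lfloor>\<phi> / pi\<rfloor> \<le> \<phi> / pi" "\<phi> / pi < of_int \<lfloor>\<phi> / pi\<rfloor> + 1" by linarith+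
  then have "of_int \<lfloor>\<phi> / pi\<rfloor> * pi \<le> \<phi>" "\<phi> < (of_int \<lfloor>\<phi> / pi\<rfloor> + 1) * pi"
    by (simp_all only: pos_le_divide_eq pos_divide_less_eq pi_gt_zero)
  then show "\<phi> - of_int \<lfloor>\<phi> / pi\<rfloor> * pi \<in> {0..<pi}"
    by (auto simp: distrib_right)
qed

text \<open>Two angles that start less than \<open>\<pi>\<close> apart stay less than \<open>\<pi>\<close> apart.\<close>

lemma rot_oscillation:
  assumes q: "q absolutely_integrable_on {0..T}"
  shows "\<bar>rot q \<phi> - rot q \<psi>\<bar> < pi"
proof -
  obtain j :: int where j: "(\<psi> - \<phi>) - of_int j * pi \<in> {0..<pi}" using reduce_mod_pi[of "\<psi> - \<phi>"] .
  define \<psi>' where "\<psi>' = \<psi> - of_int j * pi"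
  have "rot q \<psi>' = rot q \<psi>" using rot_add_pi[OF q, of \<psi> "-j"] by (simp add: \<psi>'_def)
  have r: "\<phi> \<le> \<psi>'" "\<psi>' < \<phi> + pi" using j by (auto simp: \<psi>'_def)
  obtain \<theta>1 where 1: "pruefer_angle 0 T q \<theta>1" "\<theta>1 0 = \<phi>" "\<theta>1 T = \<phi> + rot q \<phi>" using rot_witness[OF q] .
  obtain \<theta>2 where 2: "pruefer_angle 0 T q \<theta>2" "\<theta>2 0 = \<psi>'" "\<theta>2 T = \<psi>' + rot q \<psi>'" using rot_witness[OF q] .
  have 3: "pruefer_angle 0 T q (\<lambda>x. \<theta>1 x + of_int 1 * pi)"
    using 1(1) unfolding pruefer_angle_def by (rule angle_solution_add_pi)
  have "\<theta>1 T \<le> \<theta>2 T"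
    using angle_solution_mono[OF 1(1)[unfolded pruefer_angle_def] 2(1)[unfolded pruefer_angle_def] coeff_abs_int[OF q], of T]
      r 1 2 T_pos by auto
  moreover have "\<theta>2 T < \<theta>1 T + pi"
    using angle_solution_strict_order[OF 2(1)[unfolded pruefer_angle_def] 3[unfolded pruefer_angle_def] coeff_abs_int[OF q], of T]
      r 1 2 T_pos by auto
  ultimately show ?thesis using 1 2 r \<open>rot q \<psi>' = rot q \<psi>\<close> by linarith
qed

lemma coeff_diff_integral:
  "integral {0..T} (\<lambda>t. \<bar>coeff q2 t - coeff q1 t\<bar>) = integral {0..T} (\<lambda>t. \<bar>q2 t - q1 t\<bar>) / \<sigma>"
proof -
  have "(\<lambda>t. \<bar>coeff q2 t - coeff q1 t\<bar>) = (\<lambda>t. \<bar>q2 t - q1 t\<bar> / \<sigma>)"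
    using \<sigma>_pos by (auto simp: fun_eq_iff diff_divide_distrib[symmetric] abs_divide)
  then show ?thesis by simp
qed

lemma rot_stable:
  assumes q1: "q1 absolutely_integrable_on {0..T}" and q2: "q2 absolutely_integrable_on {0..T}"
  shows "\<bar>rot q2 \<phi> - rot q1 \<phi>\<bar> \<le>
    exp (2 * integral {0..T} (\<lambda>t. \<bar>coeff q1 t\<bar>)) * (integral {0..T} (\<lambda>t. \<bar>q2 t - q1 t\<bar>) / \<sigma>)"
proof -
  obtain \<theta>1 where 1: "pruefer_angle 0 T q1 \<theta>1" "\<theta>1 0 = \<phi>" "\<theta>1 T = \<phi> + rot q1 \<phi>" using rot_witness[OF q1] .
  obtain \<theta>2 where 2: "pruefer_angle 0 T q2 \<theta>2" "\<theta>2 0 = \<phi>" "\<theta>2 T = \<phi> + rot q2 \<phi>" using rot_witness[OF q2] .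
  show ?thesis
    using angle_solution_stable[OF 1(1)[unfolded pruefer_angle_def] 2(1)[unfolded pruefer_angle_def]
        coeff_abs_int[OF q1] coeff_abs_int[OF q2], of T] 1 2 T_pos
    unfolding coeff_diff_integral by simp
qed

lemma rot_continuous:
  assumes q: "q absolutely_integrable_on {0..T}"
  shows "continuous_on UNIV (rot q)"
proof -
  define M where "M = exp (2 * integral {0..T} (\<lambda>t. \<bar>coeff q t\<bar>))"
  have M: "M > 0" by (simp add: M_def)
  have "\<bar>rot q \<psi> - rot q \<phi>\<bar> \<le> (M + 1) * \<bar>\<psi> - \<phi>\<bar>" for \<phi> \<psi>
  proof -
    obtain \<theta>1 where 1: "pruefer_angle 0 T q \<theta>1" "\<theta>1 0 = \<phi>" "\<theta>1 T = \<phi> + rot q \<phi>" using rot_witness[OF q] .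
    obtain \<theta>2 where 2: "pruefer_angle 0 T q \<theta>2" "\<theta>2 0 = \<psi>" "\<theta>2 T = \<psi> + rot q \<psi>" using rot_witness[OF q] .
    have "\<bar>\<theta>2 T - \<theta>1 T\<bar> \<le> M * \<bar>\<psi> - \<phi>\<bar>"
      using angle_solution_stable[OF 1(1)[unfolded pruefer_angle_def] 2(1)[unfolded pruefer_angle_def]
        coeff_abs_int[OF q] coeff_abs_int[OF q], of T] 1 2 T_pos by (simp add: M_def)
    then show ?thesis using 1 2 by (simp add: distrib_right)
  qed
  then have "(M + 1)-lipschitz_on UNIV (rot q)"
    using M by (intro lipschitz_onI) (auto simp: dist_real_def abs_minus_commute)
  then show ?thesis by (rule lipschitz_on_continuous_on)
qed

lemma rot_attains_max:
  assumes q: "q absolutely_integrable_on {0..T}"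
  obtains \<phi> where "\<And>\<psi>. rot q \<psi> \<le> rot q \<phi>"
proof -
  have "\<exists>x\<in>{0..pi}. \<forall>y\<in>{0..pi}. rot q y \<le> rot q x"
    by (rule continuous_attains_sup) (use rot_continuous[OF q] in \<open>auto intro: continuous_on_subset\<close>)
  then obtain x where x: "\<And>y. y \<in> {0..pi} \<Longrightarrow> rot q y \<le> rot q x" by blast
  have "rot q \<psi> \<le> rot q x" for \<psi>
  proof -
    obtain j :: int where "\<psi> - of_int j * pi \<in> {0..<pi}" using reduce_mod_pi .
    then show ?thesis using x[of "\<psi> - of_int j * pi"] rot_add_pi[OF q, of \<psi> "-j"] by auto
  qed
  then show ?thesis using that by blast
qed

lemma rot_attains_min:
  assumes q: "q absolutely_integrable_on {0..T}"
  obtains \<phi> where "\<And>\<psi>. rot q \<phi> \<le> rot q \<psi>"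
proof -
  have "\<exists>x\<in>{0..pi}. \<forall>y\<in>{0..pi}. rot q x \<le> rot q y"
    by (rule continuous_attains_inf) (use rot_continuous[OF q] in \<open>auto intro: continuous_on_subset\<close>)
  then obtain x where x: "\<And>y. y \<in> {0..pi} \<Longrightarrow> rot q x \<le> rot q y" by blast
  have "rot q x \<le> rot q \<psi>" for \<psi>
  proof -
    obtain j :: int where "\<psi> - of_int j * pi \<in> {0..<pi}" using reduce_mod_pi .
    then show ?thesis using x[of "\<psi> - of_int j * pi"] rot_add_pi[OF q, of \<psi> "-j"] by auto
  qed
  then show ?thesis using that by blast
qed

definition max_rot :: "(real \<Rightarrow> real) \<Rightarrow> real" where "max_rot q = Sup (range (rot q))"
definition min_rot :: "(real \<Rightarrow> real) \<Rightarrow> real" where "min_rot q = Inf (range (rot q))"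

lemma max_rot:
  assumes q: "q absolutely_integrable_on {0..T}"
  shows "rot q \<psi> \<le> max_rot q" "\<exists>\<phi>. rot q \<phi> = max_rot q"
proof -
  obtain \<phi> where "\<And>\<psi>. rot q \<psi> \<le> rot q \<phi>" using rot_attains_max[OF q] by blast
  moreover from this have "max_rot q = rot q \<phi>" unfolding max_rot_def by (intro cSup_eq_maximum) auto
  ultimately show "rot q \<psi> \<le> max_rot q" "\<exists>\<phi>. rot q \<phi> = max_rot q" by auto
qed

lemma min_rot:
  assumes q: "q absolutely_integrable_on {0..T}"
  shows "min_rot q \<le> rot q \<psi>" "\<exists>\<phi>. rot q \<phi> = min_rot q"
proof -
  obtain \<phi> where "\<And>\<psi>. rot q \<phi> \<le> rot q \<psi>" using rot_attains_min[OF q] by blast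
  moreover from this have "min_rot q = rot q \<phi>" unfolding min_rot_def by (intro cInf_eq_minimum) auto
  ultimately show "min_rot q \<le> rot q \<psi>" "\<exists>\<phi>. rot q \<phi> = min_rot q" by auto
qed

lemma extremal_rot_gap:
  assumes q: "q absolutely_integrable_on {0..T}"
  shows "max_rot q < min_rot q + pi" "min_rot q \<le> max_rot q"
proof -
  obtain \<phi> \<psi> where "rot q \<phi> = max_rot q" "rot q \<psi> = min_rot q"
    using max_rot(2)[OF q] min_rot(2)[OF q] by blast
  then show "max_rot q < min_rot q + pi" "min_rot q \<le> max_rot q"
    using rot_oscillation[OF q, of \<phi> \<psi>] max_rot(1)[OF q, of \<psi>] by linarith+
qed

lemma max_rot_pos:
  assumes q: "q absolutely_integrable_on {0..T}"
  shows "max_rot q > 0"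
proof -
  obtain \<theta> where \<theta>: "pruefer_angle 0 T q \<theta>" "\<theta> 0 = 0" "\<theta> T = 0 + rot q 0" using rot_witness[OF q] .
  have "\<theta> T > 0"
    using angle_solution_positive[OF \<theta>(1)[unfolded pruefer_angle_def] coeff_abs_int[OF q]] \<theta> \<sigma>_pos T_pos by auto
  then show ?thesis using \<theta> max_rot(1)[OF q, of 0] by simp
qed

lemma rot_strict_mono:
  assumes q1: "q1 absolutely_integrable_on {0..T}" and q2: "q2 absolutely_integrable_on {0..T}"
    and le: "AE t in lebesgue. t \<in> {0..T} \<longrightarrow> q1 t \<le> q2 t"
    and ne: "\<not> (AE t in lebesgue. t \<in> {0..T} \<longrightarrow> q1 t = q2 t)"
  shows "rot q1 \<phi> < rot q2 \<phi>"
proof -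
  obtain \<theta>1 where 1: "pruefer_angle 0 T q1 \<theta>1" "\<theta>1 0 = \<phi>" "\<theta>1 T = \<phi> + rot q1 \<phi>" using rot_witness[OF q1] .
  obtain \<theta>2 where 2: "pruefer_angle 0 T q2 \<theta>2" "\<theta>2 0 = \<phi>" "\<theta>2 T = \<phi> + rot q2 \<phi>" using rot_witness[OF q2] .
  have "\<theta>1 T < \<theta>2 T"
  proof (rule angle_solution_strict_mono_potential[OF 1(1)[unfolded pruefer_angle_def] 2(1)[unfolded pruefer_angle_def] coeff_abs_int[OF q1]])
    show "AE t in lebesgue. t \<in> {0..T} \<longrightarrow> coeff q1 t \<le> coeff q2 t"
      using le by eventually_elim (use \<sigma>_pos in \<open>auto simp: divide_right_mono\<close>)
    show "\<not> (AE t in lebesgue. t \<in> {0..T} \<longrightarrow> coeff q1 t = coeff q2 t)" using ne \<sigma>_pos by simp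
  qed (use 1 2 T_pos \<sigma>_pos in auto)
  then show ?thesis using 1 2 by simp
qed

lemma rot_mono:
  assumes q1: "q1 absolutely_integrable_on {0..T}" and q2: "q2 absolutely_integrable_on {0..T}"
    and le: "AE t in lebesgue. t \<in> {0..T} \<longrightarrow> q1 t \<le> q2 t"
  shows "rot q1 \<phi> \<le> rot q2 \<phi>"
proof -
  obtain \<theta>1 where 1: "pruefer_angle 0 T q1 \<theta>1" "\<theta>1 0 = \<phi>" "\<theta>1 T = \<phi> + rot q1 \<phi>" using rot_witness[OF q1] .
  obtain \<theta>2 where 2: "pruefer_angle 0 T q2 \<theta>2" "\<theta>2 0 = \<phi>" "\<theta>2 T = \<phi> + rot q2 \<phi>" using rot_witness[OF q2] .
  have "\<theta>1 T \<le> \<theta>2 T"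
  proof (rule angle_solution_mono[OF 1(1)[unfolded pruefer_angle_def] 2(1)[unfolded pruefer_angle_def] coeff_abs_int[OF q1]])
    show "AE t in lebesgue. t \<in> {0..T} \<longrightarrow> coeff q1 t \<le> coeff q2 t"
      using le by eventually_elim (use \<sigma>_pos in \<open>auto simp: divide_right_mono\<close>)
  qed (use 1 2 T_pos \<sigma>_pos in auto)
  then show ?thesis using 1 2 by simp
qed

subsection \<open>Periodic solutions and extremal rotations\<close>

definition periodic_lin :: "(real \<Rightarrow> real) \<Rightarrow> (real \<Rightarrow> real) \<Rightarrow> (real \<Rightarrow> real) \<Rightarrow> bool" where
  "periodic_lin q u v \<longleftrightarrow> lin_solution 0 T q u v \<and> u 0 = u T \<and> v 0 = v T"

text \<open>For \<open>y = (u, v)\<close> the form \<open>det (y(0), y(T))\<close>, which is quadratic in the initial data, has the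
  opposite sign of the sine of the rotation.\<close>

lemma rotation_form:
  assumes s: "lin_solution 0 T q u v" and q: "q absolutely_integrable_on {0..T}"
    and nz: "u 0 \<noteq> 0 \<or> v 0 \<noteq> 0"
  obtains \<phi> m where "m > 0" "u 0 * v T - v 0 * u T = - (m * sin (rot q \<phi>))"
proof -
  obtain r \<phi> where r: "r > 0" "u 0 = r * sin \<phi>" "v 0 = \<sigma> * (r * cos \<phi>)"
    using polar_coordinates[OF nz] .
  have "0 \<le> T" using T_pos by simp
  then obtain \<theta> \<rho> where \<theta>: "pruefer_angle 0 T q \<theta>" "\<theta> 0 = \<phi>" "\<And>x. \<rho> x > 0"
    "\<And>x. x \<in> {0..T} \<Longrightarrow> u x = \<rho> x * sin (\<theta> x)" "\<And>x. x \<in> {0..T} \<Longrightarrow> v x = \<sigma> * (\<rho> x * cos (\<theta> x))"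
    using solution_to_angle[OF s q _ r] by metis
  have "u 0 * v T - v 0 * u T = - (\<sigma> * \<rho> 0 * \<rho> T * sin (\<theta> T - \<theta> 0))"
    using \<theta>(4,5)[of 0] \<theta>(4,5)[of T] T_pos by (simp add: sin_diff algebra_simps)
  also have "\<theta> T - \<theta> 0 = rot q \<phi>" using rot_eq[OF \<theta>(1) q] \<theta>(2) by simp
  finally show ?thesis using that[of "\<sigma> * \<rho> 0 * \<rho> T" \<phi>] \<theta>(3)[of 0] \<theta>(3)[of T] \<sigma>_pos by simp
qed

lemma quadratic_nonneg_linear_zero:
  fixes b d :: real
  assumes "\<And>e. 0 \<le> e * b + e\<^sup>2 * d"
  shows "b = 0"
proof (rule ccontr)
  assume "b \<noteq> 0"
  have alg: "(- b / (2 * D)) * b + (- b / (2 * D))\<^sup>2 * D = - (b\<^sup>2 / (4 * D))" if "D > 0" for D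
    using that by (simp add: power2_eq_square field_simps)
  define e where "e = - b / (2 * (\<bar>d\<bar> + 1))"
  have "e * b + e\<^sup>2 * d \<le> e * b + e\<^sup>2 * (\<bar>d\<bar> + 1)" by (intro add_left_mono mult_left_mono) auto
  also have "\<dots> = - (b\<^sup>2 / (4 * (\<bar>d\<bar> + 1)))" unfolding e_def by (rule alg) simp
  finally have "e * b + e\<^sup>2 * d \<le> - (b\<^sup>2 / (4 * (\<bar>d\<bar> + 1)))" .
  moreover have "b\<^sup>2 / (4 * (\<bar>d\<bar> + 1)) > 0" using \<open>b \<noteq> 0\<close> by (intro divide_pos_pos) auto
  ultimately show False using assms[of e] by linarith
qed

lemma sin_shift_multiple: "sin (x - 2 * pi * of_int k) = sin x" for x :: real
  using sin_cos_eq_iff[of "x - 2 * pi * of_int k" x] by (metis add.commute diff_add_cancel of_int_minus mult_minus_right diff_conv_add_uminus)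

text \<open>Let \<open>y\<^sub>1\<close> be a solution with multiplier \<open>c\<close>, and \<open>y\<^sub>2\<close> an independent one. By Liouville's
  formula the quadratic form \<open>det (y(0), y(T))\<close> has, along \<open>y\<^sub>1 + \<epsilon> y\<^sub>2\<close>, the linear coefficient
  \<open>W (1/c - c)\<close>. At an extremum of the rotation the form has a constant sign, so \<open>c = 1\<close>.\<close>

lemma extremal_rotation_periodic:
  assumes q: "q absolutely_integrable_on {0..T}" and k: "rot q \<phi> = 2 * pi * of_int k"
    and ext: "(\<forall>\<psi>. rot q \<psi> \<le> rot q \<phi>) \<or> (\<forall>\<psi>. rot q \<phi> \<le> rot q \<psi>)"
  obtains u v where "periodic_lin q u v" "u 0 = sin \<phi>" "v 0 = \<sigma> * cos \<phi>"
proof -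
  have T0: "0 \<le> T" using T_pos by simp
  obtain u1 v1 where s1: "lin_solution 0 T q u1 v1" "u1 0 = sin \<phi>" "v1 0 = \<sigma> * cos \<phi>"
    using lin_solution_with_angle[OF q T0, of \<phi>] .
  obtain u2 v2 where s2: "lin_solution 0 T q u2 v2" "u2 0 = sin (\<phi> + pi/2)" "v2 0 = \<sigma> * cos (\<phi> + pi/2)"
    using lin_solution_with_angle[OF q T0, of "\<phi> + pi/2"] .
  have W0: "u1 0 * v2 0 - v1 0 * u2 0 = - \<sigma>"
  proof -
    have "u1 0 * v2 0 - v1 0 * u2 0 = - \<sigma> * (cos \<phi> * cos \<phi> + sin \<phi> * sin \<phi>)"
      unfolding s1 s2 cos_add sin_add distrib_left by simp
    then show ?thesis by simp
  qed
  obtain \<theta> \<rho> where \<theta>: "pruefer_angle 0 T q \<theta>" "\<theta> 0 = \<phi>" "\<And>x. \<rho> x > 0"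
    "\<And>x. x \<in> {0..T} \<Longrightarrow> u1 x = \<rho> x * sin (\<theta> x)" "\<And>x. x \<in> {0..T} \<Longrightarrow> v1 x = \<sigma> * (\<rho> x * cos (\<theta> x))"
    using solution_to_angle[OF s1(1) q T0, of 1 \<phi>] s1 by auto
  define c where "c = \<rho> T"
  have c: "c > 0" using \<theta>(3) by (simp add: c_def)
  have "\<theta> T = \<phi> + 2 * pi * of_int k" using rot_eq[OF \<theta>(1) q] \<theta>(2) k by simp
  then have "sin (\<theta> T) = sin \<phi>" "cos (\<theta> T) = cos \<phi>" using sin_cos_eq_iff[of "\<theta> T" \<phi>] by auto
  then have u1T: "u1 T = c * u1 0" "v1 T = c * v1 0"
    using \<theta>(4)[of T] \<theta>(5)[of T] T_pos s1 by (auto simp: c_def)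
  have W: "c * (u1 0 * v2 T - v1 0 * u2 T) = - \<sigma>"
    using wronskian_constant[OF s1(1) s2(1), of T] W0 u1T T_pos by (simp add: algebra_simps)
  \<comment> \<open>the sign treats a maximum and a minimum at once\<close>
  define s :: real where "s = (if (\<forall>\<psi>. rot q \<psi> \<le> rot q \<phi>) then 1 else -1)"
  have sgn: "0 \<le> s * - sin (rot q \<psi>)" for \<psi>
  proof -
    have "\<bar>rot q \<psi> - rot q \<phi>\<bar> < pi" by (rule rot_oscillation[OF q])
    moreover have "sin (rot q \<psi>) = sin (rot q \<psi> - rot q \<phi>)" unfolding k by (rule sin_shift_multiple[symmetric])
    ultimately show ?thesis using ext sin_ge_zero[of "rot q \<psi> - rot q \<phi>"] sin_ge_zero[of "rot q \<phi> - rot q \<psi>"]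
        sin_minus[of "rot q \<phi> - rot q \<psi>"]
      by (auto simp: s_def)
  qed
  define b where "b = s * ((u1 0 * v2 T - v1 0 * u2 T) - c * (u1 0 * v2 0 - v1 0 * u2 0))"
  define d where "d = s * (u2 0 * v2 T - v2 0 * u2 T)"
  \<comment> \<open>the form at \<open>y\<^sub>1 + e y\<^sub>2\<close>, up to the sign \<open>s\<close>\<close>
  have "0 \<le> e * b + e\<^sup>2 * d" for e
  proof -
    let ?u = "\<lambda>t. 1 * u1 t + e * u2 t" and ?v = "\<lambda>t. 1 * v1 t + e * v2 t"
    have s: "lin_solution 0 T q ?u ?v" by (rule lin_solution_combination[OF s1(1) s2(1)])
    have "?u 0 \<noteq> 0 \<or> ?v 0 \<noteq> 0"
    proof (rule ccontr)
      assume "\<not> (?u 0 \<noteq> 0 \<or> ?v 0 \<noteq> 0)"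
      then have "u1 0 = - e * u2 0" "v1 0 = - e * v2 0" by auto
      then have "u1 0 * v2 0 - v1 0 * u2 0 = 0" by simp
      then show False using W0 \<sigma>_pos by simp
    qed
    then obtain \<psi> m where m: "m > 0" "?u 0 * ?v T - ?v 0 * ?u T = - (m * sin (rot q \<psi>))"
      using rotation_form[OF s q] by blast
    have "s * (?u 0 * ?v T - ?v 0 * ?u T) = e * b + e\<^sup>2 * d"
      unfolding b_def d_def u1T by (simp add: power2_eq_square algebra_simps)
    moreover have "0 \<le> m * (s * - sin (rot q \<psi>))" using mult_nonneg_nonneg[OF less_imp_le[OF m(1)] sgn[of \<psi>]] .
    ultimately show ?thesis using m(2) by (simp add: mult_ac)
  qed
  then have "b = 0" by (rule quadratic_nonneg_linear_zero)
  then have e: "u1 0 * v2 T - v1 0 * u2 T = - (c * \<sigma>)" using W0 by (auto simp: b_def s_def split: if_splits)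
  have "c * (c * \<sigma>) = \<sigma>" using W unfolding e by simp
  then have "c\<^sup>2 = 1" using \<sigma>_pos by (simp add: power2_eq_square mult.assoc[symmetric])
  then have "c = 1" using c by (simp add: power2_eq_1_iff)
  then have "periodic_lin q u1 v1" using u1T s1(1) by (simp add: periodic_lin_def)
  then show ?thesis using that s1 by blast
qed

lemma rot_of_periodic:
  assumes p: "periodic_lin q u v" and q: "q absolutely_integrable_on {0..T}"
    and \<phi>: "r > 0" "u 0 = r * sin \<phi>" "v 0 = \<sigma> * (r * cos \<phi>)"
  obtains k :: int where "rot q \<phi> = 2 * pi * of_int k"
proof -
  have s: "lin_solution 0 T q u v" using p by (simp add: periodic_lin_def)
  have "0 \<le> T" using T_pos by simp
  then obtain \<theta> \<rho> where \<theta>: "pruefer_angle 0 T q \<theta>" "\<theta> 0 = \<phi>" "\<And>x. \<rho> x > 0"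
    "\<And>x. x \<in> {0..T} \<Longrightarrow> u x = \<rho> x * sin (\<theta> x)" "\<And>x. x \<in> {0..T} \<Longrightarrow> v x = \<sigma> * (\<rho> x * cos (\<theta> x))"
    using solution_to_angle[OF s q _ \<phi>] by metis
  have eq: "\<rho> 0 * sin (\<theta> 0) = \<rho> T * sin (\<theta> T)" "\<rho> 0 * cos (\<theta> 0) = \<rho> T * cos (\<theta> T)"
    using p \<theta>(4,5)[of 0] \<theta>(4,5)[of T] T_pos \<sigma>_pos by (auto simp: periodic_lin_def)
  have "(\<rho> 0)\<^sup>2 * ((sin (\<theta> 0))\<^sup>2 + (cos (\<theta> 0))\<^sup>2) = (\<rho> T)\<^sup>2 * ((sin (\<theta> T))\<^sup>2 + (cos (\<theta> T))\<^sup>2)"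
    using arg_cong2[OF eq, of "\<lambda>x y. x\<^sup>2 + y\<^sup>2"] by (simp only: distrib_left power_mult_distrib)
  then have "(\<rho> 0)\<^sup>2 = (\<rho> T)\<^sup>2" by simp
  then have "\<rho> 0 = \<rho> T" using \<theta>(3)[of 0] \<theta>(3)[of T] by (auto simp: power2_eq_iff)
  then have "sin (\<theta> T) = sin (\<theta> 0) \<and> cos (\<theta> T) = cos (\<theta> 0)" using eq \<theta>(3)[of T] by auto
  then obtain k :: int where "\<theta> T = \<theta> 0 + 2 * pi * of_int k" using sin_cos_eq_iff by blast
  then have "rot q \<phi> = 2 * pi * of_int k" using rot_eq[OF \<theta>(1) q] \<theta>(2) by simp
  then show ?thesis using that by blast
qed

text \<open>Conversely, a periodic solution makes the monodromy matrix unipotent, so the form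
  \<open>det (y(0), y(T))\<close> is a multiple of a square and the rotation is extremal there.\<close>

lemma periodic_rotation_extremal:
  assumes p: "periodic_lin q u1 v1" and q: "q absolutely_integrable_on {0..T}"
    and nz: "u1 0 \<noteq> 0 \<or> v1 0 \<noteq> 0"
  obtains k :: int where "max_rot q = 2 * pi * of_int k \<or> min_rot q = 2 * pi * of_int k"
proof -
  have T0: "0 \<le> T" using T_pos by simp
  have s1: "lin_solution 0 T q u1 v1" and per: "u1 T = u1 0" "v1 T = v1 0"
    using p by (auto simp: periodic_lin_def)
  obtain r \<phi> where r: "r > 0" "u1 0 = r * sin \<phi>" "v1 0 = \<sigma> * (r * cos \<phi>)"
    using polar_coordinates[OF nz] .
  obtain k :: int where k: "rot q \<phi> = 2 * pi * of_int k" using rot_of_periodic[OF p q r] .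
  define D where "D = (\<lambda>u v. u 0 * v T - v 0 * (u T :: real) :: real)"
  obtain u2 v2 where s2: "lin_solution 0 T q u2 v2" "u2 0 = sin (\<phi> + pi/2)" "v2 0 = \<sigma> * cos (\<phi> + pi/2)"
    using lin_solution_with_angle[OF q T0, of "\<phi> + pi/2"] .
  have W0: "u1 0 * v2 0 - v1 0 * u2 0 = - (r * \<sigma>)"
  proof -
    have "u1 0 * v2 0 - v1 0 * u2 0 = - (r * \<sigma>) * (cos \<phi> * cos \<phi> + sin \<phi> * sin \<phi>)"
      unfolding r(2,3) s2 cos_add sin_add distrib_left by simp
    then show ?thesis by simp
  qed
  have W0nz: "u1 0 * v2 0 - v1 0 * u2 0 \<noteq> 0" using W0 r(1) \<sigma>_pos by simp
  have WT: "u1 0 * v2 T - v1 0 * u2 T = u1 0 * v2 0 - v1 0 * u2 0"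
    using wronskian_constant[OF s1 s2(1), of T] per T_pos by simp
  define d where "d = D u2 v2"
  \<comment> \<open>the direction of the periodic solution is in the kernel of the form\<close>
  have form: "\<exists>\<beta>. D u v = \<beta>\<^sup>2 * d" if s: "lin_solution 0 T q u v" for u v
  proof -
    obtain \<alpha> \<beta> where 1: "u 0 = \<alpha> * u1 0 + \<beta> * u2 0" "v 0 = \<alpha> * v1 0 + \<beta> * v2 0"
      using plane_basis[OF W0nz] .
    have 2: "u T = \<alpha> * u1 0 + \<beta> * u2 T \<and> v T = \<alpha> * v1 0 + \<beta> * v2 T"
      using lin_solution_unique[OF s lin_solution_combination[OF s1 s2(1), of \<alpha> \<beta>] q 1, of T] per T_pos by simp
    have "D u v = \<beta>\<^sup>2 * d + \<alpha> * \<beta> * ((u1 0 * v2 T - v1 0 * u2 T) - (u1 0 * v2 0 - v1 0 * u2 0))"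
      unfolding D_def d_def 1 conjunct1[OF 2] conjunct2[OF 2] by (simp add: power2_eq_square algebra_simps)
    then show ?thesis using WT by auto
  qed
  define s :: real where "s = (if d \<ge> 0 then 1 else -1)"
  have "s * sin (rot q \<psi>) \<le> 0" for \<psi>
  proof -
    obtain u v where uv: "lin_solution 0 T q u v" "u 0 = sin \<psi>" "v 0 = \<sigma> * cos \<psi>"
      using lin_solution_with_angle[OF q T0, of \<psi>] .
    obtain \<theta> \<rho> where \<theta>: "pruefer_angle 0 T q \<theta>" "\<theta> 0 = \<psi>" "\<And>x. \<rho> x > 0"
      "\<And>x. x \<in> {0..T} \<Longrightarrow> u x = \<rho> x * sin (\<theta> x)" "\<And>x. x \<in> {0..T} \<Longrightarrow> v x = \<sigma> * (\<rho> x * cos (\<theta> x))"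
      using solution_to_angle[OF uv(1) q T0, of 1 \<psi>] uv by auto
    have "D u v = - ((\<sigma> * \<rho> 0 * \<rho> T) * sin (\<theta> T - \<theta> 0))"
      using \<theta>(4,5)[of 0] \<theta>(4,5)[of T] T_pos by (simp add: D_def sin_diff algebra_simps)
    then have "D u v = - ((\<sigma> * \<rho> 0 * \<rho> T) * sin (rot q \<psi>))" using rot_eq[OF \<theta>(1) q] \<theta>(2) by simp
    moreover have "s * D u v \<ge> 0" using form[OF uv(1)] by (auto simp: s_def mult_nonneg_nonpos)
    ultimately have "(\<sigma> * \<rho> 0 * \<rho> T) * (s * sin (rot q \<psi>)) \<le> 0" by (simp add: algebra_simps)
    moreover have "\<sigma> * \<rho> 0 * \<rho> T > 0" using \<theta>(3) \<sigma>_pos by simp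
    ultimately show ?thesis using mult_pos_pos[of "\<sigma> * \<rho> 0 * \<rho> T" "s * sin (rot q \<psi>)"] by linarith
  qed
  then have sg: "s * sin (rot q \<psi> - rot q \<phi>) \<le> 0" for \<psi>
    unfolding k by (simp only: sin_shift_multiple)
  have ext: "s * (rot q \<psi> - rot q \<phi>) \<le> 0" for \<psi>
  proof (rule ccontr)
    assume *: "\<not> s * (rot q \<psi> - rot q \<phi>) \<le> 0"
    have o: "\<bar>rot q \<psi> - rot q \<phi>\<bar> < pi" by (rule rot_oscillation[OF q])
    show False
    proof (cases "d \<ge> 0")
      case True
      then show False using * o sg[of \<psi>] sin_gt_zero[of "rot q \<psi> - rot q \<phi>"] by (auto simp: s_def)
    next
      case False
      then show False using * o sg[of \<psi>] sin_gt_zero[of "rot q \<phi> - rot q \<psi>"] sin_minus[of "rot q \<phi> - rot q \<psi>"]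
        by (auto simp: s_def)
    qed
  qed
  show ?thesis
  proof (cases "d \<ge> 0")
    case True
    then have "\<And>\<psi>. rot q \<psi> \<le> rot q \<phi>" using ext by (auto simp: s_def)
    then have "max_rot q = rot q \<phi>" unfolding max_rot_def by (intro cSup_eq_maximum) auto
    then show ?thesis using that[of k] k by simp
  next
    case False
    then have "\<And>\<psi>. rot q \<phi> \<le> rot q \<psi>" using ext by (auto simp: s_def)
    then have "min_rot q = rot q \<phi>" unfolding min_rot_def by (intro cInf_eq_minimum) auto
    then show ?thesis using that[of k] k by simp
  qed
qed

end

section \<open>Periodic eigenvalues\<close>

lemma lin_solution_is_solution:
  assumes "T > 0" and q: "q absolutely_integrable_on {0..T}" and s: "lin_solution 0 T q u v"
  shows "is_solution T q u" "\<And>x. x \<in> {0..T} \<Longrightarrow> D_on T u x = v x"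
proof -
  have u: "primitive_on 0 T u v" and v: "primitive_on 0 T v (\<lambda>t. - q t * u t)"
    using s by (auto simp: lin_solution_def)
  have vc: "continuous_on {0..T} v" using v by (rule primitive_on_continuous)
  have der: "(u has_vector_derivative v x) (at x within {0..T})" if x: "x \<in> {0..T}" for x
  proof -
    have "((\<lambda>x. u 0 + integral {0..x} v) has_vector_derivative 0 + v x) (at x within {0..T})"
      by (intro has_vector_derivative_add has_vector_derivative_const
          integral_has_vector_derivative[OF vc x])
    then have d: "((\<lambda>x. u 0 + integral {0..x} v) has_vector_derivative v x) (at x within {0..T})" by simp
    show ?thesis
      by (rule has_vector_derivative_transform[OF x _ d]) (rule primitive_onD[OF u])
  qed
  show D: "D_on T u x = v x" if x: "x \<in> {0..T}" for x
    unfolding D_on_def using \<open>T > 0\<close> x der[OF x] by (rule vector_derivative_within_closed_interval)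
  obtain N where N: "negligible N" "\<And>x. x \<in> {0<..<T} - N \<Longrightarrow> (v has_real_derivative - q x * u x) (at x)"
    using primitive_on_derivative[OF v] by blast
  show "is_solution T q u"
    unfolding is_solution_def
  proof (intro conjI)
    show "u differentiable_on {0..T}"
      using der differentiableI_vector unfolding differentiable_on_def by blast
    show "continuous_on {0..T} (D_on T u)" using vc by (rule continuous_on_eq) (use D in auto)
    have "primitive_on 0 T (D_on T u) (\<lambda>t. - q t * u t)"
      using v by (rule primitive_on_cong) (use D in auto)
    then show "abs_continuous_on 0 T (D_on T u)" by (rule primitive_on_imp_abs_continuous)
    show "AE x in lebesgue. x \<in> {0<..<T} \<longrightarrow>
        (\<exists>w. (D_on T u has_real_derivative w) (at x) \<and> w + q x * u x = 0)"
    proof (rule AE_I'[of N])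
      show "N \<in> null_sets lebesgue" using N(1) by (simp add: negligible_iff_null_sets)
      have "(D_on T u has_real_derivative - q x * u x) (at x)" if "x \<in> {0<..<T} - N" for x
        by (rule has_field_derivative_transform_within_open[OF N(2)[OF that], of "{0<..<T}"])
          (use that D in auto)
      then show "{x \<in> space lebesgue. \<not> (x \<in> {0<..<T} \<longrightarrow>
        (\<exists>w. (D_on T u has_real_derivative w) (at x) \<and> w + q x * u x = 0))} \<subseteq> N"
        by force
    qed
  qed
qed

lemma is_solution_lin_solution:
  assumes "T > 0" and q: "q absolutely_integrable_on {0..T}" and s: "is_solution T q u"
  shows "lin_solution 0 T q u (D_on T u)"
proof -
  have d: "u differentiable_on {0..T}" and c: "continuous_on {0..T} (D_on T u)"
    and ac: "abs_continuous_on 0 T (D_on T u)"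
    and ae: "AE x in lebesgue. x \<in> {0<..<T} \<longrightarrow>
        (\<exists>w. (D_on T u has_real_derivative w) (at x) \<and> w + q x * u x = 0)"
    using s by (auto simp: is_solution_def)
  have u: "primitive_on 0 T u (D_on T u)"
  proof (rule primitive_on_of_continuous_derivative[OF _ c])
    fix x assume "x \<in> {0..T}"
    then have "u differentiable at x within {0..T}" using d by (simp add: differentiable_on_def)
    then show "(u has_vector_derivative D_on T u x) (at x within {0..T})"
      unfolding D_on_def by (simp add: vector_derivative_works)
  qed
  obtain N where N: "N \<in> null_sets lebesgue" "{x. \<not> (x \<in> {0<..<T} \<longrightarrow>
        (\<exists>w. (D_on T u has_real_derivative w) (at x) \<and> w + q x * u x = 0))} \<subseteq> N"
    using ae unfolding eventually_ae_filter by auto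
  have "primitive_on 0 T (D_on T u) (\<lambda>t. - q t * u t)"
  proof (rule abs_continuous_imp_primitive_on[OF ac])
    show "negligible N" using N(1) by (simp add: negligible_iff_null_sets)
    fix x assume "x \<in> {0<..<T} - N"
    then obtain w where "(D_on T u has_real_derivative w) (at x)" "w + q x * u x = 0" using N(2) by blast
    moreover from this have "w = - q x * u x" by simp
    ultimately show "(D_on T u has_real_derivative - q x * u x) (at x)" by simp
  next
    have "(\<lambda>t. - u t * q t) absolutely_integrable_on {0..T}"
      by (intro abs_int_mult_continuous continuous_intros primitive_on_continuous[OF u] q)
    then show "(\<lambda>t. - q t * u t) absolutely_integrable_on {0..T}" by (simp add: mult.commute)
  qed
  with u show ?thesis by (simp add: lin_solution_def)
qed

lemma lin_solution_cong_left:
  assumes "lin_solution c d q u v" "\<And>x. x \<in> {c..d} \<Longrightarrow> u x = u' x" "\<And>x. x \<in> {c..d} \<Longrightarrow> v x = v' x"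
  shows "lin_solution c d q u' v'"
  using assms unfolding lin_solution_def by (auto intro: primitive_on_cong)

context angle_scale
begin

lemma is_periodic_solution_iff:
  assumes q: "q absolutely_integrable_on {0..T}"
  shows "is_periodic_solution T q u \<longleftrightarrow> (\<exists>v. periodic_lin q u v)"
proof
  assume "is_periodic_solution T q u"
  then show "\<exists>v. periodic_lin q u v"
    using is_solution_lin_solution[OF T_pos q, of u]
    by (intro exI[of _ "D_on T u"]) (auto simp: is_periodic_solution_def periodic_lin_def)
next
  assume "\<exists>v. periodic_lin q u v"
  then obtain v where v: "lin_solution 0 T q u v" "u 0 = u T" "v 0 = v T" by (auto simp: periodic_lin_def)
  then show "is_periodic_solution T q u"
    using lin_solution_is_solution[OF T_pos q v(1)] T_pos by (auto simp: is_periodic_solution_def)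
qed

lemma nontrivial_initial:
  assumes "lin_solution 0 T q u v" "q absolutely_integrable_on {0..T}" "nontrivial_on T u"
  shows "u 0 \<noteq> 0 \<or> v 0 \<noteq> 0"
  using lin_solution_zero_unique[OF assms(1,2)] assms(3) by (auto simp: nontrivial_on_def)

lemma initial_nontrivial:
  assumes s: "lin_solution 0 T q u v" and "u 0 \<noteq> 0 \<or> v 0 \<noteq> 0"
  shows "nontrivial_on T u"
proof (rule ccontr)
  assume "\<not> nontrivial_on T u"
  then have u0: "u x = 0" if "x \<in> {0..T}" for x using that by (auto simp: nontrivial_on_def)
  have u: "primitive_on 0 T u v" and v: "primitive_on 0 T v (\<lambda>t. - q t * u t)"
    using s by (auto simp: lin_solution_def)
  have "primitive_on 0 T v (\<lambda>t. 0)" using v by (rule primitive_on_cong) (use u0 in auto)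
  then have "v x = v 0" if "x \<in> {0..T}" for x using primitive_onD[of 0 T v "\<lambda>t. 0" x] that by simp
  then have "primitive_on 0 T u (\<lambda>_. v 0)" by (rule primitive_on_cong[OF u refl])
  from primitive_onD[OF this, of T] have "u T = u 0 + T * v 0" using T_pos by simp
  then show False using u0[of 0] u0[of T] T_pos assms(2) by simp
qed

lemma periodic_combination:
  assumes "periodic_lin q u1 v1" "periodic_lin q u2 v2"
  shows "periodic_lin q (\<lambda>t. \<alpha> * u1 t + \<beta> * u2 t) (\<lambda>t. \<alpha> * v1 t + \<beta> * v2 t)"
  using assms lin_solution_combination[of 0 T q u1 v1 u2 v2] by (simp add: periodic_lin_def)

lemma extremal_turns_equal:
  assumes q: "q absolutely_integrable_on {0..T}"
    and kl: "max_rot q = 2 * pi * of_int k" "min_rot q = 2 * pi * of_int l"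
  shows "k = l"
proof -
  have "2 * pi * of_int k < 2 * pi * of_int l + pi" "2 * pi * of_int l \<le> 2 * pi * of_int k"
    using extremal_rot_gap[OF q] kl by simp_all
  then have "pi * (2 * of_int k) < pi * (2 * of_int l + 1)" "pi * of_int l \<le> pi * of_int k"
    by (simp_all add: algebra_simps)
  then have "(of_int (2 * k) :: real) < of_int (2 * l + 1)" "(of_int l :: real) \<le> of_int k"
    unfolding mult_less_cancel_left_pos[OF pi_gt_zero] mult_le_cancel_left_pos[OF pi_gt_zero] by simp_all
  then show "k = l" by (simp only: of_int_less_iff of_int_le_iff)
qed

lemma rot_constant_all_periodic:
  assumes q: "q absolutely_integrable_on {0..T}"
    and k: "max_rot q = 2 * pi * of_int k" "min_rot q = 2 * pi * of_int l"
  shows "\<exists>u v. periodic_lin q u v \<and> u 0 = sin \<phi> \<and> v 0 = \<sigma> * cos \<phi>"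
proof -
  have "k = l" by (rule extremal_turns_equal[OF q k])
  then have rot: "rot q \<psi> = 2 * pi * of_int k" for \<psi>
    using max_rot(1)[OF q, of \<psi>] min_rot(1)[OF q, of \<psi>] k by simp
  then show ?thesis using extremal_rotation_periodic[OF q rot[of \<phi>]] by (metis order_refl)
qed

text \<open>All solutions are then periodic, so every rotation is a multiple of \<open>2 \<pi>\<close>; the oscillation
  is less than \<open>\<pi>\<close>.\<close>

lemma independent_periodic_rot_constant:
  assumes q: "q absolutely_integrable_on {0..T}"
    and p1: "periodic_lin q u1 v1" and p2: "periodic_lin q u2 v2"
    and W: "u1 0 * v2 0 - v1 0 * u2 0 \<noteq> 0"
  obtains k :: int where "max_rot q = 2 * pi * of_int k" "min_rot q = 2 * pi * of_int k"
proof -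
  have ex: "\<exists>k::int. rot q \<phi> = 2 * pi * of_int k" for \<phi>
  proof -
    obtain \<alpha> \<beta> where "sin \<phi> = \<alpha> * u1 0 + \<beta> * u2 0" "\<sigma> * cos \<phi> = \<alpha> * v1 0 + \<beta> * v2 0"
      using plane_basis[OF W] .
    then have "\<alpha> * u1 0 + \<beta> * u2 0 = 1 * sin \<phi>" "\<alpha> * v1 0 + \<beta> * v2 0 = \<sigma> * (1 * cos \<phi>)" by simp_all
    then obtain k :: int where "rot q \<phi> = 2 * pi * of_int k"
      using rot_of_periodic[OF periodic_combination[OF p1 p2] q, of 1 \<alpha> \<beta> \<phi>] by auto
    then show ?thesis by blast
  qed
  obtain \<phi> \<psi> where ext: "rot q \<phi> = max_rot q" "rot q \<psi> = min_rot q" using max_rot(2)[OF q] min_rot(2)[OF q] by blast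
  obtain k l :: int where kl: "rot q \<phi> = 2 * pi * of_int k" "rot q \<psi> = 2 * pi * of_int l" using ex by meson
  have "k = l" by (rule extremal_turns_equal[OF q]) (use kl ext in simp_all)
  then show ?thesis using that[of k] kl ext by simp
qed

lemma shifted_abs_int:
  fixes a :: "real \<Rightarrow> real"
  assumes "a absolutely_integrable_on {0..T}"
  shows "(\<lambda>x. \<mu> + a x) absolutely_integrable_on {0..T}"
  using assms by (intro set_integral_add(1)) auto

lemma eigenspace_iff:
  assumes a: "a absolutely_integrable_on {0..T}"
  shows "u \<in> eigenspace T a \<mu> \<longleftrightarrow> (\<exists>v. periodic_lin (\<lambda>x. \<mu> + a x) u v) \<and> (\<forall>x. x \<notin> {0..T} \<longrightarrow> u x = 0)"
  unfolding eigenspace_def using is_periodic_solution_iff[OF shifted_abs_int[OF a]] by auto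

lemma eigenspace_extension:
  assumes a: "a absolutely_integrable_on {0..T}" and p: "periodic_lin (\<lambda>x. \<mu> + a x) u v"
  shows "(\<lambda>x. if x \<in> {0..T} then u x else 0) \<in> eigenspace T a \<mu>"
proof -
  have "periodic_lin (\<lambda>x. \<mu> + a x) (\<lambda>x. if x \<in> {0..T} then u x else 0) v"
    using p T_pos lin_solution_cong_left[of 0 T "\<lambda>x. \<mu> + a x" u v "\<lambda>x. if x \<in> {0..T} then u x else 0" v]
    by (auto simp: periodic_lin_def)
  then show ?thesis unfolding eigenspace_iff[OF a] by auto
qed

text \<open>If both extrema are multiples of \<open>2 \<pi>\<close>, all solutions are periodic. If exactly one is, there is a
  nontrivial periodic solution, and two independent ones would make the rotation constant.
  Otherwise only the zero solution is periodic.\<close>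

lemma eigenvalue_mult_eq:
  fixes \<mu> :: real
  assumes a: "a absolutely_integrable_on {0..T}"
  defines "q \<equiv> (\<lambda>x. \<mu> + a x)"
  shows "eigenvalue_mult T a \<mu> =
     (if \<exists>k::int. max_rot q = 2 * pi * of_int k then 1 else 0) +
     (if \<exists>k::int. min_rot q = 2 * pi * of_int k then 1 else 0)"
proof -
  have q: "q absolutely_integrable_on {0..T}" unfolding q_def by (rule shifted_abs_int[OF a])
  note mem = eigenspace_iff[OF a, of _ \<mu>, folded q_def]
  note ext = eigenspace_extension[OF a, of \<mu>, folded q_def]
  let ?E = "eigenspace T a \<mu>"
  consider (both) "\<exists>k::int. max_rot q = 2 * pi * of_int k" "\<exists>k::int. min_rot q = 2 * pi * of_int k"
    | (none) "\<nexists>k::int. max_rot q = 2 * pi * of_int k" "\<nexists>k::int. min_rot q = 2 * pi * of_int k"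
    | (one) "(\<exists>k::int. max_rot q = 2 * pi * of_int k) \<noteq> (\<exists>k::int. min_rot q = 2 * pi * of_int k)"
    by blast
  then show ?thesis
  proof cases
    case both
    then obtain k l :: int where kl: "max_rot q = 2 * pi * of_int k" "min_rot q = 2 * pi * of_int l" by blast
    obtain u1 v1 where 1: "periodic_lin q u1 v1" "u1 0 = 0" "v1 0 = \<sigma>"
      using rot_constant_all_periodic[OF q kl, of 0] by auto
    obtain u2 v2 where 2: "periodic_lin q u2 v2" "u2 0 = 1" "v2 0 = 0"
      using rot_constant_all_periodic[OF q kl, of "pi/2"] by auto
    define f1 where "f1 = (\<lambda>x. if x \<in> {0..T} then u1 x else 0)"
    define f2 where "f2 = (\<lambda>x. if x \<in> {0..T} then u2 x else 0)"
    have f1nz: "nontrivial_on T u1"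
      using initial_nontrivial[of q u1 v1] 1 \<sigma>_pos by (auto simp: periodic_lin_def)
    then obtain z where z: "z \<in> {0..T}" "u1 z \<noteq> 0" by (auto simp: nontrivial_on_def)
    have f10: "f1 0 = 0" and f20: "f2 0 = 1" and f1z: "f1 z \<noteq> 0" using 1 2 T_pos z by (auto simp: f1_def f2_def)
    have ne: "f1 \<noteq> f2" using f10 f20 by auto
    have "real_fun.dim ?E = 2"
    proof (rule real_fun.dim_unique[of "{f1, f2}"])
      show "{f1, f2} \<subseteq> ?E" unfolding f1_def f2_def using ext[OF 1(1)] ext[OF 2(1)] by simp
      show "?E \<subseteq> real_fun.span {f1, f2}"
      proof
        fix f assume "f \<in> ?E"
        then obtain g where g: "periodic_lin q f g" and f0: "\<And>x. x \<notin> {0..T} \<Longrightarrow> f x = 0"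
          unfolding mem by blast
        have fx: "f x = g 0 / \<sigma> * f1 x + f 0 * f2 x" for x
        proof (cases "x \<in> {0..T}")
          case True
          have L1: "lin_solution 0 T q f g" using g by (simp add: periodic_lin_def)
          have L2: "lin_solution 0 T q (\<lambda>t. g 0 / \<sigma> * u1 t + f 0 * u2 t) (\<lambda>t. g 0 / \<sigma> * v1 t + f 0 * v2 t)"
            using 1 2 by (intro lin_solution_combination) (auto simp: periodic_lin_def)
          show ?thesis
            using lin_solution_unique[OF L1 L2 q _ _ True] 1(2,3) 2(2,3) \<sigma>_pos True by (simp add: f1_def f2_def)
        next
          case False
          then show ?thesis using f0 by (auto simp: f1_def f2_def)
        qed
        have "f = (\<lambda>x. g 0 / \<sigma> * f1 x) + (\<lambda>x. f 0 * f2 x)"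
          by (rule HOL.ext) (unfold plus_fun_apply, rule fx)
        then show "f \<in> real_fun.span {f1, f2}"
          by (metis real_fun.span_add real_fun.span_scale real_fun.span_base insertI1 insertI2)
      qed
      show "real_fun.independent {f1, f2}"
      proof -
        have "f1 \<notin> real_fun.span {f2}"
        proof
          assume "f1 \<in> real_fun.span {f2}"
          then obtain c where c: "f1 = (\<lambda>x. c * f2 x)" unfolding real_fun.span_singleton by auto
          then have "c = 0" using fun_cong[OF c, of 0] f10 f20 by simp
          then show False using fun_cong[OF c, of z] f1z by simp
        qed
        moreover have "f2 \<noteq> 0" using f20 by (auto simp: fun_eq_iff intro!: exI[of _ 0])
        ultimately show ?thesis using ne real_fun.independent_insert[of f1 "{f2}"] by simp
      qed
      show "card {f1, f2} = 2" using ne by simp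
    qed
    then show ?thesis using both by (simp add: eigenvalue_mult_def)
  next
    case none
    have "?E \<subseteq> {0}"
    proof
      fix f assume "f \<in> ?E"
      then obtain g where g: "periodic_lin q f g" and f0: "\<And>x. x \<notin> {0..T} \<Longrightarrow> f x = 0"
        unfolding mem by blast
      have "f 0 = 0 \<and> g 0 = 0"
        using periodic_rotation_extremal[OF g q] none by metis
      then have "f x = 0" if "x \<in> {0..T}" for x
        using lin_solution_zero_unique[of 0 T q f g x] g q that by (auto simp: periodic_lin_def)
      then have "f = 0" using f0 by (auto simp: fun_eq_iff)
      then show "f \<in> {0}" by simp
    qed
    then have "real_fun.dim ?E \<le> card ({} :: (real \<Rightarrow> real) set)"
      by (intro real_fun.dim_le_card) auto
    then show ?thesis using none by (simp add: eigenvalue_mult_def)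
  next
    case one
    have "\<exists>u v. periodic_lin q u v \<and> (u 0 \<noteq> 0 \<or> v 0 \<noteq> 0)"
    proof (cases "\<exists>k::int. max_rot q = 2 * pi * of_int k")
      case True
      then obtain k :: int where k: "max_rot q = 2 * pi * of_int k" by blast
      obtain \<phi> where \<phi>: "rot q \<phi> = max_rot q" using max_rot(2)[OF q] by blast
      obtain u v where "periodic_lin q u v" "u 0 = sin \<phi>" "v 0 = \<sigma> * cos \<phi>"
        using extremal_rotation_periodic[OF q, of \<phi> k] \<phi> k max_rot(1)[OF q] by metis
      moreover have "sin \<phi> \<noteq> 0 \<or> cos \<phi> \<noteq> 0" using sin_zero_norm_cos_one[of \<phi>] by force
      ultimately show ?thesis using \<sigma>_pos by (intro exI[of _ u] exI[of _ v]) auto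
    next
      case False
      then obtain k :: int where k: "min_rot q = 2 * pi * of_int k" using one by blast
      obtain \<phi> where \<phi>: "rot q \<phi> = min_rot q" using min_rot(2)[OF q] by blast
      obtain u v where "periodic_lin q u v" "u 0 = sin \<phi>" "v 0 = \<sigma> * cos \<phi>"
        using extremal_rotation_periodic[OF q, of \<phi> k] \<phi> k min_rot(1)[OF q] by metis
      moreover have "sin \<phi> \<noteq> 0 \<or> cos \<phi> \<noteq> 0" using sin_zero_norm_cos_one[of \<phi>] by force
      ultimately show ?thesis using \<sigma>_pos by (intro exI[of _ u] exI[of _ v]) auto
    qed
    then obtain u v where uv: "periodic_lin q u v" "u 0 \<noteq> 0 \<or> v 0 \<noteq> 0" by blast
    have uvs: "lin_solution 0 T q u v" using uv by (simp add: periodic_lin_def)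
    define f where "f = (\<lambda>x. if x \<in> {0..T} then u x else 0)"
    have "nontrivial_on T u" using initial_nontrivial[OF uvs uv(2)] .
    then obtain z where "z \<in> {0..T}" "u z \<noteq> 0" by (auto simp: nontrivial_on_def)
    then have "f z \<noteq> 0" by (simp add: f_def)
    then have fnz: "f \<noteq> 0" by (metis zero_fun_apply)
    have "real_fun.dim ?E = 1"
    proof (rule real_fun.dim_unique[of "{f}"])
      show "{f} \<subseteq> ?E" unfolding f_def using ext[OF uv(1)] by simp
      show "real_fun.independent {f}" using fnz by simp
      show "?E \<subseteq> real_fun.span {f}"
      proof
        fix h assume "h \<in> ?E"
        then obtain g where g: "periodic_lin q h g" and h0: "\<And>x. x \<notin> {0..T} \<Longrightarrow> h x = 0"
          unfolding mem by blast
        have W: "u 0 * g 0 - v 0 * h 0 = 0"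
          using independent_periodic_rot_constant[OF q uv(1) g] one by metis
        obtain c where c: "h 0 = c * u 0" "g 0 = c * v 0"
        proof (cases "u 0 = 0")
          case True
          then show ?thesis using that[of "g 0 / v 0"] uv(2) W by auto
        next
          case False
          then show ?thesis using that[of "h 0 / u 0"] W by (auto simp: field_simps)
        qed
        have L2: "lin_solution 0 T q (\<lambda>t. c * u t + 0 * u t) (\<lambda>t. c * v t + 0 * v t)"
          by (rule lin_solution_combination[OF uvs uvs])
        have L1: "lin_solution 0 T q h g" using g by (simp add: periodic_lin_def)
        have "h x = c * u x" if "x \<in> {0..T}" for x
          using lin_solution_unique[OF L1 L2 q _ _ that] c by simp
        then have "h = (\<lambda>x. c * f x)" using h0 by (auto simp: f_def fun_eq_iff)
        then show "h \<in> real_fun.span {f}" unfolding real_fun.span_singleton by auto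
      qed
    qed simp
    then show ?thesis using one by (auto simp: eigenvalue_mult_def)
  qed
qed

subsection \<open>One-parameter families of potentials\<close>

lemma extremal_rot_perturb:
  assumes q1: "q1 absolutely_integrable_on {0..T}" and q2: "q2 absolutely_integrable_on {0..T}"
    and le: "\<And>\<phi>. rot q1 \<phi> \<le> rot q2 \<phi> + e"
  shows "max_rot q1 \<le> max_rot q2 + e" "min_rot q1 \<le> min_rot q2 + e"
proof -
  obtain \<phi> \<psi> where "rot q1 \<phi> = max_rot q1" "rot q2 \<psi> = min_rot q2"
    using max_rot(2)[OF q1] min_rot(2)[OF q2] by blast
  then show "max_rot q1 \<le> max_rot q2 + e" "min_rot q1 \<le> min_rot q2 + e"
    using le[of \<phi>] le[of \<psi>] max_rot(1)[OF q2, of \<phi>] min_rot(1)[OF q1, of \<psi>] by linarith+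
qed

lemma rot_family_continuous:
  assumes q: "q absolutely_integrable_on {0..T}" and p: "p absolutely_integrable_on {0..T}"
  shows "continuous_on UNIV (\<lambda>s. rot (\<lambda>t. q t + s * p t) \<phi>)"
    and "continuous_on UNIV (\<lambda>s. max_rot (\<lambda>t. q t + s * p t))"
    and "continuous_on UNIV (\<lambda>s. min_rot (\<lambda>t. q t + s * p t))"
proof -
  have fam: "(\<lambda>t. q t + s * p t) absolutely_integrable_on {0..T}" for s
    using q p by (intro set_integral_add(1)) auto
  have ex: "\<exists>M. \<forall>s' \<psi>. \<bar>rot (\<lambda>t. q t + s' * p t) \<psi> - rot (\<lambda>t. q t + s * p t) \<psi>\<bar> \<le> M * \<bar>s' - s\<bar>" for s
  proof (intro exI allI)
    fix s' \<psi>
    have "(\<lambda>t. \<bar>(q t + s' * p t) - (q t + s * p t)\<bar>) = (\<lambda>t. \<bar>s' - s\<bar> * \<bar>p t\<bar>)"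
      by (auto simp: abs_mult[symmetric] algebra_simps)
    then show "\<bar>rot (\<lambda>t. q t + s' * p t) \<psi> - rot (\<lambda>t. q t + s * p t) \<psi>\<bar> \<le>
       (exp (2 * integral {0..T} (\<lambda>t. \<bar>coeff (\<lambda>t. q t + s * p t) t\<bar>)) * (integral {0..T} (\<lambda>t. \<bar>p t\<bar>) / \<sigma>)) * \<bar>s' - s\<bar>"
      using rot_stable[OF fam[of s] fam[of s'], of \<psi>] by (simp add: mult_ac)
  qed
  have lim: "isCont f s" if M: "\<And>s'. \<bar>f s' - f s\<bar> \<le> M * \<bar>s' - s\<bar>" for f :: "real \<Rightarrow> real" and s M
  proof -
    have "(f \<longlongrightarrow> f s) (at s)"
    proof (rule LIM_zero_cancel, rule Lim_null_comparison)
      show "\<forall>\<^sub>F x in at s. norm (f x - f s) \<le> M * \<bar>x - s\<bar>" using M by simp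
      show "((\<lambda>x. M * \<bar>x - s\<bar>) \<longlongrightarrow> 0) (at s)"
        by (rule tendsto_eq_intros refl | simp)+
    qed
    then show ?thesis by (simp add: isCont_def)
  qed
  show "continuous_on UNIV (\<lambda>s. rot (\<lambda>t. q t + s * p t) \<phi>)"
  proof (intro continuous_at_imp_continuous_on ballI)
    fix s
    obtain M where M: "\<And>s' \<psi>. \<bar>rot (\<lambda>t. q t + s' * p t) \<psi> - rot (\<lambda>t. q t + s * p t) \<psi>\<bar> \<le> M * \<bar>s' - s\<bar>"
      using ex by blast
    show "isCont (\<lambda>s. rot (\<lambda>t. q t + s * p t) \<phi>) s" by (rule lim) (rule M)
  qed
  have ex2: "\<exists>M. \<forall>s'. \<bar>max_rot (\<lambda>t. q t + s' * p t) - max_rot (\<lambda>t. q t + s * p t)\<bar> \<le> M * \<bar>s' - s\<bar> \<and>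
      \<bar>min_rot (\<lambda>t. q t + s' * p t) - min_rot (\<lambda>t. q t + s * p t)\<bar> \<le> M * \<bar>s' - s\<bar>" for s
  proof -
    obtain M where M: "\<And>s' \<psi>. \<bar>rot (\<lambda>t. q t + s' * p t) \<psi> - rot (\<lambda>t. q t + s * p t) \<psi>\<bar> \<le> M * \<bar>s' - s\<bar>"
      using ex by blast
    show ?thesis
    proof (intro exI[of _ M] allI)
      fix s'
      have 1: "rot (\<lambda>t. q t + s' * p t) \<psi> \<le> rot (\<lambda>t. q t + s * p t) \<psi> + M * \<bar>s' - s\<bar>"
        "rot (\<lambda>t. q t + s * p t) \<psi> \<le> rot (\<lambda>t. q t + s' * p t) \<psi> + M * \<bar>s' - s\<bar>" for \<psi>
        using M[of s' \<psi>] by linarith+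
      show "\<bar>max_rot (\<lambda>t. q t + s' * p t) - max_rot (\<lambda>t. q t + s * p t)\<bar> \<le> M * \<bar>s' - s\<bar> \<and>
      \<bar>min_rot (\<lambda>t. q t + s' * p t) - min_rot (\<lambda>t. q t + s * p t)\<bar> \<le> M * \<bar>s' - s\<bar>"
        using extremal_rot_perturb[OF fam[of s'] fam[of s] 1(1)] extremal_rot_perturb[OF fam[of s] fam[of s'] 1(2)] by linarith
    qed
  qed
  show "continuous_on UNIV (\<lambda>s. max_rot (\<lambda>t. q t + s * p t))"
  proof (intro continuous_at_imp_continuous_on ballI)
    fix s
    obtain M where M: "\<And>s'. \<bar>max_rot (\<lambda>t. q t + s' * p t) - max_rot (\<lambda>t. q t + s * p t)\<bar> \<le> M * \<bar>s' - s\<bar>"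
      using ex2 by blast
    show "isCont (\<lambda>s. max_rot (\<lambda>t. q t + s * p t)) s" by (rule lim) (rule M)
  qed
  show "continuous_on UNIV (\<lambda>s. min_rot (\<lambda>t. q t + s * p t))"
  proof (intro continuous_at_imp_continuous_on ballI)
    fix s
    obtain M where M: "\<And>s'. \<bar>min_rot (\<lambda>t. q t + s' * p t) - min_rot (\<lambda>t. q t + s * p t)\<bar> \<le> M * \<bar>s' - s\<bar>"
      using ex2 by blast
    show "isCont (\<lambda>s. min_rot (\<lambda>t. q t + s * p t)) s" by (rule lim) (rule M)
  qed
qed

lemma shift_continuous:
  assumes a: "a absolutely_integrable_on {0..T}"
  shows "continuous_on UNIV (\<lambda>\<mu>. max_rot (\<lambda>t. \<mu> + a t))" "continuous_on UNIV (\<lambda>\<mu>. min_rot (\<lambda>t. \<mu> + a t))"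
  using rot_family_continuous(2,3)[OF a, of "\<lambda>_. 1"] by (simp_all add: add.commute)

lemma shift_strict_mono:
  assumes a: "a absolutely_integrable_on {0..T}" and "\<mu> < \<nu>"
  shows "max_rot (\<lambda>t. \<mu> + a t) < max_rot (\<lambda>t. \<nu> + a t)" "min_rot (\<lambda>t. \<mu> + a t) < min_rot (\<lambda>t. \<nu> + a t)"
proof -
  note q = shifted_abs_int[OF a]
  have "\<not> (AE t in lebesgue. t \<notin> {0..T})" by (rule interval_not_null[OF T_pos])
  then have lt: "rot (\<lambda>t. \<mu> + a t) \<phi> < rot (\<lambda>t. \<nu> + a t) \<phi>" for \<phi>
    using \<open>\<mu> < \<nu>\<close> by (intro rot_strict_mono q) auto
  obtain \<phi> \<psi> where "rot (\<lambda>t. \<mu> + a t) \<phi> = max_rot (\<lambda>t. \<mu> + a t)" "rot (\<lambda>t. \<nu> + a t) \<psi> = min_rot (\<lambda>t. \<nu> + a t)"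
    using max_rot(2)[OF q] min_rot(2)[OF q] by blast
  then show "max_rot (\<lambda>t. \<mu> + a t) < max_rot (\<lambda>t. \<nu> + a t)" "min_rot (\<lambda>t. \<mu> + a t) < min_rot (\<lambda>t. \<nu> + a t)"
    using lt[of \<phi>] lt[of \<psi>] max_rot(1)[OF q, of \<nu> \<phi>] min_rot(1)[OF q, of \<mu> \<psi>] by linarith+
qed

text \<open>Let \<open>w\<close> be the primitive of \<open>m - a\<close>, \<open>m\<close> being the mean of \<open>a\<close>, with \<open>w(0) = w(T) = 0\<close>. The
  positive function \<open>exp (\<integral>w)\<close> solves the equation with the potential \<open>- w' - w\<^sup>2\<close>, and its angle
  \<open>\<pi>/2 - arctan (w/\<sigma>)\<close> has rotation zero. As \<open>w\<close> is bounded, this potential dominates a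
  translate of \<open>a\<close>.\<close>

lemma min_rot_nonpos:
  assumes a: "a absolutely_integrable_on {0..T}"
  shows "\<exists>\<mu>. min_rot (\<lambda>t. \<mu> + a t) \<le> 0"
proof -
  define m where "m = integral {0..T} a / T"
  have ma: "(\<lambda>t. m - a t) absolutely_integrable_on {0..T}" using a by (intro set_integral_diff(1)) auto
  define w where "w = (\<lambda>x. 0 + integral {0..x} (\<lambda>t. m - a t))"
  have w: "primitive_on 0 T w (\<lambda>t. m - a t)" unfolding w_def by (rule primitive_on_integral[OF ma])
  have w0: "w 0 = 0" by (simp add: w_def)
  have wT: "w T = 0"
    using integral_diff[OF integrable_const_ivl abs_int_imp_int[OF a], of m] T_pos by (simp add: w_def m_def)
  have wc: "continuous_on {0..T} w" using w by (rule primitive_on_continuous)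
  have "bounded (w ` {0..T})" using wc by (intro compact_imp_bounded compact_continuous_image) auto
  then obtain W where W: "\<And>x. x \<in> {0..T} \<Longrightarrow> \<bar>w x\<bar> \<le> W" unfolding bounded_iff by (metis imageI real_norm_def)
  define b where "b = (\<lambda>t. - ((m - a t) + (w t)\<^sup>2))"
  have b: "b absolutely_integrable_on {0..T}"
  proof -
    have "(\<lambda>t. (w t)\<^sup>2) absolutely_integrable_on {0..T}"
      by (intro absolutely_integrable_continuous_real continuous_intros wc)
    then have "(\<lambda>t. (-1) * ((m - a t) + (w t)\<^sup>2)) absolutely_integrable_on {0..T}"
      using ma by (intro set_integrable_mult_right set_integral_add(1))
    then show ?thesis by (simp add: b_def)
  qed
  define \<theta> where "\<theta> = (\<lambda>t. pi/2 + (-1) * arctan ((1/\<sigma>) * w t))"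
  have \<theta>p: "primitive_on 0 T \<theta> (\<lambda>t. 0 + (-1) * (inverse (1 + ((1/\<sigma>) * w t)\<^sup>2) * ((1/\<sigma>) * (m - a t))))"
    unfolding \<theta>_def
  proof (intro primitive_on_add primitive_on_cmult primitive_on_const)
    show "primitive_on 0 T (\<lambda>x. arctan (1 / \<sigma> * w x)) (\<lambda>x. inverse (1 + (1 / \<sigma> * w x)\<^sup>2) * (1 / \<sigma> * (m - a x)))"
    proof (rule primitive_on_compose_UNIV[OF primitive_on_cmult[OF w]])
      show "(arctan has_real_derivative inverse (1 + y\<^sup>2)) (at y)" for y :: real by (rule DERIV_arctan)
      show "continuous_on UNIV (\<lambda>y::real. inverse (1 + y\<^sup>2))"
        by (intro continuous_intros) (metis add_pos_nonneg less_irrefl zero_le_power2 zero_less_one)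
    qed
  qed
  have "pruefer_angle 0 T b \<theta>"
    unfolding pruefer_angle_def angle_solution_def
  proof (rule primitive_on_cong[OF \<theta>p])
    fix t
    define y where "y = (1/\<sigma>) * w t"
    have wy: "w t = \<sigma> * y" using \<sigma>_pos by (simp add: y_def)
    have "sin (\<theta> t) = cos (arctan y)" by (simp add: \<theta>_def y_def sin_diff)
    moreover have p: "1 + y\<^sup>2 > 0" by (metis add_pos_nonneg zero_le_power2 zero_less_one)
    ultimately have s: "(sin (\<theta> t))\<^sup>2 = inverse (1 + y\<^sup>2)"
      by (simp add: cos_arctan power_divide inverse_eq_divide)
    have "\<sigma> = \<sigma> * (1 + y\<^sup>2) * inverse (1 + y\<^sup>2)" using p by simp
    then have "\<sigma> + coeff b t * inverse (1 + y\<^sup>2) = (\<sigma> * (1 + y\<^sup>2) + coeff b t) * inverse (1 + y\<^sup>2)"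
      by (simp add: distrib_right)
    also have "\<sigma> * (1 + y\<^sup>2) + coeff b t = - ((1/\<sigma>) * (m - a t))"
      unfolding b_def wy using \<sigma>_pos by (simp add: power2_eq_square field_simps)
    finally show "0 + (-1) * (inverse (1 + ((1/\<sigma>) * w t)\<^sup>2) * ((1/\<sigma>) * (m - a t))) = \<sigma> + coeff b t * (sin (\<theta> t))\<^sup>2"
      unfolding s y_def[symmetric] by (simp add: mult.commute)
  qed simp
  then have "rot b (\<theta> 0) = \<theta> T - \<theta> 0" by (rule rot_eq[OF _ b])
  also have "\<dots> = 0" using w0 wT by (simp add: \<theta>_def)
  finally have rb: "rot b (\<theta> 0) = 0" .
  define \<mu> where "\<mu> = - m - W\<^sup>2"
  note q = shifted_abs_int[OF a, of \<mu>]
  have "rot (\<lambda>t. \<mu> + a t) (\<theta> 0) \<le> rot b (\<theta> 0)"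
  proof (rule rot_mono[OF q b], rule AE_I2, rule impI)
    fix t assume "t \<in> {0..T}"
    then have "(w t)\<^sup>2 \<le> W\<^sup>2" using W[of t] by (simp add: abs_le_square_iff[symmetric])
    then show "\<mu> + a t \<le> b t" by (simp add: \<mu>_def b_def)
  qed
  then have "min_rot (\<lambda>t. \<mu> + a t) \<le> 0" using min_rot(1)[OF q, of "\<theta> 0"] rb by linarith
  then show ?thesis by blast
qed

text \<open>The angles of one solution in two scales have sines and cosines of the same signs, so if both
  start at \<open>0\<close> they never get \<open>\<pi>/2\<close> apart. In the scale \<open>\<kappa>\<close> the potential \<open>\<kappa>\<^sup>2 + a\<close> has rotation close to \<open>\<kappa> T\<close>.\<close>

lemma rot_large:
  assumes a: "a absolutely_integrable_on {0..T}" and "\<kappa> > 0"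
  shows "rot (\<lambda>t. \<kappa>\<^sup>2 + a t) 0 \<ge> \<kappa> * T - integral {0..T} (\<lambda>t. \<bar>a t\<bar>) / \<kappa> - pi / 2"
proof -
  interpret K: angle_scale T \<kappa> by unfold_locales (use T_pos \<open>\<kappa> > 0\<close> in auto)
  let ?q = "\<lambda>t. \<kappa>\<^sup>2 + a t"
  have T0: "0 \<le> T" using T_pos by simp
  note q = shifted_abs_int[OF a, of "\<kappa>\<^sup>2"]
  obtain \<psi> where \<psi>: "K.pruefer_angle 0 T ?q \<psi>" "\<psi> 0 = 0" using K.pruefer_angle_exists[OF q T0, of 0] .
  have \<psi>p: "primitive_on 0 T \<psi> (\<lambda>t. \<kappa> + (?q t / \<kappa> - \<kappa>) * (sin (\<psi> t))\<^sup>2)"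
    using \<psi>(1) by (simp add: K.pruefer_angle_def angle_solution_def)
  have "\<psi> T \<ge> \<kappa> * T - integral {0..T} (\<lambda>t. \<bar>a t\<bar>) / \<kappa>"
  proof -
    have i: "(\<lambda>t. \<kappa> + (?q t / \<kappa> - \<kappa>) * (sin (\<psi> t))\<^sup>2) integrable_on {0..T}"
      using abs_int_imp_int[OF primitive_on_abs_int[OF \<psi>p]] .
    have ia: "(\<lambda>t. \<bar>a t\<bar> / \<kappa>) integrable_on {0..T}"
      using abs_int_imp_int[OF set_integrable_abs[OF a]] by (rule integrable_on_divide)
    have "integral {0..T} (\<lambda>t. \<kappa> - \<bar>a t\<bar> / \<kappa>) \<le> integral {0..T} (\<lambda>t. \<kappa> + (?q t / \<kappa> - \<kappa>) * (sin (\<psi> t))\<^sup>2)"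
    proof (rule integral_le[OF _ i])
      show "(\<lambda>t. \<kappa> - \<bar>a t\<bar> / \<kappa>) integrable_on {0..T}" using ia by (intro integrable_diff) auto
      fix t
      have eq: "?q t / \<kappa> - \<kappa> = a t / \<kappa>" using \<open>\<kappa> > 0\<close> by (simp add: power2_eq_square add_divide_distrib)
      have "\<bar>a t / \<kappa> * (sin (\<psi> t))\<^sup>2\<bar> \<le> \<bar>a t\<bar> / \<kappa>"
        using \<open>\<kappa> > 0\<close> mult_left_le[of "(sin (\<psi> t))\<^sup>2" "\<bar>a t\<bar> / \<kappa>"] by (simp add: abs_mult abs_square_le_1)
      then show "\<kappa> - \<bar>a t\<bar> / \<kappa> \<le> \<kappa> + (?q t / \<kappa> - \<kappa>) * (sin (\<psi> t))\<^sup>2" unfolding eq by linarith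
    qed
    also have "integral {0..T} (\<lambda>t. \<kappa> - \<bar>a t\<bar> / \<kappa>) = \<kappa> * T - integral {0..T} (\<lambda>t. \<bar>a t\<bar>) / \<kappa>"
      using integral_diff[OF integrable_const_ivl ia, of \<kappa>] T0 by simp
    finally show ?thesis using primitive_onD[OF \<psi>p, of T] \<psi>(2) T0 by simp
  qed
  moreover
  obtain \<rho> where \<rho>: "\<And>x. \<rho> x > 0" "\<rho> 0 = 1"
    "lin_solution 0 T ?q (\<lambda>x. \<rho> x * sin (\<psi> x)) (\<lambda>x. \<kappa> * \<rho> x * cos (\<psi> x))"
    using K.angle_to_solution[OF \<psi>(1) q] by metis
  obtain \<theta> r where \<theta>: "pruefer_angle 0 T ?q \<theta>" "\<theta> 0 = 0" "\<And>x. r x > 0"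
    "\<And>x. x \<in> {0..T} \<Longrightarrow> \<rho> x * sin (\<psi> x) = r x * sin (\<theta> x)"
    "\<And>x. x \<in> {0..T} \<Longrightarrow> \<kappa> * \<rho> x * cos (\<psi> x) = \<sigma> * (r x * cos (\<theta> x))"
    using solution_to_angle[OF \<rho>(3) q T0, of "\<kappa> / \<sigma>" 0] \<psi>(2) \<rho>(2) \<open>\<kappa> > 0\<close> \<sigma>_pos by auto
  have cpos: "cos (\<theta> x - \<psi> x) > 0" if x: "x \<in> {0..T}" for x
  proof -
    have "sin (\<theta> x) = \<rho> x / r x * sin (\<psi> x)" "cos (\<theta> x) = \<kappa> * \<rho> x / (\<sigma> * r x) * cos (\<psi> x)"
      using \<theta>(4,5)[OF x] \<theta>(3)[of x] \<sigma>_pos by (simp_all add: field_simps)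
    then have "cos (\<theta> x - \<psi> x) = \<kappa> * \<rho> x / (\<sigma> * r x) * (cos (\<psi> x))\<^sup>2 + \<rho> x / r x * (sin (\<psi> x))\<^sup>2"
      by (simp add: cos_diff power2_eq_square)
    moreover have pos: "\<kappa> * \<rho> x / (\<sigma> * r x) > 0" "\<rho> x / r x > 0"
      using \<rho>(1) \<theta>(3) \<sigma>_pos \<open>\<kappa> > 0\<close> by simp_all
    moreover have "cos (\<psi> x) \<noteq> 0 \<or> sin (\<psi> x) \<noteq> 0" using sin_zero_norm_cos_one[of "\<psi> x"] by force
    ultimately show ?thesis
      by (metis add_nonneg_pos add_pos_nonneg less_imp_le mult_nonneg_nonneg mult_pos_pos zero_le_power2 zero_less_power2)
  qed
  have cont: "continuous_on {0..T} (\<lambda>x. \<theta> x - \<psi> x)"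
    using \<theta>(1) \<psi>(1) unfolding pruefer_angle_def K.pruefer_angle_def
    by (intro continuous_intros angle_solution_continuous)
  have "\<theta> T - \<psi> T > - (pi / 2)"
  proof (rule ccontr)
    assume "\<not> \<theta> T - \<psi> T > - (pi / 2)"
    then obtain x where "0 \<le> x" "x \<le> T" "\<theta> x - \<psi> x = - (pi / 2)"
      using IVT2'[of "\<lambda>x. \<theta> x - \<psi> x" T "- (pi/2)" 0] cont T0 \<theta>(2) \<psi>(2) by auto
    then show False using cpos[of x] by simp
  qed
  moreover have "rot ?q 0 = \<theta> T" using rot_eq[OF \<theta>(1) q] \<theta>(2) by simp
  ultimately show ?thesis by linarith
qed

lemma min_rot_unbounded:
  assumes a: "a absolutely_integrable_on {0..T}"
  shows "\<exists>\<mu>. min_rot (\<lambda>t. \<mu> + a t) \<ge> B"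
proof -
  define A where "A = integral {0..T} (\<lambda>t. \<bar>a t\<bar>)"
  have A: "A \<ge> 0" unfolding A_def
    using abs_int_imp_int[OF set_integrable_abs[OF a]] by (intro Henstock_Kurzweil_Integration.integral_nonneg) auto
  define \<kappa> where "\<kappa> = max 1 ((A + B + 2 * pi) / T)"
  have \<kappa>: "\<kappa> \<ge> 1" "(A + B + 2 * pi) / T \<le> \<kappa>" by (simp_all add: \<kappa>_def)
  have "A + B + 2 * pi \<le> \<kappa> * T" using \<kappa>(2) T_pos by (simp add: pos_divide_le_eq)
  moreover have "A / \<kappa> \<le> A" using A \<kappa>(1) by (simp add: pos_divide_le_eq mult_le_cancel_left1)
  moreover have "\<kappa> * T - A / \<kappa> - pi / 2 \<le> rot (\<lambda>t. \<kappa>\<^sup>2 + a t) 0"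
    using rot_large[OF a, of \<kappa>] \<kappa>(1) by (simp add: A_def)
  ultimately have "B + pi \<le> rot (\<lambda>t. \<kappa>\<^sup>2 + a t) 0"
    using pi_gt_zero by linarith
  then have "B \<le> min_rot (\<lambda>t. \<kappa>\<^sup>2 + a t)"
    using max_rot(1)[OF shifted_abs_int[OF a, of "\<kappa>\<^sup>2"], of 0] extremal_rot_gap(1)[OF shifted_abs_int[OF a, of "\<kappa>\<^sup>2"]]
    by linarith
  then show ?thesis by blast
qed

end

subsection \<open>The eigenvalue sequence\<close>

text \<open>At the first index where two such sequences differ, the smaller of the two values would occur
  more often in one sequence than in the other.\<close>

lemma eigenvalue_sequence_unique:
  assumes l: "is_eigenvalue_sequence T a l" and l': "is_eigenvalue_sequence T a l'"
  shows "l = l'"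
proof -
  have half: "\<not> f k < g k" if eq: "\<And>j. j < k \<Longrightarrow> f j = g j"
    and f: "is_eigenvalue_sequence T a f" and g: "is_eigenvalue_sequence T a g" for f g k
  proof
    assume lt: "f k < g k"
    have "{j. g j = f k} \<subseteq> {j. f j = f k} - {k}"
    proof
      fix j assume j: "j \<in> {j. g j = f k}"
      have "j < k"
      proof (rule ccontr)
        assume "\<not> j < k"
        then have "g k \<le> g j" using g by (auto simp: is_eigenvalue_sequence_def mono_def)
        then show False using j lt by simp
      qed
      then show "j \<in> {j. f j = f k} - {k}" using eq[of j] j by auto
    qed
    moreover have fin: "finite {j. f j = f k}" and card: "card {j. f j = f k} = card {j. g j = f k}"
      using f g by (auto simp: is_eigenvalue_sequence_def)
    ultimately have "card {j. g j = f k} \<le> card ({j. f j = f k} - {k})" by (intro card_mono) auto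
    also have "\<dots> < card {j. f j = f k}" using fin by (intro card_Diff1_less) auto
    finally show False using card by simp
  qed
  have "l k = l' k" for k
  proof (induction k rule: less_induct)
    case (less k)
    show ?case using half[of k l l'] half[of k l' l] less l l' by fastforce
  qed
  then show ?thesis by auto
qed

context angle_scale
begin

text \<open>As functions of \<open>\<mu>\<close> the extremal rotations are continuous and strictly increasing. The minimum
  takes nonpositive and arbitrarily large values, the maximum is always positive, and they differ by
  less than \<open>\<pi>\<close>. So the minimum takes each value \<open>2 \<pi> k\<close> with \<open>k \<ge> 0\<close> and the maximum each value
  \<open>2 \<pi> (k + 1)\<close>, at parameters \<open>A 0 < B 0 \<le> A 1 < B 1 \<le> \<dots>\<close>, and no other multiples of \<open>2 \<pi>\<close>
  occur.\<close>

lemma eigenvalue_characterization: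
  assumes a: "a absolutely_integrable_on {0..T}"
  shows "min_rot (\<lambda>t. eigenvalue T a (2 * k) + a t) = 2 * pi * real k"
    and "k \<ge> 1 \<Longrightarrow> max_rot (\<lambda>t. eigenvalue T a (2 * k - 1) + a t) = 2 * pi * real k"
proof -
  note q = shifted_abs_int[OF a]
  define mx mn where "mx = (\<lambda>\<mu>. max_rot (\<lambda>t. \<mu> + a t))" and "mn = (\<lambda>\<mu>. min_rot (\<lambda>t. \<mu> + a t))"
  have mx_mono: "mx \<mu> < mx \<nu>" and mn_mono: "mn \<mu> < mn \<nu>" if "\<mu> < \<nu>" for \<mu> \<nu>
    using shift_strict_mono[OF a that] by (simp_all add: mx_def mn_def)
  have mx_inj: "mx \<mu> = mx \<nu> \<longleftrightarrow> \<mu> = \<nu>" and mn_inj: "mn \<mu> = mn \<nu> \<longleftrightarrow> \<mu> = \<nu>" for \<mu> \<nu>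
    using mx_mono mn_mono by (metis less_irrefl linorder_neqE_linordered_idom)+
  have mx_le: "mx \<mu> \<le> mx \<nu> \<longleftrightarrow> \<mu> \<le> \<nu>" for \<mu> \<nu>
    using mx_mono[of \<mu> \<nu>] mx_mono[of \<nu> \<mu>] by (cases \<mu> \<nu> rule: linorder_cases) auto
  have mnmx: "mn \<mu> \<le> mx \<mu>" "mx \<mu> < mn \<mu> + pi" for \<mu>
    using extremal_rot_gap[OF q[of \<mu>]] by (simp_all add: mx_def mn_def)
  have pos: "mx \<mu> > 0" for \<mu> using max_rot_pos[OF q[of \<mu>]] by (simp add: mx_def)
  obtain \<mu>0 where \<mu>0: "mn \<mu>0 \<le> 0" using min_rot_nonpos[OF a] by (auto simp: mn_def)
  have mnk: "\<exists>\<mu>. mn \<mu> = 2 * pi * real k" for k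
  proof -
    obtain \<mu>1 where \<mu>1: "mn \<mu>1 \<ge> 2 * pi * real k" using min_rot_unbounded[OF a] by (auto simp: mn_def)
    have "0 \<le> 2 * pi * real k" by simp
    then have "mn \<mu>0 \<le> mn \<mu>1" using \<mu>0 \<mu>1 by linarith
    then have "\<mu>0 \<le> \<mu>1" using mn_mono[of \<mu>1 \<mu>0] by fastforce
    moreover have "mn \<mu>0 \<le> 2 * pi * real k" using \<mu>0 \<open>0 \<le> 2 * pi * real k\<close> by linarith
    moreover have "continuous_on {\<mu>0..\<mu>1} mn"
      using shift_continuous(2)[OF a] unfolding mn_def by (rule continuous_on_subset) simp
    ultimately show ?thesis using IVT'[of mn \<mu>0 "2 * pi * real k" \<mu>1] \<mu>1 by blast
  qed
  have mxk: "\<exists>\<mu>. mx \<mu> = 2 * pi * real (k + 1)" for k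
  proof -
    obtain \<mu>1 where \<mu>1: "mn \<mu>1 \<ge> 2 * pi * real (k + 1)" using min_rot_unbounded[OF a] by (auto simp: mn_def)
    have p: "mx \<mu>0 \<le> 2 * pi * real (k + 1)"
    proof -
      have "mx \<mu>0 < pi * 1" using mnmx(2)[of \<mu>0] \<mu>0 by simp
      also have "pi * 1 \<le> pi * (2 * real (k + 1))" by (intro mult_left_mono) auto
      finally show ?thesis by (simp only: mult_ac less_imp_le)
    qed
    have "mx \<mu>0 \<le> mx \<mu>1" using mnmx(1)[of \<mu>1] \<mu>1 p by linarith
    then have "\<mu>0 \<le> \<mu>1" by (simp add: mx_le)
    moreover have "2 * pi * real (k + 1) \<le> mx \<mu>1" using \<mu>1 mnmx(1)[of \<mu>1] by linarith
    moreover have "continuous_on {\<mu>0..\<mu>1} mx"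
      using shift_continuous(1)[OF a] unfolding mx_def by (rule continuous_on_subset) simp
    ultimately show ?thesis using IVT'[of mx \<mu>0 "2 * pi * real (k + 1)" \<mu>1] p by blast
  qed
  obtain A where A: "\<And>k. mn (A k) = 2 * pi * real k" using mnk by metis
  obtain B where B: "\<And>k. mx (B k) = 2 * pi * real (k + 1)" using mxk by metis
  define l where "l = (\<lambda>j. if even j then A (j div 2) else B (j div 2))"
  have AB: "A k < B k" for k
  proof -
    have "mx (A k) < 2 * pi * real k + pi" using mnmx(2)[of "A k"] A[of k] by simp
    also have "\<dots> \<le> mx (B k)" using pi_gt_zero by (simp add: B algebra_simps)
    finally show ?thesis using mx_le[of "B k" "A k"] by auto
  qed
  have BA: "B k \<le> A (k + 1)" for k
    using mnmx(1)[of "A (k+1)"] A[of "k+1"] B[of k] mx_le[of "B k" "A (k+1)"] by simp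
  have "mono l"
    unfolding mono_iff_le_Suc
  proof
    fix j show "l j \<le> l (Suc j)"
    proof (cases "even j")
      case True
      then show ?thesis using AB[of "j div 2"] by (simp add: l_def)
    next
      case False
      then show ?thesis using BA[of "j div 2"] by (simp add: l_def)
    qed
  qed
  have cardeq: "card {j. l j = \<mu>} = eigenvalue_mult T a \<mu> \<and> finite {j. l j = \<mu>}" for \<mu>
  proof -
    let ?A = "{k. A k = \<mu>}" and ?B = "{k. B k = \<mu>}"
    have inj: "inj (\<lambda>k::nat. 2 * k)" "inj (\<lambda>k::nat. 2 * k + 1)" by (auto intro!: injI)
    have "{j. l j = \<mu>} = (\<lambda>k. 2 * k) ` ?A \<union> (\<lambda>k. 2 * k + 1) ` ?B"
    proof (intro equalityI subsetI)
      fix j assume "j \<in> {j. l j = \<mu>}"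
      then show "j \<in> (\<lambda>k. 2 * k) ` ?A \<union> (\<lambda>k. 2 * k + 1) ` ?B"
        by (cases "even j") (auto simp: l_def elim!: evenE oddE)
    qed (auto simp: l_def)
    moreover have kA: "A k = \<mu> \<longleftrightarrow> mn \<mu> = 2 * pi * real k" for k using A mn_inj by metis
    moreover have kB: "B k = \<mu> \<longleftrightarrow> mx \<mu> = 2 * pi * real (k + 1)" for k using B mx_inj by metis
    moreover have cA: "finite ?A \<and> card ?A = (if \<exists>k::int. mn \<mu> = 2 * pi * of_int k then 1 else 0)"
    proof (cases "\<exists>k::int. mn \<mu> = 2 * pi * of_int k")
      case True
      then obtain k :: int where k: "mn \<mu> = 2 * pi * of_int k" by blast
      have "k \<ge> 0"
      proof (rule ccontr)
        assume "\<not> k \<ge> 0"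
        then have "of_int k \<le> (-1 :: real)" using of_int_le_iff[of k "-1", where ?'a = real] by simp
        then have "pi * (2 * of_int k) \<le> pi * (-2)" by (intro mult_left_mono) auto
        then show False using mnmx(2)[of \<mu>] pos[of \<mu>] k pi_gt_zero by simp
      qed
      then have "?A = {nat k}" unfolding kA k by auto
      then show ?thesis using True by simp
    next
      case False
      then have "?A = {}" unfolding kA by (metis (mono_tags, lifting) Collect_empty_eq of_int_of_nat_eq)
      then show ?thesis using False by simp
    qed
    moreover have cB: "finite ?B \<and> card ?B = (if \<exists>k::int. mx \<mu> = 2 * pi * of_int k then 1 else 0)"
    proof (cases "\<exists>k::int. mx \<mu> = 2 * pi * of_int k")
      case True
      then obtain k :: int where k: "mx \<mu> = 2 * pi * of_int k" by blast
      have "0 < pi * of_int k" using pos[of \<mu>] k by simp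
      then have "k > 0" by (simp add: zero_less_mult_iff)
      then have "?B = {nat (k - 1)}" unfolding kB k by auto
      then show ?thesis using True by simp
    next
      case False
      then have "?B = {}" unfolding kB by (metis (mono_tags, lifting) Collect_empty_eq of_int_of_nat_eq)
      then show ?thesis using False by simp
    qed
    moreover have "(\<lambda>k. 2 * k) ` ?A \<inter> (\<lambda>k. 2 * k + 1) ` ?B = {}" by (auto; presburger)
    ultimately show ?thesis
      using card_image[OF inj_on_subset[OF inj(1)], of ?A] card_image[OF inj_on_subset[OF inj(2)], of ?B]
      by (simp add: card_Un_disjoint eigenvalue_mult_eq[OF a] mx_def mn_def)
  qed
  have seq: "is_eigenvalue_sequence T a l"
    using \<open>mono l\<close> cardeq by (simp add: is_eigenvalue_sequence_def)
  have ev: "eigenvalue T a = l"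
    unfolding eigenvalue_def
    by (rule the_equality[of "is_eigenvalue_sequence T a", OF seq]) (rule eigenvalue_sequence_unique[OF _ seq])
  show "min_rot (\<lambda>t. eigenvalue T a (2 * k) + a t) = 2 * pi * real k"
    using A[of k] by (simp add: ev l_def mn_def)
  show "max_rot (\<lambda>t. eigenvalue T a (2 * k - 1) + a t) = 2 * pi * real k" if "k \<ge> 1"
  proof -
    have "2 * k - 1 = 2 * (k - 1) + 1" using that by simp
    then have "l (2 * k - 1) = B (k - 1)" by (simp add: l_def)
    then show ?thesis using B[of "k - 1"] that by (simp add: ev mx_def)
  qed
qed

end

section \<open>Quarter turns\<close>

lemma cot_diff: "sin x \<noteq> 0 \<Longrightarrow> sin y \<noteq> 0 \<Longrightarrow> cot x - cot y = sin (y - x) / (sin x * sin y)" for x y :: real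
  by (simp add: cot_def sin_diff diff_frac_eq mult_ac)

lemma cot_strict_antimono:
  assumes "0 < x" "x < y" "y < pi"
  shows "cot y < cot x"
proof -
  have "sin x > 0" "sin y > 0" "sin (y - x) > 0" using assms by (auto intro!: sin_gt_zero)
  then have "cot x - cot y > 0" by (subst cot_diff) auto
  then show ?thesis by simp
qed

lemma cot_pi_minus: "cot (pi - x) = - cot x" for x :: real
  by (simp add: cot_def)

lemma primitive_on_cot:
  assumes p: "primitive_on c d f g" and AB: "0 < A" "B < pi" "\<And>x. x \<in> {c..d} \<Longrightarrow> f x \<in> {A..B}"
  shows "primitive_on c d (\<lambda>x. cot (f x)) (\<lambda>x. - inverse ((sin (f x))\<^sup>2) * g x)"
proof (rule primitive_on_compose[OF p _ _ AB(3)])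
  have nz: "sin y \<noteq> 0" if "y \<in> {A..B}" for y using that AB sin_gt_zero[of y] by auto
  show "(cot has_real_derivative - inverse ((sin y)\<^sup>2)) (at y)" if "y \<in> {A..B}" for y
    using DERIV_cot[OF nz[OF that]] .
  show "continuous_on {A..B} (\<lambda>y. - inverse ((sin y)\<^sup>2))"
    by (intro continuous_intros) (use nz in auto)
qed

text \<open>The angle \<open>\<psi>\<close> is compared with \<open>\<xi>\<close>, which has the increments of \<open>\<psi> - \<sigma> t\<close>; since
  \<open>sin\<^sup>2 \<psi> \<le> sin\<^sup>2 \<xi>\<close>, the cotangent of \<open>\<xi>\<close> decreases at most at the rate \<open>r\<close>.\<close>

lemma cot_increment_bound:
  assumes \<xi>: "primitive_on c d \<xi> (\<lambda>t. r t * (sin (\<psi> t))\<^sup>2)" and "c \<le> d"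
    and r: "r absolutely_integrable_on {c..d}" "AE t in lebesgue. t \<in> {c..d} \<longrightarrow> 0 \<le> r t"
    and range: "0 < \<xi> c" "\<xi> d < pi"
    and le: "\<And>t. t \<in> {c<..<d} \<Longrightarrow> (sin (\<psi> t))\<^sup>2 < (sin (\<xi> t))\<^sup>2"
  shows "cot (\<xi> c) - cot (\<xi> d) \<le> integral {c..d} r"
    and "integral {c..d} r = cot (\<xi> c) - cot (\<xi> d) \<Longrightarrow> \<xi> c = \<xi> d"
proof -
  have in_range: "\<xi> t \<in> {\<xi> c..\<xi> d}" if "t \<in> {c..d}" for t
  proof -
    have nn: "AE t in lebesgue. t \<in> {c..d} \<longrightarrow> 0 \<le> r t * (sin (\<psi> t))\<^sup>2"
      using r(2) by eventually_elim auto
    show ?thesis using primitive_on_mono[OF \<xi> nn, of c t] primitive_on_mono[OF \<xi> nn, of t d] that by simp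
  qed
  define R where "R = (\<lambda>t. 0 + integral {c..t} r)"
  have R: "primitive_on c d R r" unfolding R_def by (rule primitive_on_integral[OF r(1)])
  define g where "g = (\<lambda>t. r t + - inverse ((sin (\<xi> t))\<^sup>2) * (r t * (sin (\<psi> t))\<^sup>2))"
  have P: "primitive_on c d (\<lambda>t. R t + cot (\<xi> t)) g"
    unfolding g_def by (intro primitive_on_add R primitive_on_cot[OF \<xi> range in_range])
  \<comment> \<open>the strict inequality between the squared sines is only assumed in the interior\<close>
  have ends: "AE t in lebesgue. t \<notin> {c,d}"
    by (rule AE_I'[of "{c,d}"]) (auto simp: negligible_iff_null_sets[symmetric])
  have g: "g t = r t * (((sin (\<xi> t))\<^sup>2 - (sin (\<psi> t))\<^sup>2) / (sin (\<xi> t))\<^sup>2)"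
    and pos: "((sin (\<xi> t))\<^sup>2 - (sin (\<psi> t))\<^sup>2) / (sin (\<xi> t))\<^sup>2 > 0" if "t \<in> {c<..<d}" for t
  proof -
    have "0 \<le> (sin (\<psi> t))\<^sup>2" by simp
    then have s: "(sin (\<xi> t))\<^sup>2 > 0" using le[OF that] by linarith
    then show "g t = r t * (((sin (\<xi> t))\<^sup>2 - (sin (\<psi> t))\<^sup>2) / (sin (\<xi> t))\<^sup>2)"
      unfolding g_def diff_divide_distrib by (simp add: divide_inverse algebra_simps)
    show "((sin (\<xi> t))\<^sup>2 - (sin (\<psi> t))\<^sup>2) / (sin (\<xi> t))\<^sup>2 > 0" using s le[OF that] by simp
  qed
  have gnn: "AE t in lebesgue. t \<in> {c..d} \<longrightarrow> 0 \<le> g t"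
    using r(2) ends
  proof eventually_elim
    case (elim t)
    show ?case
    proof
      assume t: "t \<in> {c..d}"
      then have tt: "t \<in> {c<..<d}" using elim by auto
      show "0 \<le> g t"
        unfolding g[OF tt] using elim t pos[OF tt] by (intro mult_nonneg_nonneg) auto
    qed
  qed
  have "R c + cot (\<xi> c) \<le> R d + cot (\<xi> d)"
    using primitive_on_mono[OF P gnn] \<open>c \<le> d\<close> by simp
  then show "cot (\<xi> c) - cot (\<xi> d) \<le> integral {c..d} r" by (simp add: R_def)
  assume eq: "integral {c..d} r = cot (\<xi> c) - cot (\<xi> d)"
  then have "\<not> R c + cot (\<xi> c) < R d + cot (\<xi> d)" by (simp add: R_def)
  then have "AE t in lebesgue. t \<in> {c..d} \<longrightarrow> g t = 0"
    using primitive_on_strict_growth[OF P \<open>c \<le> d\<close> gnn] by blast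
  then have "AE t in lebesgue. t \<in> {c..d} \<longrightarrow> r t * (sin (\<psi> t))\<^sup>2 = 0"
    using ends
  proof eventually_elim
    case (elim t)
    show ?case
    proof
      assume t: "t \<in> {c..d}"
      then have tt: "t \<in> {c<..<d}" using elim by auto
      have "g t = 0" using elim t by simp
      then have "r t = 0" unfolding g[OF tt] mult_eq_0_iff using pos[OF tt] by linarith
      then show "r t * (sin (\<psi> t))\<^sup>2 = 0" by simp
    qed
  qed
  then have "primitive_on c d \<xi> (\<lambda>_. 0)" by (rule primitive_on_spike[OF \<xi>])
  from primitive_onD[OF this, of d] show "\<xi> c = \<xi> d" using \<open>c \<le> d\<close> by simp
qed

lemma angle_growth:
  assumes s: "angle_solution c d \<sigma> r \<psi>" and r: "AE t in lebesgue. t \<in> {c..d} \<longrightarrow> 0 \<le> r t"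
    and "c \<le> s" "s \<le> t" "t \<le> d"
  shows "\<psi> s + \<sigma> * (t - s) \<le> \<psi> t"
proof -
  have "primitive_on c d (\<lambda>t. \<psi> t - \<sigma> * t) (\<lambda>t. (\<sigma> + r t * (sin (\<psi> t))\<^sup>2) - \<sigma> * 1)"
    using s unfolding angle_solution_def by (intro primitive_on_diff_fun primitive_on_cmult primitive_on_ident)
  then have "primitive_on c d (\<lambda>t. \<psi> t - \<sigma> * t) (\<lambda>t. r t * (sin (\<psi> t))\<^sup>2)" by simp
  moreover have "AE t in lebesgue. t \<in> {c..d} \<longrightarrow> 0 \<le> r t * (sin (\<psi> t))\<^sup>2"
    using r by eventually_elim auto
  ultimately have "\<psi> s - \<sigma> * s \<le> \<psi> t - \<sigma> * t" using assms(3-5) by (rule primitive_on_mono)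
  then show ?thesis by (simp add: algebra_simps)
qed

text \<open>On a first quarter the comparison phase is \<open>\<xi> = \<psi> + \<sigma> (d - t)\<close>, which runs from \<open>\<sigma> (d - c)\<close>
  to \<open>\<pi>/2\<close>; on a second quarter it is \<open>\<xi> = \<psi> - \<sigma> (t - c)\<close>, which runs from \<open>\<pi>/2\<close> to
  \<open>\<pi> - \<sigma> (d - c)\<close>. In both cases \<open>\<xi>\<close> is closer to \<open>\<pi>/2\<close> than \<open>\<psi>\<close> is.\<close>

lemma quarter_turn_normalized:
  assumes s: "angle_solution c d \<sigma> r \<psi>" and "\<sigma> > 0" "c < d"
    and r: "r absolutely_integrable_on {c..d}" "AE t in lebesgue. t \<in> {c..d} \<longrightarrow> 0 \<le> r t"
    and start: "\<psi> c = 0 \<or> \<psi> c = pi / 2" and turn: "\<psi> d = \<psi> c + pi / 2"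
  shows "\<sigma> * (d - c) \<le> pi / 2"
    and "cot (\<sigma> * (d - c)) \<le> integral {c..d} r"
    and "integral {c..d} r = cot (\<sigma> * (d - c)) \<Longrightarrow> \<sigma> * (d - c) = pi / 2"
proof -
  note grow = angle_growth[OF s r(2)]
  show L: "\<sigma> * (d - c) \<le> pi / 2" using grow[of c d] turn \<open>c < d\<close> by simp
  have L0: "\<sigma> * (d - c) > 0" using \<open>\<sigma> > 0\<close> \<open>c < d\<close> by simp
  have prim: "primitive_on c d (\<lambda>t. k + (\<psi> t - \<sigma> * t)) (\<lambda>t. r t * (sin (\<psi> t))\<^sup>2)" for k
  proof -
    have "primitive_on c d (\<lambda>t. k + (\<psi> t - \<sigma> * t)) (\<lambda>t. 0 + ((\<sigma> + r t * (sin (\<psi> t))\<^sup>2) - \<sigma> * 1))"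
      using s unfolding angle_solution_def
      by (intro primitive_on_diff_fun primitive_on_cmult primitive_on_ident primitive_on_add primitive_on_const)
    then show ?thesis by simp
  qed
  have "cot (\<sigma> * (d - c)) \<le> integral {c..d} r \<and>
    (integral {c..d} r = cot (\<sigma> * (d - c)) \<longrightarrow> \<sigma> * (d - c) = pi / 2)"
    using start
  proof
    assume 0: "\<psi> c = 0"
    define \<xi> where "\<xi> = (\<lambda>t. \<sigma> * d + (\<psi> t - \<sigma> * t))"
    have ends: "\<xi> c = \<sigma> * (d - c)" "\<xi> d = pi / 2" using 0 turn by (simp_all add: \<xi>_def algebra_simps)
    have lt: "(sin (\<psi> t))\<^sup>2 < (sin (\<xi> t))\<^sup>2" if t: "t \<in> {c<..<d}" for t
    proof -
      have "0 \<le> \<psi> t" using grow[of c t] 0 t \<open>\<sigma> > 0\<close> by (smt (verit) greaterThanLessThan_iff mult_nonneg_nonneg)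
      moreover have "\<psi> t < \<xi> t" using t \<open>\<sigma> > 0\<close> by (simp add: \<xi>_def)
      moreover have "\<xi> t \<le> pi / 2" using grow[of t d] t turn 0 by (simp add: \<xi>_def algebra_simps)
      ultimately have "0 \<le> sin (\<psi> t)" "sin (\<psi> t) < sin (\<xi> t)"
        using sin_ge_zero[of "\<psi> t"] sin_monotone_2pi[of "\<psi> t" "\<xi> t"] by auto
      then show ?thesis by (intro power_strict_mono) auto
    qed
    have b: "0 < \<xi> c" "\<xi> d < pi" using ends L0 pi_gt_zero by linarith+
    note cib = cot_increment_bound[OF prim[of "\<sigma> * d", folded \<xi>_def] less_imp_le[OF \<open>c < d\<close>] r b lt]
    have "cot (\<xi> d) = 0" unfolding ends by (simp add: cot_def)
    then show ?thesis using cib unfolding ends by auto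
  next
    assume 0: "\<psi> c = pi / 2"
    define \<xi> where "\<xi> = (\<lambda>t. \<sigma> * c + (\<psi> t - \<sigma> * t))"
    have ends: "\<xi> c = pi / 2" "\<xi> d = pi - \<sigma> * (d - c)" using 0 turn by (simp_all add: \<xi>_def algebra_simps)
    have lt: "(sin (\<psi> t))\<^sup>2 < (sin (\<xi> t))\<^sup>2" if t: "t \<in> {c<..<d}" for t
    proof -
      have "\<psi> t \<le> pi" using grow[of t d] 0 t turn \<open>\<sigma> > 0\<close> by (smt (verit) greaterThanLessThan_iff mult_nonneg_nonneg field_sum_of_halves)
      moreover have "\<xi> t < \<psi> t" using t \<open>\<sigma> > 0\<close> by (simp add: \<xi>_def)
      moreover have "pi / 2 \<le> \<xi> t" using grow[of c t] t turn 0 by (simp add: \<xi>_def algebra_simps)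
      ultimately have "0 \<le> sin (pi - \<psi> t)" "sin (pi - \<psi> t) < sin (pi - \<xi> t)"
        using sin_ge_zero[of "pi - \<psi> t"] sin_monotone_2pi[of "pi - \<psi> t" "pi - \<xi> t"] by auto
      then show ?thesis unfolding sin_pi_minus by (intro power_strict_mono) auto
    qed
    have b: "0 < \<xi> c" "\<xi> d < pi" using ends L0 pi_gt_zero by linarith+
    note cib = cot_increment_bound[OF prim[of "\<sigma> * c", folded \<xi>_def] less_imp_le[OF \<open>c < d\<close>] r b lt]
    have "cot (\<xi> c) = 0" unfolding ends by (simp add: cot_def)
    then show ?thesis using cib unfolding ends by (auto simp: cot_pi_minus)
  qed
  then show "cot (\<sigma> * (d - c)) \<le> integral {c..d} r"
    "integral {c..d} r = cot (\<sigma> * (d - c)) \<Longrightarrow> \<sigma> * (d - c) = pi / 2" by auto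
qed

lemma quarter_turn:
  assumes s: "angle_solution c d \<sigma> r \<psi>" and "\<sigma> > 0" "c < d"
    and r: "r absolutely_integrable_on {c..d}" "AE t in lebesgue. t \<in> {c..d} \<longrightarrow> 0 \<le> r t"
    and start: "\<psi> c = of_int j * (pi / 2)" and turn: "\<psi> d = \<psi> c + pi / 2"
  shows "\<sigma> * (d - c) \<le> pi / 2"
    and "cot (\<sigma> * (d - c)) \<le> integral {c..d} r"
    and "integral {c..d} r = cot (\<sigma> * (d - c)) \<Longrightarrow> \<sigma> * (d - c) = pi / 2"
proof -
  define i where "i = j div 2"
  define \<psi>' where "\<psi>' = (\<lambda>t. \<psi> t + of_int (- i) * pi)"
  have s': "angle_solution c d \<sigma> r \<psi>'" unfolding \<psi>'_def using s by (rule angle_solution_add_pi)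
  have "j = 2 * i \<or> j = 2 * i + 1" unfolding i_def by presburger
  then have "\<psi>' c = 0 \<or> \<psi>' c = pi / 2" using start by (auto simp: \<psi>'_def algebra_simps)
  moreover have "\<psi>' d = \<psi>' c + pi / 2" using turn by (simp add: \<psi>'_def)
  ultimately show "\<sigma> * (d - c) \<le> pi / 2" "cot (\<sigma> * (d - c)) \<le> integral {c..d} r"
    "integral {c..d} r = cot (\<sigma> * (d - c)) \<Longrightarrow> \<sigma> * (d - c) = pi / 2"
    using quarter_turn_normalized[OF s' \<open>\<sigma> > 0\<close> \<open>c < d\<close> r] by auto
qed

section \<open>The lower bound\<close>

lemma cot_above_tangent:
  assumes t: "0 < t" "t \<le> pi / 2" and t0: "0 < t0" "t0 < pi / 2"
  shows "cot t0 - (t - t0) / (sin t0)\<^sup>2 \<le> cot t"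
proof -
  have D: "(cot has_real_derivative - inverse ((sin x)\<^sup>2)) (at x)" if "0 < x" "x < pi" for x :: real
    using DERIV_cot[of x] sin_gt_zero[OF that] by auto
  have sinle: "inverse ((sin y)\<^sup>2) \<le> inverse ((sin x)\<^sup>2)" if "0 < x" "x \<le> y" "y \<le> pi / 2" for x y :: real
  proof -
    have "sin x \<le> sin y" using that by (intro sin_monotone_2pi_le) auto
    moreover have "sin x > 0" using that pi_gt_zero by (intro sin_gt_zero) auto
    ultimately show ?thesis by (intro le_imp_inverse_le power_mono) auto
  qed
  consider "t < t0" | "t = t0" | "t0 < t" by linarith
  then show ?thesis
  proof cases
    case 1
    then obtain z where z: "t < z" "z < t0" "cot t0 - cot t = (t0 - t) * - inverse ((sin z)\<^sup>2)"
      using MVT2[of t t0 cot "\<lambda>x. - inverse ((sin x)\<^sup>2)"] D t t0 pi_gt_zero by force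
    have "(t0 - t) * inverse ((sin t0)\<^sup>2) \<le> (t0 - t) * inverse ((sin z)\<^sup>2)"
      using 1 z t t0 by (intro mult_left_mono sinle) auto
    then show ?thesis using z(3) by (simp add: divide_inverse algebra_simps)
  next
    case 3
    then obtain z where z: "t0 < z" "z < t" "cot t - cot t0 = (t - t0) * - inverse ((sin z)\<^sup>2)"
      using MVT2[of t0 t cot "\<lambda>x. - inverse ((sin x)\<^sup>2)"] D t t0 pi_gt_zero by force
    have "(t - t0) * inverse ((sin z)\<^sup>2) \<le> (t - t0) * inverse ((sin t0)\<^sup>2)"
      using 3 z t t0 by (intro mult_left_mono sinle) auto
    then show ?thesis using z(3) by (simp add: divide_inverse algebra_simps)
  qed simp
qed

text \<open>Convexity of the cotangent, together with \<open>cot t\<^sub>0 + t\<^sub>0 / sin\<^sup>2 t\<^sub>0 > 0\<close>, which shows that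
  more than \<open>N\<close> summands only increase the bound.\<close>

lemma cot_sum_lower_bound:
  fixes x :: "nat \<Rightarrow> real"
  assumes x: "\<And>i. i < m \<Longrightarrow> 0 < x i \<and> x i \<le> pi / 2" and sum: "(\<Sum>i<m. x i) = N * t0"
    and t0: "0 < t0" "t0 < pi / 2" and N: "N \<le> real m"
  shows "N * cot t0 \<le> (\<Sum>i<m. cot (x i))"
proof -
  have "cot t0 > 0" using t0 by (intro cot_gt_zero) auto
  moreover have "t0 / (sin t0)\<^sup>2 \<ge> 0" using t0 by simp
  ultimately have pos: "cot t0 + t0 / (sin t0)\<^sup>2 \<ge> 0" by linarith
  have "N * cot t0 = N * (cot t0 + t0 / (sin t0)\<^sup>2) - N * t0 / (sin t0)\<^sup>2"
    by (simp add: distrib_left)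
  also have "\<dots> \<le> real m * (cot t0 + t0 / (sin t0)\<^sup>2) - N * t0 / (sin t0)\<^sup>2"
    using mult_right_mono[OF N pos] by simp
  also have "\<dots> = (\<Sum>i<m. (cot t0 + t0 / (sin t0)\<^sup>2) - x i / (sin t0)\<^sup>2)"
    by (simp add: sum_subtractf sum_divide_distrib[symmetric] sum)
  also have "\<dots> \<le> (\<Sum>i<m. cot (x i))"
  proof (rule sum_mono)
    fix i assume "i \<in> {..<m}"
    then have "cot t0 - (x i - t0) / (sin t0)\<^sup>2 \<le> cot (x i)"
      using cot_above_tangent[of "x i" t0] x[of i] t0 by simp
    then show "cot t0 + t0 / (sin t0)\<^sup>2 - x i / (sin t0)\<^sup>2 \<le> cot (x i)" by (simp add: diff_divide_distrib)
  qed
  finally show ?thesis .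
qed

lemma abs_int_shift:
  fixes g :: "real \<Rightarrow> real"
  shows "(\<lambda>x. g (x + k)) absolutely_integrable_on {c..d} \<longleftrightarrow> g absolutely_integrable_on {c+k..d+k}"
  using integrable_on_shift_Icc_real[of g k c d] integrable_on_shift_Icc_real[of "\<lambda>x. norm (g x)" k c d]
  by (simp add: absolutely_integrable_on_def o_def add.commute)

text \<open>A quarter-turn partition of one period, started at a zero of the solution. The zero
  need not be at the origin, so the angle is continued to two periods.\<close>

lemma periodic_quarter_turns:
  assumes "T > 0" "\<sigma> > 0"
    and s: "angle_solution 0 T \<sigma> r \<psi>" and r: "r absolutely_integrable_on {0..T}"
    and per: "\<And>x. r (x + T) = r x" and nn: "AE t in lebesgue. t \<in> {0..T} \<longrightarrow> 0 \<le> r t"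
    and turn: "\<psi> T = \<psi> 0 + 2 * pi * real k" and "k \<ge> 1"
  obtains len where "\<And>i. i < 4 * k \<Longrightarrow> 0 < len i \<and> \<sigma> * len i \<le> pi / 2"
    "(\<Sum>i<4*k. len i) = T" "(\<Sum>i<4*k. cot (\<sigma> * len i)) \<le> integral {0..T} r"
    "integral {0..T} r = (\<Sum>i<4*k. cot (\<sigma> * len i)) \<Longrightarrow> (\<forall>i<4*k. \<sigma> * len i = pi / 2)"
proof -
  \<comment> \<open>nonnegative at every point, so that the sign carries over to the second period\<close>
  define r' where "r' = (\<lambda>x. max (r x) 0)"
  have r'0: "r' x \<ge> 0" for x by (simp add: r'_def)
  have per': "r' (x + T) = r' x" for x by (simp add: r'_def per)
  have ae: "AE t in lebesgue. t \<in> {0..T} \<longrightarrow> r t = r' t"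
    using nn by eventually_elim (auto simp: r'_def)
  have r'1: "r' absolutely_integrable_on {0..T}"
    unfolding r'_def using r by (intro absolutely_integrable_max_1) auto
  have "(\<lambda>x. r' (x + T)) absolutely_integrable_on {0..T}" using r'1 by (simp add: per')
  then have "r' absolutely_integrable_on {T..2*T}" unfolding abs_int_shift by simp
  with r'1 have "r' absolutely_integrable_on ({0..T} \<union> {T..2*T})" by (rule absolutely_integrable_Un)
  moreover have "{0..T} \<union> {T..2*T} = {0..2*T}" using \<open>T > 0\<close> by auto
  ultimately have r'2: "r' absolutely_integrable_on {0..2*T}" by simp
  have s': "angle_solution 0 T \<sigma> r' \<psi>" by (rule angle_solution_cong_AE[OF s ae])
  obtain \<Psi> where \<Psi>: "angle_solution 0 (2*T) \<sigma> r' \<Psi>" "\<Psi> 0 = \<psi> 0"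
    using angle_solution_exists[OF r'2, of \<sigma> "\<psi> 0"] \<open>T > 0\<close> by auto
  have \<Psi>1: "angle_solution 0 T \<sigma> r' \<Psi>"
    using primitive_on_subinterval[OF \<Psi>(1)[unfolded angle_solution_def], of 0 T] \<open>T > 0\<close>
    by (simp add: angle_solution_def)
  have \<Psi>T: "\<Psi> T = \<Psi> 0 + 2 * pi * real k"
    using angle_solution_unique[OF \<Psi>1 s' r'1, of T] \<Psi>(2) turn \<open>T > 0\<close> by simp
  have sh: "\<Psi> (x + T) = \<Psi> x + 2 * pi * real k" if "x \<in> {0..T}" for x
  proof -
    have "primitive_on (0 + T) (T + T) \<Psi> (\<lambda>t. \<sigma> + r' t * (sin (\<Psi> t))\<^sup>2)"
      using primitive_on_subinterval[OF \<Psi>(1)[unfolded angle_solution_def], of T "2*T"] \<open>T > 0\<close> by simp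
    from primitive_on_shift[OF this] have 1: "angle_solution 0 T \<sigma> r' (\<lambda>x. \<Psi> (x + T))"
      by (simp add: angle_solution_def per')
    have 2: "angle_solution 0 T \<sigma> r' (\<lambda>x. \<Psi> x + of_int (2 * int k) * pi)"
      by (rule angle_solution_add_pi[OF \<Psi>1])
    have "\<Psi> (x + T) = \<Psi> x + of_int (2 * int k) * pi"
      using angle_solution_unique[OF 1 2 r'1 _ that] \<Psi>T by simp
    then show ?thesis by simp
  qed
  have grow: "\<Psi> x + \<sigma> * (y - x) \<le> \<Psi> y" if "0 \<le> x" "x \<le> y" "y \<le> 2 * T" for x y
    by (rule angle_growth[OF \<Psi>(1) _ that]) (use r'0 in simp)
  have smono: "\<Psi> x < \<Psi> y" if "0 \<le> x" "x < y" "y \<le> 2 * T" for x y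
  proof -
    have "0 < \<sigma> * (y - x)" using that \<open>\<sigma> > 0\<close> by simp
    then show ?thesis using grow[of x y] that by linarith
  qed
  have cont: "continuous_on {0..2*T} \<Psi>" by (rule angle_solution_continuous[OF \<Psi>(1)])
  \<comment> \<open>the first multiple of \<open>\<pi>\<close> from the initial angle on\<close>
  define j where "j = \<lceil>\<psi> 0 / pi\<rceil>"
  have j: "\<psi> 0 \<le> of_int j * pi" "of_int j * pi \<le> \<psi> 0 + pi"
  proof -
    have "\<psi> 0 / pi \<le> of_int j" "of_int j \<le> \<psi> 0 / pi + 1" unfolding j_def by linarith+
    then have "\<psi> 0 \<le> of_int j * pi" "of_int j * pi \<le> (\<psi> 0 / pi + 1) * pi"
      by (simp_all only: pos_divide_le_eq pi_gt_zero mult_right_mono less_imp_le)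
    then show "\<psi> 0 \<le> of_int j * pi" "of_int j * pi \<le> \<psi> 0 + pi" by (simp_all add: distrib_right)
  qed
  have "pi * 1 \<le> pi * (2 * real k)" using \<open>k \<ge> 1\<close> by (intro mult_left_mono) auto
  then have "pi \<le> 2 * pi * real k" by (simp only: mult_ac mult_1_right mult_1_left)
  then have "of_int j * pi \<le> \<Psi> T" using j(2) \<Psi>T \<Psi>(2) by linarith
  then obtain x0 where x0: "0 \<le> x0" "x0 \<le> T" "\<Psi> x0 = of_int j * pi"
    using IVT'[of \<Psi> 0 "of_int j * pi" T] j(1) \<Psi>(2) \<open>T > 0\<close> continuous_on_subset[OF cont, of "{0..T}"] by auto
  have end_val: "\<Psi> (x0 + T) = of_int j * pi + real (4 * k) * (pi / 2)"
    using sh[of x0] x0 by simp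
  have "\<exists>y. x0 \<le> y \<and> y \<le> x0 + T \<and> \<Psi> y = of_int j * pi + real i * (pi / 2)" if "i \<le> 4 * k" for i
  proof -
    have "real i * (pi / 2) \<le> real (4 * k) * (pi / 2)" using that by (intro mult_right_mono) auto
    then show ?thesis
      using IVT'[of \<Psi> x0 "of_int j * pi + real i * (pi / 2)" "x0 + T"] end_val x0 \<open>T > 0\<close>
        continuous_on_subset[OF cont, of "{x0..x0+T}"] by auto
  qed
  then obtain y where y: "\<And>i. i \<le> 4 * k \<Longrightarrow> x0 \<le> y i \<and> y i \<le> x0 + T \<and> \<Psi> (y i) = of_int j * pi + real i * (pi / 2)"
    by metis
  have inj: "p = q" if "\<Psi> p = \<Psi> q" "0 \<le> p" "p \<le> 2*T" "0 \<le> q" "q \<le> 2*T" for p q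
    using smono[of p q] smono[of q p] that by (cases p q rule: linorder_cases) auto
  have y0: "y 0 = x0"
  proof (rule inj)
    show "\<Psi> (y 0) = \<Psi> x0" using y[of 0] x0 by simp
    show "0 \<le> y 0" "y 0 \<le> 2 * T" using y[of 0] x0 by linarith+
  qed (use x0 \<open>T > 0\<close> in linarith)+
  have yk: "y (4 * k) = x0 + T"
  proof (rule inj)
    show "\<Psi> (y (4 * k)) = \<Psi> (x0 + T)" using y[of "4 * k"] end_val by simp
    show "0 \<le> y (4 * k)" "y (4 * k) \<le> 2 * T" using y[of "4 * k"] x0 by linarith+
  qed (use x0 \<open>T > 0\<close> in linarith)+
  have ylt: "y i < y (Suc i)" if "i < 4 * k" for i
  proof (rule ccontr)
    assume "\<not> y i < y (Suc i)"
    then have "y (Suc i) = y i \<or> y (Suc i) < y i" by auto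
    then have "\<Psi> (y (Suc i)) \<le> \<Psi> (y i)"
      using smono[of "y (Suc i)" "y i"] y[of i] y[of "Suc i"] that x0 by auto
    then have "real (Suc i) * (pi / 2) \<le> real i * (pi / 2)" using y[of i] y[of "Suc i"] that by simp
    then show False using pi_gt_zero by (simp add: mult_le_cancel_right)
  qed
  define len where "len = (\<lambda>i. y (Suc i) - y i)"
  define R where "R = (\<lambda>t. 0 + integral {0..t} r')"
  have R: "primitive_on 0 (2*T) R r'" unfolding R_def by (rule primitive_on_integral[OF r'2])
  have quarter: "\<sigma> * len i \<le> pi / 2 \<and> cot (\<sigma> * len i) \<le> R (y (Suc i)) - R (y i) \<and>
     (R (y (Suc i)) - R (y i) = cot (\<sigma> * len i) \<longrightarrow> \<sigma> * len i = pi / 2)" if i: "i < 4 * k" for i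
  proof -
    have b: "0 \<le> y i" "y i \<le> y (Suc i)" "y (Suc i) \<le> 2 * T"
      using y[of i] y[of "Suc i"] ylt[OF i] i x0 by auto
    have a1: "angle_solution (y i) (y (Suc i)) \<sigma> r' \<Psi>"
      using primitive_on_subinterval[OF \<Psi>(1)[unfolded angle_solution_def] b] by (simp add: angle_solution_def)
    have a2: "r' absolutely_integrable_on {y i..y (Suc i)}" using abs_int_subinterval[OF r'2] b by simp
    have a3: "\<Psi> (y i) = of_int (2 * j + int i) * (pi / 2)" using y[of i] i by (simp add: algebra_simps)
    have a4: "\<Psi> (y (Suc i)) = \<Psi> (y i) + pi / 2" using y[of i] y[of "Suc i"] i by (simp add: algebra_simps)
    have a5: "AE t in lebesgue. t \<in> {y i..y (Suc i)} \<longrightarrow> 0 \<le> r' t" using r'0 by simp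
    show ?thesis
      using quarter_turn[OF a1 \<open>\<sigma> > 0\<close> ylt[OF i] a2 a5 a3 a4] primitive_on_diff[OF R b] by (simp add: len_def)
  qed
  have "(\<Sum>i<4*k. R (y (Suc i)) - R (y i)) = R (x0 + T) - R x0"
    using sum_lessThan_telescope[of "\<lambda>i. R (y i)" "4 * k"] y0 yk by simp
  also have "\<dots> = R T"
  proof -
    have "primitive_on (0 + T) (T + T) R r'" using primitive_on_subinterval[OF R, of T "2*T"] \<open>T > 0\<close> by simp
    from primitive_on_shift[OF this] have "primitive_on 0 T (\<lambda>x. R (x + T)) r'" by (simp add: per')
    from primitive_onD[OF this, of x0] have "R (x0 + T) = R T + integral {0..x0} r'" using x0 by simp
    then show ?thesis by (simp add: R_def)
  qed
  also have "\<dots> = integral {0..T} r"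
  proof -
    have "primitive_on 0 T R r" 
      using primitive_on_subinterval[OF R, of 0 T] \<open>T > 0\<close> ae
      by (intro primitive_on_spike[of 0 T R r' r]) (auto elim: eventually_mono)
    from primitive_onD[OF this, of T] show ?thesis using \<open>T > 0\<close> by (simp add: R_def)
  qed
  finally have total: "(\<Sum>i<4*k. R (y (Suc i)) - R (y i)) = integral {0..T} r" .
  show ?thesis
  proof (rule that[of len])
    show "0 < len i \<and> \<sigma> * len i \<le> pi / 2" if "i < 4 * k" for i
      using ylt[OF that] quarter[OF that] by (simp add: len_def)
    show "(\<Sum>i<4*k. len i) = T"
      using sum_lessThan_telescope[of y "4 * k"] y0 yk by (simp add: len_def)
    show "(\<Sum>i<4*k. cot (\<sigma> * len i)) \<le> integral {0..T} r"
      unfolding total[symmetric] by (intro sum_mono) (use quarter in auto)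
    show "\<forall>i<4*k. \<sigma> * len i = pi / 2" if eq: "integral {0..T} r = (\<Sum>i<4*k. cot (\<sigma> * len i))"
    proof (rule ccontr)
      assume "\<not> (\<forall>i<4*k. \<sigma> * len i = pi / 2)"
      then obtain i where i: "i < 4 * k" "\<sigma> * len i \<noteq> pi / 2" by blast
      have "(\<Sum>i<4*k. cot (\<sigma> * len i)) < (\<Sum>i<4*k. R (y (Suc i)) - R (y i))"
      proof (rule sum_strict_mono_ex1)
        show "\<exists>i\<in>{..<4*k}. cot (\<sigma> * len i) < R (y (Suc i)) - R (y i)"
          using quarter[OF i(1)] i by (intro bexI[of _ i]) auto
      qed (use quarter in auto)
      then show False using total eq by simp
    qed
  qed
qed

section \<open>Trial potentials\<close>

text \<open>The angle for the potential \<open>\<sigma>\<^sup>2 + \<sigma> r\<close>, where \<open>r\<close> has mass \<open>2 cot (\<sigma> (h/2 - \<epsilon>))\<close> near the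
  middle of each of \<open>K\<close> intervals of length \<open>h\<close>, gains at least \<open>\<pi>\<close> on each interval: the free
  motion leads to \<open>\<sigma> (h/2 - \<epsilon>)\<close>, the mass reflects this to \<open>\<pi> - \<sigma> (h/2 - \<epsilon>)\<close>, and the free
  motion completes the half turn.\<close>

lemma bump_half_turn:
  assumes s: "angle_solution c (c + h) \<sigma> r \<psi>" and r: "r absolutely_integrable_on {c..c+h}"
    "\<And>t. 0 \<le> r t" and "\<sigma> > 0" and \<epsilon>: "0 < \<epsilon>" "\<epsilon> < h / 2" and small: "\<sigma> * h < pi"
    and mass: "\<And>t. t \<in> {c + h/2 - \<epsilon>..c + h/2 + \<epsilon>} \<Longrightarrow> cot (\<sigma> * (h/2 - \<epsilon>)) / \<epsilon> \<le> r t"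
    and start: "\<psi> c \<ge> of_int j * pi"
  shows "\<psi> (c + h) \<ge> of_int (j + 1) * pi"
proof (rule ccontr)
  assume "\<not> \<psi> (c + h) \<ge> of_int (j + 1) * pi"
  then have neg: "\<psi> (c + h) + of_int (-j) * pi < pi" by (simp add: algebra_simps)
  define \<theta> where "\<theta> = (\<lambda>t. \<psi> t + of_int (-j) * pi)"
  define \<alpha> where "\<alpha> = \<sigma> * (h/2 - \<epsilon>)"
  define b e where "b = c + h/2 - \<epsilon>" and "e = c + h/2 + \<epsilon>"
  have be: "c \<le> b" "b \<le> e" "e \<le> c + h" using \<epsilon> by (auto simp: b_def e_def)
  have th: "angle_solution c (c + h) \<sigma> r \<theta>" unfolding \<theta>_def by (rule angle_solution_add_pi[OF s])
  have grow: "\<theta> x + \<sigma> * (y - x) \<le> \<theta> y" if "c \<le> x" "x \<le> y" "y \<le> c + h" for x y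
    by (rule angle_growth[OF th _ that]) (use r in simp)
  have "\<theta> c \<ge> 0" "\<theta> (c + h) < pi" using start neg by (auto simp: \<theta>_def)
  moreover have "\<sigma> * (b - c) = \<alpha>" "\<sigma> * (c + h - e) = \<alpha>" by (simp_all add: \<alpha>_def b_def e_def)
  ultimately have tb: "\<theta> b \<ge> \<alpha>" and te: "\<theta> e < pi - \<alpha>" using grow[of c b] grow[of e "c + h"] be by auto
  have \<alpha>: "\<alpha> > 0" "\<alpha> < pi"
  proof -
    show "\<alpha> > 0" using \<epsilon> \<open>\<sigma> > 0\<close> by (simp add: \<alpha>_def)
    have "\<alpha> < \<sigma> * h" unfolding \<alpha>_def using \<epsilon> \<open>\<sigma> > 0\<close> by (intro mult_strict_left_mono) auto
    then show "\<alpha> < pi" using small by linarith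
  qed
  have mono: "\<theta> x \<le> \<theta> y" if "c \<le> x" "x \<le> y" "y \<le> c + h" for x y
  proof -
    have "0 \<le> \<sigma> * (y - x)" using that \<open>\<sigma> > 0\<close> by simp
    then show ?thesis using grow[OF that] by linarith
  qed
  have p: "primitive_on b e \<theta> (\<lambda>t. \<sigma> + r t * (sin (\<theta> t))\<^sup>2)"
    using primitive_on_subinterval[OF th[unfolded angle_solution_def] be] .
  have rng: "\<theta> t \<in> {\<theta> b..\<theta> e}" if "t \<in> {b..e}" for t using mono[of b t] mono[of t e] that be by auto
  have C: "primitive_on b e (\<lambda>t. cot (\<theta> t)) (\<lambda>t. - inverse ((sin (\<theta> t))\<^sup>2) * (\<sigma> + r t * (sin (\<theta> t))\<^sup>2))"
    using primitive_on_cot[OF p, of "\<theta> b" "\<theta> e"] rng tb te \<alpha> by simp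
  have "primitive_on b e (\<lambda>t. (-1) * cot (\<theta> t) - (cot \<alpha> / \<epsilon>) * t)
     (\<lambda>t. (-1) * (- inverse ((sin (\<theta> t))\<^sup>2) * (\<sigma> + r t * (sin (\<theta> t))\<^sup>2)) - (cot \<alpha> / \<epsilon>) * 1)"
    by (intro primitive_on_diff_fun primitive_on_cmult primitive_on_ident C)
  then have "(-1) * cot (\<theta> b) - (cot \<alpha> / \<epsilon>) * b \<le> (-1) * cot (\<theta> e) - (cot \<alpha> / \<epsilon>) * e"
  proof (rule primitive_on_mono)
    have "0 \<le> (-1) * (- inverse ((sin (\<theta> t))\<^sup>2) * (\<sigma> + r t * (sin (\<theta> t))\<^sup>2)) - (cot \<alpha> / \<epsilon>) * 1" if t: "t \<in> {b..e}" for t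
    proof -
      have "sin (\<theta> t) > 0" using rng[OF t] tb te \<alpha> by (intro sin_gt_zero) auto
      then have "inverse ((sin (\<theta> t))\<^sup>2) * (\<sigma> + r t * (sin (\<theta> t))\<^sup>2) = \<sigma> * inverse ((sin (\<theta> t))\<^sup>2) + r t"
        by (simp add: distrib_left)
      moreover have "\<sigma> * inverse ((sin (\<theta> t))\<^sup>2) \<ge> 0" using \<open>\<sigma> > 0\<close> by simp
      moreover have "cot \<alpha> / \<epsilon> \<le> r t" using mass[of t] t by (simp add: \<alpha>_def b_def e_def)
      ultimately show ?thesis by simp
    qed
    then show "AE t in lebesgue. t \<in> {b..e} \<longrightarrow>
       0 \<le> (-1) * (- inverse ((sin (\<theta> t))\<^sup>2) * (\<sigma> + r t * (sin (\<theta> t))\<^sup>2)) - (cot \<alpha> / \<epsilon>) * 1" by simp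
  qed (use be in auto)
  moreover have "(cot \<alpha> / \<epsilon>) * e - (cot \<alpha> / \<epsilon>) * b = 2 * cot \<alpha>"
  proof -
    have "(cot \<alpha> / \<epsilon>) * e - (cot \<alpha> / \<epsilon>) * b = (cot \<alpha> / \<epsilon>) * (2 * \<epsilon>)"
      unfolding right_diff_distrib[symmetric] by (simp add: b_def e_def)
    then show ?thesis using \<epsilon> by simp
  qed
  moreover have "cot (\<theta> b) \<le> cot \<alpha>"
    using cot_strict_antimono[of \<alpha> "\<theta> b"] tb \<alpha> te rng[of b] be by (cases "\<theta> b = \<alpha>") auto
  moreover have "- cot \<alpha> < cot (\<theta> e)"
    using cot_strict_antimono[of "\<theta> e" "pi - \<alpha>"] cot_pi_minus[of \<alpha>] te \<alpha> tb rng[of e] be by auto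
  ultimately show False by linarith
qed

lemma bumps_rotation:
  assumes s: "angle_solution 0 (real K * h) \<sigma> r \<psi>" and r: "r absolutely_integrable_on {0..real K * h}"
    "\<And>t. 0 \<le> r t" and "\<sigma> > 0" and \<epsilon>: "0 < \<epsilon>" "\<epsilon> < h / 2" and small: "\<sigma> * h < pi"
    and mass: "\<And>i t. i < K \<Longrightarrow> t \<in> {real i * h + h/2 - \<epsilon>..real i * h + h/2 + \<epsilon>} \<Longrightarrow> cot (\<sigma> * (h/2 - \<epsilon>)) / \<epsilon> \<le> r t"
    and start: "\<psi> 0 = 0"
  shows "i \<le> K \<Longrightarrow> \<psi> (real i * h) \<ge> real i * pi"
proof (induction i)
  case 0
  then show ?case using start by simp
next
  case (Suc i)
  have h: "h > 0" using \<epsilon> by simp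
  have b: "0 \<le> real i * h" "real i * h \<le> real i * h + h" "real i * h + h \<le> real K * h"
  proof -
    have "real (Suc i) * h \<le> real K * h" using Suc.prems h by (intro mult_right_mono) auto
    then show "real i * h + h \<le> real K * h" by (simp add: distrib_right)
  qed (use h in auto)
  have a: "angle_solution (real i * h) (real i * h + h) \<sigma> r \<psi>"
    using primitive_on_subinterval[OF s[unfolded angle_solution_def] b] by (simp add: angle_solution_def)
  have ri: "r absolutely_integrable_on {real i * h..real i * h + h}" using abs_int_subinterval[OF r(1)] b by simp
  have "\<psi> (real i * h) \<ge> of_int (int i) * pi" using Suc by simp
  from bump_half_turn[OF a ri r(2) \<open>\<sigma> > 0\<close> \<epsilon> small _ this] mass[of i] Suc.prems
  have "\<psi> (real i * h + h) \<ge> of_int (int i + 1) * pi" by simp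
  then show ?case by (simp add: distrib_right add.commute)
qed

lemma trial_weight:
  assumes h: "h > 0" and \<epsilon>: "0 < \<epsilon>" "\<epsilon> < h / 2" and "C \<ge> 0" and "K \<ge> 1"
  defines "T \<equiv> real K * h"
  obtains r :: "real \<Rightarrow> real" where "\<And>x. r (x + T) = r x" "\<And>x. 0 \<le> r x"
    "r absolutely_integrable_on {0..T}" "integral {0..T} r = real K * (2 * \<epsilon> * C)"
    "\<And>i t. i < K \<Longrightarrow> t \<in> {real i * h + h/2 - \<epsilon>..real i * h + h/2 + \<epsilon>} \<Longrightarrow> C \<le> r t"
proof -
  define B where "B = (\<lambda>i::nat. {real i * h + h/2 - \<epsilon>..real i * h + h/2 + \<epsilon>})"
  define g where "g = (\<lambda>x. \<Sum>i<K. C * indicat_real (B i) x)"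
  \<comment> \<open>the periodic extension of \<open>g\<close> from \<open>[0, T)\<close>\<close>
  define r where "r = (\<lambda>x. g (x - T * of_int \<lfloor>x / T\<rfloor>))"
  have T: "T > 0" using h \<open>K \<ge> 1\<close> by (simp add: T_def)
  have per: "r (x + T) = r x" for x
  proof -
    have "(x + T) / T = x / T + 1" using T by (simp add: add_divide_distrib)
    then have "\<lfloor>(x + T) / T\<rfloor> = \<lfloor>x / T\<rfloor> + 1" by simp
    then show ?thesis by (simp add: r_def algebra_simps)
  qed
  have g0: "0 \<le> g x" for x unfolding g_def using \<open>C \<ge> 0\<close> by (intro sum_nonneg) auto
  have BT: "B i \<subseteq> {0<..<T}" if "i < K" for i
  proof -
    have "real (Suc i) * h \<le> T" unfolding T_def using that h by (intro mult_right_mono) auto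
    then have "real i * h + h \<le> T" by (simp add: distrib_right)
    moreover have "0 \<le> real i * h" using h by simp
    ultimately have "0 < x \<and> x < T" if "x \<in> B i" for x
      using \<epsilon> that unfolding B_def atLeastAtMost_iff by linarith
    then show ?thesis by auto
  qed
  have rg: "r x = g x" if x: "x \<in> {0..T}" for x
  proof (cases "x = T")
    case True
    have "g 0 = 0" "g T = 0" unfolding g_def using BT by (force intro!: sum.neutral simp: indicator_def)+
    then show ?thesis using True T by (simp add: r_def)
  next
    case False
    then have "\<lfloor>x / T\<rfloor> = 0" using x T by (simp add: floor_eq_iff)
    then show ?thesis by (simp add: r_def)
  qed
  have bi: "((\<lambda>x. C * indicat_real (B i) x) has_integral C * (2 * \<epsilon>)) {0..T}" if "i < K" for i
  proof -
    have "((\<lambda>x. C) has_integral C * (2 * \<epsilon>)) (B i)"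
      using has_integral_const_real[of C "real i * h + h/2 - \<epsilon>" "real i * h + h/2 + \<epsilon>"] \<epsilon> by (simp add: B_def mult.commute)
    then have "((\<lambda>x. if x \<in> B i then C else 0) has_integral C * (2 * \<epsilon>)) {0..T}"
      using BT[OF that] by (subst has_integral_restrict) auto
    moreover have "(\<lambda>x. if x \<in> B i then C else 0) = (\<lambda>x. C * indicat_real (B i) x)" by (auto simp: indicator_def)
    ultimately show ?thesis by simp
  qed
  have gi: "(g has_integral (\<Sum>i<K. C * (2 * \<epsilon>))) {0..T}"
    unfolding g_def by (rule has_integral_sum) (use bi in auto)
  then have ri: "(r has_integral (\<Sum>i<K. C * (2 * \<epsilon>))) {0..T}"
    by (rule has_integral_eq[rotated]) (use rg in auto)
  show ?thesis
  proof (rule that[of r])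
    show "r (x + T) = r x" for x by (rule per)
    show r0: "0 \<le> r x" for x by (simp add: r_def g0)
    show "r absolutely_integrable_on {0..T}"
      using ri r0 by (intro nonnegative_absolutely_integrable_1) (auto simp: integrable_on_def)
    show "integral {0..T} r = real K * (2 * \<epsilon> * C)" using integral_unique[OF ri] by simp
    fix i t assume i: "i < K" and t: "t \<in> {real i * h + h/2 - \<epsilon>..real i * h + h/2 + \<epsilon>}"
    have "t \<in> B i" using t by (simp add: B_def)
    have "C * indicat_real (B i) t \<le> g t"
      unfolding g_def by (rule member_le_sum) (use i \<open>C \<ge> 0\<close> in auto)
    then have "C \<le> g t" using \<open>t \<in> B i\<close> by simp
    also have "g t = r t" using BT[OF i] \<open>t \<in> B i\<close> by (intro rg[symmetric]) auto
    finally show "C \<le> r t" .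
  qed
qed

section \<open>Zeros of periodic solutions\<close>

lemma strict_enumeration_unique:
  fixes x y :: "nat \<Rightarrow> real"
  assumes x: "strict_mono_on {..M} x" and y: "strict_mono_on {..N} y" and eq: "x ` {..M} = y ` {..N}"
  shows "M = N" "\<And>i. i \<le> N \<Longrightarrow> x i = y i"
proof -
  have sorted: "sorted_wrt (<) (map f [0..<Suc K])" if "strict_mono_on {..K} f" for f :: "nat \<Rightarrow> real" and K
    using that by (auto simp: sorted_wrt_iff_nth_less strict_mono_on_def simp del: upt_Suc)
  have set: "set (map f [0..<Suc K]) = f ` {..K}" for f :: "nat \<Rightarrow> real" and K
    by (auto simp del: upt_Suc)
  have *: "map x [0..<Suc M] = map y [0..<Suc N]"
    by (rule strict_sorted_equal[OF sorted[OF y] sorted[OF x]]) (simp only: set eq)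
  show "M = N" using arg_cong[OF *, of length] by simp
  then show "x i = y i" if "i \<le> N" for i
    using arg_cong[OF *, of "\<lambda>l. l ! i"] that by (simp del: upt_Suc)
qed

lemma interlaced_zeros_unique:
  assumes x: "interlaced_zeros T u m x" and y: "interlaced_zeros T u l y"
  shows "m = l" "\<And>i. i \<le> 2 * l \<Longrightarrow> x i = y i"
proof -
  have img: "f ` {..2*k} = {t \<in> {0..T}. u t = 0} \<union> {t \<in> {0<..<T}. D_on T u t = 0}"
    if "interlaced_zeros T u k f" for f k
  proof -
    have "{..2*k} = {i. i \<le> 2 * k \<and> even i} \<union> {i. i \<le> 2 * k \<and> odd i}" by auto
    then have *: "f ` {..2*k} = f ` {i. i \<le> 2 * k \<and> even i} \<union> f ` {i. i \<le> 2 * k \<and> odd i}"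
      by (simp only: image_Un)
    show ?thesis unfolding * using that by (simp add: interlaced_zeros_def)
  qed
  have "strict_mono_on {..2*m} x" "strict_mono_on {..2*l} y" using x y by (auto simp: interlaced_zeros_def)
  note u = strict_enumeration_unique[OF this] 
  show "m = l" using u(1) img[OF x] img[OF y] by simp
  show "x i = y i" if "i \<le> 2 * l" for i using u(2)[OF _ that] img[OF x] img[OF y] by simp
qed

context angle_scale
begin

lemma rot_free: "rot (\<lambda>_. \<sigma>\<^sup>2) \<phi> = \<sigma> * T"
proof -
  have "primitive_on 0 T (\<lambda>t. \<phi> + \<sigma> * t) (\<lambda>t. 0 + \<sigma> * 1)"
    by (intro primitive_on_add primitive_on_const primitive_on_cmult primitive_on_ident)
  then have "pruefer_angle 0 T (\<lambda>_. \<sigma>\<^sup>2) (\<lambda>t. \<phi> + \<sigma> * t)"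
    unfolding pruefer_angle_def angle_solution_def using \<sigma>_pos
    by (rule_tac primitive_on_cong) (auto simp: power2_eq_square)
  from rot_eq[OF this] show ?thesis by simp
qed

lemma extremal_rot_free: "max_rot (\<lambda>_. \<sigma>\<^sup>2) = \<sigma> * T" "min_rot (\<lambda>_. \<sigma>\<^sup>2) = \<sigma> * T"
  by (simp_all add: max_rot_def min_rot_def rot_free)

lemma coeff_nonneg:
  assumes "AE t in lebesgue. t \<in> {c..d} \<longrightarrow> \<sigma>\<^sup>2 \<le> q t"
  shows "AE t in lebesgue. t \<in> {c..d} \<longrightarrow> 0 \<le> coeff q t"
  using assms
proof eventually_elim
  case (elim t)
  then show ?case using \<sigma>_pos by (auto simp: pos_le_divide_eq power2_eq_square)
qed

lemma coeff_integral:
  assumes q: "q absolutely_integrable_on {c..d}"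
  shows "integral {c..d} (coeff q) = integral {c..d} (\<lambda>t. q t - \<sigma>\<^sup>2) / \<sigma>"
proof -
  have "coeff q = (\<lambda>t. (q t - \<sigma>\<^sup>2) / \<sigma>)" using \<sigma>_pos by (auto simp: diff_divide_distrib power2_eq_square)
  then show ?thesis by simp
qed

text \<open>For a potential above \<open>\<sigma>\<^sup>2\<close> the angle is strictly increasing, and the zeros of the solution
  and of its derivative are the points where it crosses the multiples of \<open>\<pi>/2\<close>.\<close>

lemma periodic_solution_zeros:
  assumes p: "periodic_lin q u v" and q: "q absolutely_integrable_on {0..T}"
    and nz: "nontrivial_on T u" and u0: "u 0 = 0"
    and ge: "AE t in lebesgue. t \<in> {0..T} \<longrightarrow> \<sigma>\<^sup>2 \<le> q t"
  obtains \<theta> j k y where "pruefer_angle 0 T q \<theta>" "\<theta> 0 = of_int j * pi" "\<theta> T = \<theta> 0 + 2 * pi * real k"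
    "\<And>i. i \<le> 4 * k \<Longrightarrow> \<theta> (y i) = \<theta> 0 + real i * (pi / 2)" "interlaced_zeros T u (2 * k) y"
proof -
  have s: "lin_solution 0 T q u v" using p by (simp add: periodic_lin_def)
  have T0: "0 \<le> T" using T_pos by simp
  obtain r \<phi> where r: "r > 0" "u 0 = r * sin \<phi>" "v 0 = \<sigma> * (r * cos \<phi>)"
    using polar_coordinates nontrivial_initial[OF s q nz] by metis
  obtain \<theta> \<rho> where \<theta>: "pruefer_angle 0 T q \<theta>" "\<theta> 0 = \<phi>" "\<And>x. \<rho> x > 0"
    "\<And>x. x \<in> {0..T} \<Longrightarrow> u x = \<rho> x * sin (\<theta> x)" "\<And>x. x \<in> {0..T} \<Longrightarrow> v x = \<sigma> * (\<rho> x * cos (\<theta> x))"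
    using solution_to_angle[OF s q T0 r] by metis
  have "sin \<phi> = 0" using r u0 by simp
  then obtain j :: int where j: "\<theta> 0 = of_int j * pi" using sin_zero_iff_int2 \<theta>(2) by metis
  have th: "angle_solution 0 T \<sigma> (coeff q) \<theta>" using \<theta>(1) by (simp add: pruefer_angle_def)
  have grow: "\<theta> x + \<sigma> * (y - x) \<le> \<theta> y" if "0 \<le> x" "x \<le> y" "y \<le> T" for x y
    by (rule angle_growth[OF th coeff_nonneg[OF ge] that])
  have smono: "\<theta> x < \<theta> y" if "0 \<le> x" "x < y" "y \<le> T" for x y
  proof -
    have "0 < \<sigma> * (y - x)" using that \<sigma>_pos by simp
    then show ?thesis using grow[of x y] that by linarith
  qed
  have inj: "x = y" if "\<theta> x = \<theta> y" "0 \<le> x" "x \<le> T" "0 \<le> y" "y \<le> T" for x y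
    using smono[of x y] smono[of y x] that by (cases x y rule: linorder_cases) auto
  obtain k0 :: int where k0: "rot q \<phi> = 2 * pi * of_int k0" using rot_of_periodic[OF p q r] .
  have \<theta>T: "\<theta> T = \<theta> 0 + 2 * pi * of_int k0" using rot_eq[OF \<theta>(1) q] k0 \<theta>(2) by simp
  have "0 < 2 * pi * of_int k0" using smono[of 0 T] T_pos \<theta>T by simp
  then have "k0 > 0" by (simp add: zero_less_mult_iff)
  then obtain k :: nat where k: "k0 = int k" "k > 0" by (metis zero_less_imp_eq_int)
  have \<theta>Tk: "\<theta> T = \<theta> 0 + real (4 * k) * (pi / 2)" using \<theta>T k by simp
  have cont: "continuous_on {0..T} \<theta>" by (rule angle_solution_continuous[OF th])
  have "\<exists>y. 0 \<le> y \<and> y \<le> T \<and> \<theta> y = \<theta> 0 + real i * (pi / 2)" if "i \<le> 4 * k" for i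
  proof -
    have "real i * (pi / 2) \<le> real (4 * k) * (pi / 2)" using that by (intro mult_right_mono) auto
    then show ?thesis using IVT'[of \<theta> 0 "\<theta> 0 + real i * (pi / 2)" T] \<theta>Tk T0 cont by auto
  qed
  then obtain y where y: "\<And>i. i \<le> 4 * k \<Longrightarrow> 0 \<le> y i \<and> y i \<le> T \<and> \<theta> (y i) = \<theta> 0 + real i * (pi / 2)"
    by metis
  have at: "t = y i" if "t \<in> {0..T}" "\<theta> t = \<theta> 0 + real i * (pi / 2)" "i \<le> 4 * k" for t i
    using inj[of t "y i"] y[of i] that by auto
  have y0: "y 0 = 0" using at[of 0 0] T0 by simp
  have yT: "y (4 * k) = T" using at[of T "4 * k"] T0 \<theta>Tk by simp
  have ylt: "y i < y l" if "i < l" "l \<le> 4 * k" for i l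
  proof (rule ccontr)
    assume "\<not> y i < y l"
    then have "\<theta> (y l) \<le> \<theta> (y i)"
      using smono[of "y l" "y i"] y[of i] y[of l] that by (cases "y l = y i") auto
    then have "real l * (pi / 2) \<le> real i * (pi / 2)" using y[of i] y[of l] that by simp
    then have "real l \<le> real i" using pi_gt_zero by (simp add: mult_le_cancel_right)
    then show False using that by simp
  qed
  have range: "\<theta> 0 \<le> \<theta> t" "\<theta> t \<le> \<theta> 0 + 2 * pi * real k" if "t \<in> {0..T}" for t
    using smono[of 0 t] smono[of t T] that \<theta>T k by (cases "t = 0"; cases "t = T"; force)+
  have crossing: "\<exists>i\<le>4*k. t = y i" if "t \<in> {0..T}" "\<theta> t = of_int l * (pi / 2)" for t l
  proof -
    have "of_int (2 * j) * (pi / 2) \<le> of_int l * (pi / 2)" "of_int l * (pi / 2) \<le> of_int (2 * j + 4 * int k) * (pi / 2)"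
    proof -
      have "of_int (2 * j) * (pi / 2) = \<theta> 0" "of_int (2 * j + 4 * int k) * (pi / 2) = \<theta> 0 + 2 * pi * real k"
        by (simp_all add: j distrib_right)
      then show "of_int (2 * j) * (pi / 2) \<le> of_int l * (pi / 2)" "of_int l * (pi / 2) \<le> of_int (2 * j + 4 * int k) * (pi / 2)"
        using range[OF that(1)] unfolding that(2) by simp_all
    qed
    then have "2 * j \<le> l" "l \<le> 2 * j + 4 * int k"
      using pi_gt_zero by (simp_all only: mult_le_cancel_right_pos half_gt_zero_iff of_int_le_iff)
    then have i: "nat (l - 2 * j) \<le> 4 * k" "of_int l = of_int (2 * j) + real (nat (l - 2 * j))" by auto
    have "\<theta> t = \<theta> 0 + real (nat (l - 2 * j)) * (pi / 2)"
      unfolding that(2) j by (subst i(2)) (simp add: distrib_right)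
    then have "t = y (nat (l - 2 * j))" by (rule at[OF that(1) _ i(1)])
    then show ?thesis using i(1) by blast
  qed
  have Dv: "D_on T u x = v x" if "x \<in> {0..T}" for x by (rule lin_solution_is_solution(2)[OF T_pos q s that])
  have u_zero: "u t = 0 \<longleftrightarrow> sin (\<theta> t) = 0" and v_zero: "D_on T u t = 0 \<longleftrightarrow> cos (\<theta> t) = 0" if "t \<in> {0..T}" for t
    using \<theta>(3)[of t] \<theta>(4,5)[OF that] Dv[OF that] \<sigma>_pos by auto
  have \<theta>y: "\<theta> (y i) = of_int (2 * j + int i) * (pi / 2)" if "i \<le> 4 * k" for i
    using y[OF that] j by (simp add: distrib_right)
  have yin: "y i \<in> {0..T}" if "i \<le> 4 * k" for i using y[OF that] by simp
  have even_zero: "sin (of_int l * (pi / 2)) = 0" if "even l" for l :: int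
    using that by (auto elim!: evenE simp: sin_zero_iff_int2)
  have odd_zero: "cos (of_int l * (pi / 2)) = 0" if "odd l" for l :: int
    using that by (auto elim!: oddE simp: cos_zero_iff_int2 distrib_right)
  have "interlaced_zeros T u (2 * k) y"
    unfolding interlaced_zeros_def
  proof (intro conjI)
    show "strict_mono_on {..2 * (2 * k)} y" using ylt by (auto simp: strict_mono_on_def)
    show "y 0 = 0" by (rule y0)
    show "y (2 * (2 * k)) = T" using yT by simp
    show "{t \<in> {0..T}. u t = 0} = y ` {i. i \<le> 2 * (2 * k) \<and> even i}"
    proof (intro equalityI subsetI)
      fix t assume "t \<in> {t \<in> {0..T}. u t = 0}"
      then have t: "t \<in> {0..T}" "sin (\<theta> t) = 0" using u_zero by auto
      then obtain l :: int where "\<theta> t = of_int l * pi" using sin_zero_iff_int2 by metis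
      then have "\<theta> t = of_int (2 * l) * (pi / 2)" by simp
      from crossing[OF t(1) this] obtain i where i: "i \<le> 4 * k" "t = y i" by blast
      moreover have "even i"
      proof (rule ccontr)
        assume "odd i"
        then have "cos (\<theta> t) = 0" unfolding i(2) \<theta>y[OF i(1)] by (intro odd_zero) simp
        then show False using t(2) sin_zero_norm_cos_one[of "\<theta> t"] by force
      qed
      ultimately show "t \<in> y ` {i. i \<le> 2 * (2 * k) \<and> even i}" by auto
    next
      fix t assume "t \<in> y ` {i. i \<le> 2 * (2 * k) \<and> even i}"
      then obtain i where i: "i \<le> 4 * k" "even i" "t = y i" by auto
      then have "sin (\<theta> t) = 0" unfolding i(3) \<theta>y[OF i(1)] by (intro even_zero) auto
      then show "t \<in> {t \<in> {0..T}. u t = 0}" using u_zero yin[OF i(1)] i(3) by auto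
    qed
    show "{t \<in> {0<..<T}. D_on T u t = 0} = y ` {i. i \<le> 2 * (2 * k) \<and> odd i}"
    proof (intro equalityI subsetI)
      fix t assume "t \<in> {t \<in> {0<..<T}. D_on T u t = 0}"
      then have t: "t \<in> {0..T}" "cos (\<theta> t) = 0" using v_zero by auto
      then obtain l :: int where "\<theta> t = of_int l * pi + pi / 2" using cos_zero_iff_int2 by metis
      then have "\<theta> t = of_int (2 * l + 1) * (pi / 2)" by (simp add: distrib_right)
      from crossing[OF t(1) this] obtain i where i: "i \<le> 4 * k" "t = y i" by blast
      moreover have "odd i"
      proof -
        have "even i \<Longrightarrow> sin (\<theta> t) = 0" unfolding i(2) \<theta>y[OF i(1)] by (intro even_zero) simp
        then show ?thesis using t(2) sin_zero_norm_cos_one[of "\<theta> t"] by fastforce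
      qed
      ultimately show "t \<in> y ` {i. i \<le> 2 * (2 * k) \<and> odd i}" by auto
    next
      fix t assume "t \<in> y ` {i. i \<le> 2 * (2 * k) \<and> odd i}"
      then obtain i where i: "i \<le> 4 * k" "odd i" "t = y i" by auto
      then have "cos (\<theta> t) = 0" unfolding i(3) \<theta>y[OF i(1)] by (intro odd_zero) auto
      moreover have "0 < i" "i < 4 * k" using i by (auto simp: odd_pos le_less)
      then have "0 < t" "t < T" using ylt[of 0 i] ylt[of i "4 * k"] y0 yT i(3) by auto
      ultimately show "t \<in> {t \<in> {0<..<T}. D_on T u t = 0}" using v_zero[of t] by auto
    qed
  qed
  moreover have "\<theta> T = \<theta> 0 + 2 * pi * real k" using \<theta>T k by simp
  ultimately show ?thesis using that[OF \<theta>(1) j, of k y] y by blast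
qed

lemma rot_above_free:
  assumes q: "q absolutely_integrable_on {0..T}"
    and ge: "AE t in lebesgue. t \<in> {0..T} \<longrightarrow> \<sigma>\<^sup>2 \<le> q t"
    and ne: "\<not> (AE t in lebesgue. t \<in> {0..T} \<longrightarrow> \<sigma>\<^sup>2 = q t)"
  shows "\<sigma> * T < rot q \<phi>"
  using rot_strict_mono[OF _ q ge ne, of \<phi>] rot_free by simp

end

section \<open>Integrability and strict inequalities\<close>

text \<open>The set where \<open>m < a\<close> is measurable, so it has positive measure unless it is a null set.\<close>

lemma strictly_below_const_iff:
  assumes a: "a absolutely_integrable_on {0..T}"
  shows "strictly_below T (\<lambda>_. m) a \<longleftrightarrow>
    (AE t in lebesgue. t \<in> {0..T} \<longrightarrow> m \<le> a t) \<and> \<not> (AE t in lebesgue. t \<in> {0..T} \<longrightarrow> m = a t)"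
proof -
  let ?S = "{x \<in> {0..T}. m < a x}"
  have "a \<in> borel_measurable (lebesgue_on {0..T})"
    by (rule absolutely_integrable_imp_borel_measurable[OF a]) simp
  then have "{x \<in> space (lebesgue_on {0..T}). m < a x} \<in> sets (lebesgue_on {0..T})" by measurable
  then have S: "?S \<in> sets lebesgue" by (simp add: sets_restrict_space_iff)
  have "emeasure lebesgue ?S > 0 \<longleftrightarrow> ?S \<notin> null_sets lebesgue"
    using S by (auto simp: null_sets_def zero_less_iff_neq_zero)
  also have "\<dots> \<longleftrightarrow> \<not> (AE t in lebesgue. t \<notin> ?S)"
    using AE_iff_null_sets[OF S] by simp
  finally have *: "emeasure lebesgue ?S > 0 \<longleftrightarrow> \<not> (AE t in lebesgue. t \<notin> ?S)" .
  have "(AE t in lebesgue. t \<notin> ?S) \<longleftrightarrow> (AE t in lebesgue. t \<in> {0..T} \<longrightarrow> m = a t)"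
    if ge: "AE t in lebesgue. t \<in> {0..T} \<longrightarrow> m \<le> a t"
  proof
    assume "AE t in lebesgue. t \<notin> ?S"
    with ge show "AE t in lebesgue. t \<in> {0..T} \<longrightarrow> m = a t" by eventually_elim auto
  next
    assume "AE t in lebesgue. t \<in> {0..T} \<longrightarrow> m = a t"
    then show "AE t in lebesgue. t \<notin> ?S" by eventually_elim auto
  qed
  then show ?thesis unfolding strictly_below_def * by auto
qed

lemma L1_norm_nonneg_eq:
  assumes f: "f absolutely_integrable_on {c..d}" and nn: "AE t in lebesgue. t \<in> {c..d} \<longrightarrow> 0 \<le> f t"
  shows "L1_norm {c<..<d} f = integral {c..d} f"
proof -
  obtain N where N: "N \<in> null_sets lebesgue" "{t. \<not> (t \<in> {c..d} \<longrightarrow> 0 \<le> f t)} \<subseteq> N"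
    using nn unfolding eventually_ae_filter by auto
  have "(\<lambda>x. \<bar>f x\<bar>) absolutely_integrable_on {c..d}" using f by (rule set_integrable_abs)
  then have "(\<lambda>x. \<bar>f x\<bar>) absolutely_integrable_on {c<..<d}"
    by (rule set_integrable_subset) auto
  then have "L1_norm {c<..<d} f = integral {c<..<d} (\<lambda>x. \<bar>f x\<bar>)"
    unfolding L1_norm_def by (rule set_lebesgue_integral_eq_integral(2))
  also have "\<dots> = integral {c..d} (\<lambda>x. \<bar>f x\<bar>)" by (rule integral_open_interval_real[symmetric])
  also have "\<dots> = integral {c..d} f"
  proof (rule integral_spike)
    show "negligible N" using N(1) by (simp add: negligible_iff_null_sets)
    show "f x = \<bar>f x\<bar>" if "x \<in> {c..d} - N" for x using that N(2) by force
  qed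
  finally show ?thesis .
qed

section \<open>The resonance at \<open>\<lambda>\<^sub>2\<^sub>n\<^sub>-\<^sub>1\<close>\<close>

text \<open>With this scale \<open>\<lambda>\<^sub>2\<^sub>n\<^sub>-\<^sub>1(0) = \<sigma>\<^sup>2\<close>, and the potential \<open>\<sigma>\<^sup>2\<close> turns every angle by exactly
  \<open>2 \<pi> n\<close>.\<close>

locale resonance = angle_scale T \<sigma> for T \<sigma> +
  fixes n :: nat
  assumes n_pos: "n \<ge> 1" and \<sigma>_def: "\<sigma> = 2 * real n * pi / T"
begin

text \<open>The phase of one of \<open>4 (n + 1)\<close> equal parts of the period.\<close>

abbreviation (input) t0 :: real where "t0 \<equiv> real n * pi / (2 * (real n + 1))"
abbreviation (input) bound :: real where
  "bound \<equiv> 8 * pi * real n * (real n + 1) / T * cot (real n * pi / (2 * (real n + 1)))"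

lemma \<sigma>T: "\<sigma> * T = 2 * pi * real n"
  using T_pos by (simp add: \<sigma>_def)

lemma t0: "0 < t0" "t0 < pi / 2" "4 * (real n + 1) * t0 = \<sigma> * T"
proof -
  have n: "real n > 0" using n_pos by simp
  show "0 < t0" using n by simp
  have t0_eq: "t0 = pi / 2 * (real n / (real n + 1))" by simp
  have "pi / 2 * (real n / (real n + 1)) < pi / 2 * 1" using n by (intro mult_strict_left_mono) auto
  then show "t0 < pi / 2" unfolding t0_eq by simp
  have alg: "4 * N * (x / (2 * N)) = 2 * x" if "N > 0" for N x :: real using that by simp
  show "4 * (real n + 1) * t0 = \<sigma> * T" unfolding \<sigma>T using alg[of "real n + 1" "real n * pi"] by simp
qed

lemma bound_eq: "bound = \<sigma> * (4 * (real n + 1) * cot t0)"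
  by (simp add: \<sigma>_def)

lemma eigenvalue0_eq: "eigenvalue0 T (2 * n - 1) = \<sigma>\<^sup>2"
proof -
  have z: "(\<lambda>_::real. 0::real) absolutely_integrable_on {0..T}" by simp
  have 1: "max_rot (\<lambda>t. eigenvalue T (\<lambda>_. 0) (2 * n - 1) + 0) = 2 * pi * real n"
    using eigenvalue_characterization(2)[OF z n_pos] .
  have 2: "max_rot (\<lambda>t. \<sigma>\<^sup>2 + 0) = 2 * pi * real n" using extremal_rot_free \<sigma>T by simp
  show ?thesis
    using shift_strict_mono(1)[OF z, of "eigenvalue T (\<lambda>_. 0) (2 * n - 1)" "\<sigma>\<^sup>2"]
      shift_strict_mono(1)[OF z, of "\<sigma>\<^sup>2" "eigenvalue T (\<lambda>_. 0) (2 * n - 1)"] 1 2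
    by (cases "eigenvalue T (\<lambda>_. 0) (2 * n - 1)" "\<sigma>\<^sup>2" rule: linorder_cases) auto
qed

definition above :: "(real \<Rightarrow> real) \<Rightarrow> bool" where
  "above a \<longleftrightarrow> a \<in> L_per T \<and> strictly_below T (\<lambda>_. \<sigma>\<^sup>2) a"

lemma aboveD:
  assumes "above a"
  shows "a absolutely_integrable_on {0..T}" "a (x + T) = a x"
    "AE t in lebesgue. t \<in> {0..T} \<longrightarrow> \<sigma>\<^sup>2 \<le> a t" "\<not> (AE t in lebesgue. t \<in> {0..T} \<longrightarrow> \<sigma>\<^sup>2 = a t)"
  using assms strictly_below_const_iff[of T a "\<sigma>\<^sup>2"] by (auto simp: above_def L_per_def)

lemma Lambda_set_iff:
  "a \<in> Lambda_set T n \<longleftrightarrow> above a \<and> (\<exists>u v. periodic_lin a u v \<and> nontrivial_on T u)"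
proof -
  have "is_periodic_solution T a u \<longleftrightarrow> (\<exists>v. periodic_lin a u v)" if "above a" for u
    by (rule is_periodic_solution_iff[OF aboveD(1)[OF that]])
  then show ?thesis unfolding Lambda_set_def eigenvalue0_eq above_def by blast
qed

lemma excess_abs_int:
  fixes a :: "real \<Rightarrow> real"
  assumes "a absolutely_integrable_on {c..d}"
  shows "(\<lambda>t. a t - \<sigma>\<^sup>2) absolutely_integrable_on {c..d}"
  using assms by (intro set_integral_diff(1)) auto

lemma excess_norm:
  assumes a: "above a" and cd: "0 \<le> c" "d \<le> T"
  shows "L1_norm {c<..<d} (\<lambda>t. a t - \<sigma>\<^sup>2) = integral {c..d} (\<lambda>t. a t - \<sigma>\<^sup>2)"
proof (rule L1_norm_nonneg_eq)
  show "(\<lambda>t. a t - \<sigma>\<^sup>2) absolutely_integrable_on {c..d}"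
    by (rule excess_abs_int[OF abs_int_subinterval[OF aboveD(1)[OF a] cd]])
  show "AE t in lebesgue. t \<in> {c..d} \<longrightarrow> 0 \<le> a t - \<sigma>\<^sup>2"
    using aboveD(3)[OF a] by eventually_elim (use cd in auto)
qed

text \<open>A rotation above \<open>2 \<pi> n\<close> by a whole number of turns is at least \<open>2 \<pi> (n + 1)\<close>.\<close>

lemma angle_turns:
  assumes a: "above a" and \<theta>: "pruefer_angle 0 T a \<theta>" and k: "\<theta> T = \<theta> 0 + 2 * pi * of_int k"
  shows "k \<ge> int n + 1"
proof -
  have "2 * pi * real n < 2 * pi * of_int k"
    using rot_above_free[OF aboveD(1,3,4)[OF a], of "\<theta> 0"] rot_eq[OF \<theta> aboveD(1)[OF a]] k \<sigma>T by simp
  then have "of_int (int n) < (of_int k :: real)" by (simp add: mult_less_cancel_left_pos)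
  then show ?thesis by (simp only: of_int_less_iff)
qed

lemma zero_spacing:
  assumes a: "above a" and p: "periodic_lin a u v" and nz: "nontrivial_on T u" and u0: "u 0 = 0"
  obtains l y where "interlaced_zeros T u l y" "even l" "l \<ge> 2 * (n + 1)"
    "\<And>i. i < 2 * l \<Longrightarrow> y (i + 1) - y i \<le> T / (4 * real n)"
    "\<exists>i<2 * l. y (i + 1) - y i < T / (4 * real n)"
    "\<And>i. i < 2 * l \<Longrightarrow> \<sigma> * cot (\<sigma> * (y (i + 1) - y i)) \<le> L1_norm {y i<..<y (i + 1)} (\<lambda>t. a t - \<sigma>\<^sup>2)"
proof -
  note q = aboveD(1)[OF a]
  obtain \<theta> j k y where \<theta>: "pruefer_angle 0 T a \<theta>" "\<theta> 0 = of_int j * pi" "\<theta> T = \<theta> 0 + 2 * pi * real k"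
    "\<And>i. i \<le> 4 * k \<Longrightarrow> \<theta> (y i) = \<theta> 0 + real i * (pi / 2)" and z: "interlaced_zeros T u (2 * k) y"
    using periodic_solution_zeros[OF p q nz u0 aboveD(3)[OF a]] by metis
  have "int k \<ge> int n + 1" using angle_turns[OF a \<theta>(1), of "int k"] \<theta>(3) by simp
  then have kn: "k \<ge> n + 1" by simp
  have th: "angle_solution 0 T \<sigma> (coeff a) \<theta>" using \<theta>(1) by (simp add: pruefer_angle_def)
  have sm: "strict_mono_on {..4*k} y" and y0: "y 0 = 0" and yT: "y (4 * k) = T"
    using z by (auto simp: interlaced_zeros_def)
  have ylt: "y i < y l" if "i < l" "l \<le> 4 * k" for i l using strict_mono_onD[OF sm, of i l] that by simp
  have in_T: "0 \<le> y i \<and> y i \<le> T" if "i \<le> 4 * k" for i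
    using ylt[of 0 i] ylt[of i "4 * k"] y0 yT that by (cases "i = 0"; cases "i = 4 * k") auto
  have quarter: "\<sigma> * (y (i + 1) - y i) \<le> pi / 2"
    "cot (\<sigma> * (y (i + 1) - y i)) \<le> integral {y i..y (i + 1)} (coeff a)" if i: "i < 4 * k" for i
  proof -
    have lt: "y i < y (i + 1)" using ylt[of i "i + 1"] i by simp
    have b: "0 \<le> y i" "y i \<le> y (i + 1)" "y (i + 1) \<le> T" using in_T[of i] in_T[of "i + 1"] lt i by auto
    have a1: "angle_solution (y i) (y (i + 1)) \<sigma> (coeff a) \<theta>"
      using primitive_on_subinterval[OF th[unfolded angle_solution_def] b] by (simp add: angle_solution_def)
    have a2: "coeff a absolutely_integrable_on {y i..y (i + 1)}"
      using abs_int_subinterval[OF coeff_abs_int[OF q]] b by simp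
    have a3: "AE t in lebesgue. t \<in> {y i..y (i + 1)} \<longrightarrow> 0 \<le> coeff a t"
      using coeff_nonneg[OF aboveD(3)[OF a]] by eventually_elim (use b in auto)
    have a4: "\<theta> (y i) = of_int (2 * j + int i) * (pi / 2)" using \<theta>(4)[of i] \<theta>(2) i by (simp add: distrib_right)
    have a5: "\<theta> (y (i + 1)) = \<theta> (y i) + pi / 2" using \<theta>(4)[of i] \<theta>(4)[of "i + 1"] i by (simp add: distrib_right)
    show "\<sigma> * (y (i + 1) - y i) \<le> pi / 2"
      "cot (\<sigma> * (y (i + 1) - y i)) \<le> integral {y i..y (i + 1)} (coeff a)"
      using quarter_turn(1,2)[OF a1 \<sigma>_pos lt a2 a3 a4 a5] by auto
  qed
  have le_iff: "\<sigma> * d \<le> pi / 2 \<longleftrightarrow> d \<le> T / (4 * real n)" for d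
  proof -
    have "\<sigma> * (T / (4 * real n)) = pi / 2" using T_pos n_pos by (simp add: \<sigma>_def)
    then show ?thesis using mult_le_cancel_left_pos[OF \<sigma>_pos, of d "T / (4 * real n)"] by argo
  qed
  have le: "y (i + 1) - y i \<le> T / (4 * real n)" if "i < 4 * k" for i
    using quarter(1)[OF that] le_iff by blast
  show ?thesis
  proof (rule that[OF z])
    show "even (2 * k)" "2 * k \<ge> 2 * (n + 1)" using kn by simp_all
    show "y (i + 1) - y i \<le> T / (4 * real n)" if "i < 2 * (2 * k)" for i using le[of i] that by simp
    show "\<exists>i<2 * (2 * k). y (i + 1) - y i < T / (4 * real n)"
    proof (rule ccontr)
      assume "\<not> ?thesis"
      then have eq: "y (i + 1) - y i = T / (4 * real n)" if "i < 4 * k" for i using le[OF that] that by force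
      have "T = (\<Sum>i<4*k. y (Suc i) - y i)" using sum_lessThan_telescope[of y "4 * k"] y0 yT by simp
      also have "\<dots> = real (4 * k) * (T / (4 * real n))" using eq by simp
      finally have "real n = real k" using T_pos n_pos by (simp add: field_simps)
      then show False using kn by simp
    qed
    show "\<sigma> * cot (\<sigma> * (y (i + 1) - y i)) \<le> L1_norm {y i<..<y (i + 1)} (\<lambda>t. a t - \<sigma>\<^sup>2)" if "i < 2 * (2 * k)" for i
    proof -
      have i: "i < 4 * k" using that by simp
      have b: "0 \<le> y i" "y (i + 1) \<le> T" using in_T[of i] in_T[of "i + 1"] i by auto
      have "\<sigma> * cot (\<sigma> * (y (i + 1) - y i)) \<le> \<sigma> * (integral {y i..y (i + 1)} (\<lambda>t. a t - \<sigma>\<^sup>2) / \<sigma>)"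
        using quarter(2)[OF i] coeff_integral[OF abs_int_subinterval[OF q b]] \<sigma>_pos by (intro mult_left_mono) auto
      also have "\<dots> = L1_norm {y i<..<y (i + 1)} (\<lambda>t. a t - \<sigma>\<^sup>2)"
        using excess_norm[OF a b] \<sigma>_pos by simp
      finally show ?thesis .
    qed
  qed
qed

text \<open>The constant potential \<open>\<kappa>\<^sup>2\<close> with \<open>\<kappa> = m \<pi> / T\<close> and \<open>u = sin (\<kappa> t)\<close>. Its zeros are located in
  the scale \<open>\<kappa>\<close>, where the angle is linear.\<close>

lemma constant_potential_example:
  assumes "even m" "m \<ge> 2 * (n + 1)"
  shows "\<exists>a\<in>Lambda_set T n. \<exists>u x. is_periodic_solution T a u \<and> nontrivial_on T u \<and> u 0 = 0 \<and> u T = 0 \<and>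
      interlaced_zeros T u m x"
proof -
  define \<kappa> where "\<kappa> = real m * pi / T"
  have "m > 0" using assms by simp
  then have \<kappa>: "\<kappa> > 0" using T_pos by (simp add: \<kappa>_def)
  interpret K: angle_scale T \<kappa> by unfold_locales (use T_pos \<kappa> in auto)
  define a :: "real \<Rightarrow> real" where "a = (\<lambda>_. \<kappa>\<^sup>2)"
  have ai: "a absolutely_integrable_on {0..T}" by (simp add: a_def)
  define u v where "u = (\<lambda>x. sin (\<kappa> * x))" and "v = (\<lambda>x. \<kappa> * cos (\<kappa> * x))"
  have "primitive_on 0 T u v" "primitive_on 0 T v (\<lambda>x. - a x * u x)"
    unfolding u_def v_def a_def
    by (rule primitive_on_of_continuous_derivative;
        auto intro!: derivative_eq_intros continuous_intros
          simp: has_real_derivative_iff_has_vector_derivative[symmetric] power2_eq_square)+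
  then have s: "lin_solution 0 T a u v" by (simp add: lin_solution_def)
  obtain l where l: "m = 2 * l" using assms(1) by (rule evenE)
  have \<kappa>T: "\<kappa> * T = 2 * pi * real l" using T_pos l by (simp add: \<kappa>_def)
  have "u T = 0 \<and> v T = v 0"
  proof -
    have "sin (\<kappa> * T) = sin 0 \<and> cos (\<kappa> * T) = cos 0"
      unfolding sin_cos_eq_iff \<kappa>T by (intro exI[of _ "int l"]) simp
    then show ?thesis by (simp add: u_def v_def)
  qed
  then have p: "K.periodic_lin a u v" and p': "periodic_lin a u v" and uT: "u T = 0" and u0: "u 0 = 0"
    using s by (auto simp: K.periodic_lin_def periodic_lin_def u_def)
  have nz: "nontrivial_on T u" using initial_nontrivial[OF s] \<kappa> by (simp add: v_def)
  have lt: "\<sigma>\<^sup>2 < \<kappa>\<^sup>2"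
  proof -
    have "2 * real n < real m" using assms by simp
    then have "2 * real n * pi < real m * pi" by simp
    then have "\<sigma> < \<kappa>" using T_pos unfolding \<sigma>_def \<kappa>_def by (intro divide_strict_right_mono)
    then show ?thesis using \<sigma>_pos by (intro power_strict_mono) auto
  qed
  have "\<not> (AE t in lebesgue. t \<notin> {0..T})" by (rule interval_not_null[OF T_pos])
  then have ab: "above a"
    unfolding above_def strictly_below_const_iff[OF ai] using ai lt by (auto simp: L_per_def a_def)
  obtain \<theta> k y where \<theta>: "K.pruefer_angle 0 T a \<theta>" "\<theta> T = \<theta> 0 + 2 * pi * real k" and
    z: "interlaced_zeros T u (2 * k) y"
  proof (rule K.periodic_solution_zeros[OF p ai nz u0])
    show "AE t in lebesgue. t \<in> {0..T} \<longrightarrow> \<kappa>\<^sup>2 \<le> a t" by (simp add: a_def)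
  qed blast
  have "2 * pi * real k = \<kappa> * T" using K.rot_eq[OF \<theta>(1) ai] \<theta>(2) K.rot_free by (simp add: a_def)
  then have "k = l" using \<kappa>T by simp
  then have "interlaced_zeros T u m y" using z l by simp
  moreover have "a \<in> Lambda_set T n" using ab p' nz by (auto simp: Lambda_set_iff)
  moreover have "is_periodic_solution T a u" using is_periodic_solution_iff[OF ai] p' by blast
  ultimately show ?thesis using nz u0 uT by blast
qed

text \<open>The phases \<open>\<sigma> len\<close> of the \<open>4 k \<ge> 4 (n + 1)\<close> quarter turns add up to \<open>\<sigma> T = 4 (n + 1) t0\<close>.
  Equality would make each of them \<open>\<pi>/2\<close>, hence \<open>2 \<pi> k = 2 \<pi> n\<close>.\<close>

lemma excess_lower_bound:
  assumes a: "above a" and \<theta>: "pruefer_angle 0 T a \<theta>" and k: "\<theta> T = \<theta> 0 + 2 * pi * of_int k"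
  shows "bound < integral {0..T} (\<lambda>t. a t - \<sigma>\<^sup>2)"
proof -
  note q = aboveD(1)[OF a]
  have kn: "k \<ge> int n + 1" by (rule angle_turns[OF a \<theta> k])
  define l where "l = nat k"
  have l: "k = int l" "l \<ge> n + 1" "l \<ge> 1" using kn by (auto simp: l_def)
  have th: "angle_solution 0 T \<sigma> (coeff a) \<theta>" using \<theta> by (simp add: pruefer_angle_def)
  have per: "coeff a (x + T) = coeff a x" for x using aboveD(2)[OF a] by simp
  have k': "\<theta> T = \<theta> 0 + 2 * pi * real l" using k l by simp
  obtain len where len: "\<And>i. i < 4 * l \<Longrightarrow> 0 < len i \<and> \<sigma> * len i \<le> pi / 2"
    "(\<Sum>i<4*l. len i) = T" "(\<Sum>i<4*l. cot (\<sigma> * len i)) \<le> integral {0..T} (coeff a)"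
    "integral {0..T} (coeff a) = (\<Sum>i<4*l. cot (\<sigma> * len i)) \<Longrightarrow> (\<forall>i<4*l. \<sigma> * len i = pi / 2)"
    using periodic_quarter_turns[OF T_pos \<sigma>_pos th coeff_abs_int[OF q] per coeff_nonneg[OF aboveD(3)[OF a]] k' l(3)]
    by metis
  have sum: "(\<Sum>i<4*l. \<sigma> * len i) = 4 * (real n + 1) * t0"
    unfolding t0(3) len(2)[symmetric] by (simp add: sum_distrib_left)
  have "4 * (real n + 1) * cot t0 \<le> (\<Sum>i<4*l. cot (\<sigma> * len i))"
    by (rule cot_sum_lower_bound[OF _ sum t0(1,2)]) (use len(1) \<sigma>_pos l in auto)
  moreover have "(\<Sum>i<4*l. cot (\<sigma> * len i)) \<noteq> integral {0..T} (coeff a)"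
  proof
    assume "(\<Sum>i<4*l. cot (\<sigma> * len i)) = integral {0..T} (coeff a)"
    then have "\<sigma> * len i = pi / 2" if "i < 4 * l" for i using len(4) that by simp
    then have "(\<Sum>i<4*l. \<sigma> * len i) = (\<Sum>i<4*l. pi / 2)" by (intro sum.cong) auto
    then have "(\<Sum>i<4*l. \<sigma> * len i) = real (4 * l) * (pi / 2)" by simp
    then have "pi * real n = pi * real l" using sum \<sigma>T unfolding t0(3) by simp
    then show False using l by simp
  qed
  ultimately have "4 * (real n + 1) * cot t0 < integral {0..T} (coeff a)" using len(3) by linarith
  then have "\<sigma> * (4 * (real n + 1) * cot t0) < \<sigma> * (integral {0..T} (\<lambda>t. a t - \<sigma>\<^sup>2) / \<sigma>)"
    unfolding coeff_integral[OF q] using \<sigma>_pos by (rule mult_strict_left_mono)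
  then show ?thesis unfolding bound_eq using \<sigma>_pos by simp
qed

lemma Lambda_set_lower_bound:
  assumes a: "a \<in> Lambda_set T n"
  shows "bound < L1_norm {0<..<T} (\<lambda>t. a t - \<sigma>\<^sup>2)"
proof -
  obtain u v where ab: "above a" and p: "periodic_lin a u v" and nz: "nontrivial_on T u"
    using a Lambda_set_iff by blast
  note q = aboveD(1)[OF ab]
  have s: "lin_solution 0 T a u v" using p by (simp add: periodic_lin_def)
  obtain r \<phi> where r: "r > 0" "u 0 = r * sin \<phi>" "v 0 = \<sigma> * (r * cos \<phi>)"
    using polar_coordinates nontrivial_initial[OF s q nz] by metis
  obtain k :: int where k: "rot a \<phi> = 2 * pi * of_int k" using rot_of_periodic[OF p q r] .
  obtain \<theta> where \<theta>: "pruefer_angle 0 T a \<theta>" "\<theta> 0 = \<phi>" "\<theta> T = \<phi> + rot a \<phi>" using rot_witness[OF q] .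
  have "bound < integral {0..T} (\<lambda>t. a t - \<sigma>\<^sup>2)"
    by (rule excess_lower_bound[OF ab \<theta>(1)]) (use \<theta> k in simp)
  then show ?thesis using excess_norm[OF ab, of 0 T] by simp
qed

lemma family_above:
  assumes p: "p absolutely_integrable_on {0..T}" "\<And>x. p (x + T) = p x"
    "AE t in lebesgue. t \<in> {0..T} \<longrightarrow> 0 \<le> p t" and "s \<ge> 0"
    and ne: "\<not> (AE t in lebesgue. t \<in> {0..T} \<longrightarrow> s * p t = 0)"
  shows "above (\<lambda>t. \<sigma>\<^sup>2 + s * p t)"
proof -
  have i: "(\<lambda>t. \<sigma>\<^sup>2 + s * p t) absolutely_integrable_on {0..T}"
    using p(1) by (intro set_integral_add(1)) auto
  have "AE t in lebesgue. t \<in> {0..T} \<longrightarrow> \<sigma>\<^sup>2 \<le> \<sigma>\<^sup>2 + s * p t"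
    using p(3) by eventually_elim (use \<open>s \<ge> 0\<close> in auto)
  moreover have "\<not> (AE t in lebesgue. t \<in> {0..T} \<longrightarrow> \<sigma>\<^sup>2 = \<sigma>\<^sup>2 + s * p t)" using ne by simp
  ultimately show ?thesis
    unfolding above_def strictly_below_const_iff[OF i] using i p(2) by (simp add: L_per_def)
qed

text \<open>The trial weight rotates the angle from \<open>0\<close> by at least \<open>2 \<pi> (n + 1)\<close>. On the segment from
  \<open>\<sigma>\<^sup>2\<close> to the trial potential the maximal rotation takes the value \<open>2 \<pi> (n + 1)\<close>; that potential
  has a periodic solution and no larger an excess than the trial potential.\<close>

lemma near_minimal_potential:
  assumes \<epsilon>: "0 < \<epsilon>" "\<epsilon> < T / (4 * (real n + 1))"
  shows "\<exists>a\<in>Lambda_set T n. L1_norm {0<..<T} (\<lambda>t. a t - \<sigma>\<^sup>2) \<le> \<sigma> * (4 * (real n + 1) * cot (t0 - \<sigma> * \<epsilon>))"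
proof -
  define K where "K = 2 * (n + 1)"
  define h where "h = T / real K"
  have K: "K \<ge> 1" "real K * h = T" "h > 0" using T_pos by (auto simp: K_def h_def)
  have h2: "h / 2 = T / (4 * (real n + 1))" by (simp add: h_def K_def algebra_simps)
  have "\<sigma> * (h / 2) = (4 * (real n + 1) * t0) / (4 * (real n + 1))" unfolding h2 t0(3) by simp
  also have "\<dots> = t0" by (rule nonzero_mult_div_cancel_left) simp
  finally have \<sigma>h: "\<sigma> * (h / 2) = t0" .
  have \<epsilon>h: "\<epsilon> < h / 2" using \<epsilon>(2) unfolding h2 .
  define \<alpha> where "\<alpha> = \<sigma> * (h / 2 - \<epsilon>)"
  have \<alpha>: "\<alpha> = t0 - \<sigma> * \<epsilon>" "\<alpha> > 0" "\<alpha> < pi / 2"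
  proof -
    show 1: "\<alpha> = t0 - \<sigma> * \<epsilon>" unfolding \<alpha>_def right_diff_distrib \<sigma>h ..
    show "\<alpha> > 0" using \<epsilon>h \<sigma>_pos by (simp add: \<alpha>_def)
    have "\<sigma> * \<epsilon> > 0" using \<epsilon> \<sigma>_pos by simp
    then show "\<alpha> < pi / 2" using 1 t0(2) by linarith
  qed
  have cot: "cot \<alpha> > 0" using \<alpha> by (intro cot_gt_zero) auto
  have small: "\<sigma> * h < pi" using \<sigma>h t0(2) by simp
  have "cot \<alpha> / \<epsilon> \<ge> 0" using cot \<epsilon> by simp
  then obtain r :: "real \<Rightarrow> real" where r: "\<And>x. r (x + T) = r x" "\<And>x. 0 \<le> r x"
    "r absolutely_integrable_on {0..T}" "integral {0..T} r = real K * (2 * \<epsilon> * (cot \<alpha> / \<epsilon>))"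
    "\<And>i t. i < K \<Longrightarrow> t \<in> {real i * h + h/2 - \<epsilon>..real i * h + h/2 + \<epsilon>} \<Longrightarrow> cot \<alpha> / \<epsilon> \<le> r t"
    using trial_weight[OF K(3) \<epsilon>(1) \<epsilon>h _ K(1), unfolded K(2)] by metis
  define p where "p = (\<lambda>t. \<sigma> * r t)"
  have p: "p absolutely_integrable_on {0..T}" unfolding p_def using r(3) by (rule set_integrable_mult_right)
  define q where "q = (\<lambda>s t. \<sigma>\<^sup>2 + s * p t)"
  have free: "(\<lambda>_. \<sigma>\<^sup>2) absolutely_integrable_on {0..T}" by simp
  have qi: "q s absolutely_integrable_on {0..T}" for s
    unfolding q_def using p by (intro set_integral_add(1)) auto
  have coeff1: "coeff (q 1) = r" using \<sigma>_pos by (auto simp: q_def p_def power2_eq_square add_divide_distrib)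
  obtain \<theta> where \<theta>: "pruefer_angle 0 T (q 1) \<theta>" "\<theta> 0 = 0" "\<theta> T = 0 + rot (q 1) 0" using rot_witness[OF qi] .
  have "angle_solution 0 (real K * h) \<sigma> r \<theta>" using \<theta>(1) by (simp add: pruefer_angle_def coeff1 K(2))
  from bumps_rotation[OF this _ r(2) \<sigma>_pos \<epsilon>(1) \<epsilon>h small r(5)[unfolded \<alpha>_def] \<theta>(2), where i = K]
  have "real K * pi \<le> \<theta> T" using r(3) K(2) by simp
  then have top: "2 * pi * real (n + 1) \<le> max_rot (q 1)"
    using \<theta>(3) max_rot(1)[OF qi, of 1 0] by (simp add: K_def algebra_simps)
  have bot: "max_rot (q 0) = 2 * pi * real n" using extremal_rot_free(1) \<sigma>T by (simp add: q_def)
  have "continuous_on {0..1} (\<lambda>s. max_rot (q s))"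
    using rot_family_continuous(2)[OF free p] unfolding q_def by (rule continuous_on_subset) simp
  then obtain s where s: "0 \<le> s" "s \<le> 1" "max_rot (q s) = 2 * pi * real (n + 1)"
    using IVT'[of "\<lambda>s. max_rot (q s)" 0 "2 * pi * real (n + 1)" 1] top bot by auto
  have ab: "above (q s)"
    unfolding q_def
  proof (rule family_above[OF p _ _ s(1)])
    show "p (x + T) = p x" for x by (simp add: p_def r(1))
    show "AE t in lebesgue. t \<in> {0..T} \<longrightarrow> 0 \<le> p t" using r(2) \<sigma>_pos by (simp add: p_def)
    show "\<not> (AE t in lebesgue. t \<in> {0..T} \<longrightarrow> s * p t = 0)"
    proof
      assume ae: "AE t in lebesgue. t \<in> {0..T} \<longrightarrow> s * p t = 0"
      have "AE t in lebesgue. t \<in> {0..T} \<longrightarrow> q s t \<le> \<sigma>\<^sup>2" using ae by eventually_elim (auto simp: q_def)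
      from rot_mono[OF qi free this] have "rot (q s) \<phi> \<le> 2 * pi * real n" for \<phi> by (simp add: rot_free \<sigma>T)
      moreover obtain \<phi> where "rot (q s) \<phi> = max_rot (q s)" using max_rot(2)[OF qi] by blast
      ultimately have "2 * pi * real (n + 1) \<le> 2 * pi * real n" using s(3) by metis
      then show False using pi_gt_zero by (simp add: distrib_left)
    qed
  qed
  obtain \<phi> where \<phi>: "rot (q s) \<phi> = max_rot (q s)" using max_rot(2)[OF qi] by blast
  obtain u v where uv: "periodic_lin (q s) u v" "u 0 = sin \<phi>" "v 0 = \<sigma> * cos \<phi>"
    using extremal_rotation_periodic[OF qi, of s \<phi> "int (n + 1)"] \<phi> s(3) max_rot(1)[OF qi] by (metis of_int_of_nat_eq)
  have "sin \<phi> \<noteq> 0 \<or> cos \<phi> \<noteq> 0" using sin_zero_norm_cos_one[of \<phi>] by force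
  then have "nontrivial_on T u" using initial_nontrivial[of "q s" u v] uv \<sigma>_pos by (auto simp: periodic_lin_def)
  then have mem: "q s \<in> Lambda_set T n" using ab uv(1) Lambda_set_iff by blast
  have "L1_norm {0<..<T} (\<lambda>t. q s t - \<sigma>\<^sup>2) = integral {0..T} (\<lambda>t. s * (\<sigma> * r t))"
    using excess_norm[OF ab, of 0 T] by (simp add: q_def p_def)
  also have "\<dots> = s * (\<sigma> * (4 * (real n + 1) * cot \<alpha>))"
  proof -
    have "2 * \<epsilon> * (cot \<alpha> / \<epsilon>) = 2 * cot \<alpha>" using \<epsilon>(1) by simp
    moreover have "real K = 2 * (real n + 1)" by (simp add: K_def)
    ultimately have "integral {0..T} r = 4 * (real n + 1) * cot \<alpha>" unfolding r(4) by simp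
    then show ?thesis by simp
  qed
  also have "\<dots> \<le> 1 * (\<sigma> * (4 * (real n + 1) * cot \<alpha>))"
    using s(2) \<sigma>_pos cot by (intro mult_right_mono) auto
  finally show ?thesis using mem \<alpha>(1) by auto
qed

lemma beta1_eq: "beta1 T n = bound"
proof -
  let ?N = "\<lambda>a. L1_norm {0<..<T} (\<lambda>t. a t - \<sigma>\<^sup>2)"
  have ne: "Lambda_set T n \<noteq> {}" using constant_potential_example[of "2 * (n + 1)"] by auto
  have "Inf (?N ` Lambda_set T n) = bound"
  proof (rule cInf_eq_non_empty)
    show "?N ` Lambda_set T n \<noteq> {}" using ne by simp
    show "bound \<le> x" if "x \<in> ?N ` Lambda_set T n" for x
      using Lambda_set_lower_bound that by (auto intro: less_imp_le)
    fix y assume y: "\<And>x. x \<in> ?N ` Lambda_set T n \<Longrightarrow> y \<le> x"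
    have le: "y \<le> \<sigma> * (4 * (real n + 1) * cot (t0 - \<sigma> * \<epsilon>))" if "0 < \<epsilon>" "\<epsilon> < T / (4 * (real n + 1))" for \<epsilon>
      using near_minimal_potential[OF that] y by force
    have "((\<lambda>\<epsilon>. \<sigma> * (4 * (real n + 1) * cot (t0 - \<sigma> * \<epsilon>))) \<longlongrightarrow> \<sigma> * (4 * (real n + 1) * cot (t0 - \<sigma> * 0))) (at_right 0)"
    proof (intro tendsto_intros)
      have "sin t0 > 0" using t0(1,2) pi_gt_zero by (intro sin_gt_zero) linarith+
      then show "sin (t0 - \<sigma> * 0) \<noteq> 0" by simp
    qed
    then have lim: "((\<lambda>\<epsilon>. \<sigma> * (4 * (real n + 1) * cot (t0 - \<sigma> * \<epsilon>))) \<longlongrightarrow> bound) (at_right 0)"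
      unfolding bound_eq by simp
    show "y \<le> bound"
    proof (rule tendsto_lowerbound[OF lim])
      have "0 < T / (4 * (real n + 1))" using T_pos by simp
      then show "\<forall>\<^sub>F \<epsilon> in at_right 0. y \<le> \<sigma> * (4 * (real n + 1) * cot (t0 - \<sigma> * \<epsilon>))"
        unfolding eventually_at_right_field using le by blast
    qed simp
  qed
  then show ?thesis unfolding beta1_def eigenvalue0_eq .
qed

text \<open>By the characterization of the eigenvalues this says \<open>2 \<pi> n < rot a \<phi> < 2 \<pi> (n + 1)\<close> for
  all \<open>\<phi>\<close>.\<close>

lemma eigenvalues_enclose_zero:
  assumes a: "above a" and norm: "L1_norm {0<..<T} a \<le> gamma1 T n"
  shows "eigenvalue T a (2 * n) < 0" "0 < eigenvalue T a (2 * n + 1)"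
proof -
  note q = aboveD(1)[OF a]
  have excess: "integral {0..T} (\<lambda>t. a t - \<sigma>\<^sup>2) \<le> bound"
  proof -
    have "AE t in lebesgue. t \<in> {0..T} \<longrightarrow> 0 \<le> a t"
      using aboveD(3)[OF a] by eventually_elim (metis order_trans zero_le_power2)
    then have "integral {0..T} a \<le> T * \<sigma>\<^sup>2 + bound"
      using norm L1_norm_nonneg_eq[OF q] unfolding gamma1_def eigenvalue0_eq beta1_eq by simp
    moreover have "integral {0..T} (\<lambda>t. a t - \<sigma>\<^sup>2) = integral {0..T} a - T * \<sigma>\<^sup>2"
      using integral_diff[OF abs_int_imp_int[OF q] integrable_const_ivl, of "\<sigma>\<^sup>2"] T_pos by simp
    ultimately show ?thesis by simp
  qed
  have b0: "bound > 0"
    unfolding bound_eq using \<sigma>_pos cot_gt_zero[OF t0(1,2)] by simp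
  define p where "p = (\<lambda>t. a t - \<sigma>\<^sup>2)"
  have p: "p absolutely_integrable_on {0..T}" unfolding p_def by (rule excess_abs_int[OF q])
  have free: "(\<lambda>_. \<sigma>\<^sup>2) absolutely_integrable_on {0..T}" by simp
  have upper: "rot a \<phi> < 2 * pi * real (n + 1)" for \<phi>
  proof (rule ccontr)
    assume "\<not> rot a \<phi> < 2 * pi * real (n + 1)"
    then have top: "2 * pi * real (n + 1) \<le> rot (\<lambda>t. \<sigma>\<^sup>2 + 1 * p t) \<phi>" by (simp add: p_def)
    have bot: "rot (\<lambda>t. \<sigma>\<^sup>2 + 0 * p t) \<phi> = 2 * pi * real n" by (simp add: rot_free \<sigma>T)
    have "continuous_on {0..1} (\<lambda>s. rot (\<lambda>t. \<sigma>\<^sup>2 + s * p t) \<phi>)"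
      using rot_family_continuous(1)[OF free p] by (rule continuous_on_subset) simp
    then obtain s where s: "0 \<le> s" "s \<le> 1" "rot (\<lambda>t. \<sigma>\<^sup>2 + s * p t) \<phi> = 2 * pi * real (n + 1)"
      using IVT'[of "\<lambda>s. rot (\<lambda>t. \<sigma>\<^sup>2 + s * p t) \<phi>" 0 "2 * pi * real (n + 1)" 1] top bot by auto
    have "s \<noteq> 0" using s(3) bot by auto
    have ab: "above (\<lambda>t. \<sigma>\<^sup>2 + s * p t)"
    proof (rule family_above[OF p _ _ s(1)])
      show "p (x + T) = p x" for x by (simp add: p_def aboveD(2)[OF a])
      show "AE t in lebesgue. t \<in> {0..T} \<longrightarrow> 0 \<le> p t" using aboveD(3)[OF a] by eventually_elim (simp add: p_def)
      show "\<not> (AE t in lebesgue. t \<in> {0..T} \<longrightarrow> s * p t = 0)"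
      proof
        assume "AE t in lebesgue. t \<in> {0..T} \<longrightarrow> s * p t = 0"
        then have "AE t in lebesgue. t \<in> {0..T} \<longrightarrow> \<sigma>\<^sup>2 = a t"
          by eventually_elim (use \<open>s \<noteq> 0\<close> in \<open>simp add: p_def\<close>)
        then show False using aboveD(4)[OF a] by simp
      qed
    qed
    obtain \<theta> where \<theta>: "pruefer_angle 0 T (\<lambda>t. \<sigma>\<^sup>2 + s * p t) \<theta>" "\<theta> 0 = \<phi>"
      "\<theta> T = \<phi> + rot (\<lambda>t. \<sigma>\<^sup>2 + s * p t) \<phi>" using rot_witness[OF aboveD(1)[OF ab]] .
    have "bound < integral {0..T} (\<lambda>t. (\<sigma>\<^sup>2 + s * p t) - \<sigma>\<^sup>2)"
      by (rule excess_lower_bound[OF ab \<theta>(1), of "int (n + 1)"]) (use \<theta> s in simp)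
    also have "\<dots> = s * integral {0..T} p" by simp
    also have "\<dots> \<le> s * bound" using excess s(1) by (intro mult_left_mono) (simp_all add: p_def)
    also have "\<dots> \<le> 1 * bound" using s(2) b0 by (intro mult_right_mono) auto
    finally show False by simp
  qed
  have lower: "2 * pi * real n < rot a \<phi>" for \<phi> using rot_above_free[OF q aboveD(3,4)[OF a]] \<sigma>T by simp
  obtain \<phi> \<psi> where "rot a \<phi> = max_rot a" "rot a \<psi> = min_rot a"
    using max_rot(2)[OF q] min_rot(2)[OF q] by blast
  then have mx: "max_rot (\<lambda>t. 0 + a t) < 2 * pi * real (n + 1)" and mn: "2 * pi * real n < min_rot (\<lambda>t. 0 + a t)"
    using upper[of \<phi>] lower[of \<psi>] by simp_all
  show "eigenvalue T a (2 * n) < 0"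
    using shift_strict_mono(2)[OF q, of 0 "eigenvalue T a (2 * n)"] mn eigenvalue_characterization(1)[OF q, of n]
    by (cases "eigenvalue T a (2 * n)" "0 :: real" rule: linorder_cases) auto
  have "max_rot (\<lambda>t. eigenvalue T a (2 * n + 1) + a t) = 2 * pi * real (n + 1)"
    using eigenvalue_characterization(2)[OF q, of "n + 1"] by simp
  then show "0 < eigenvalue T a (2 * n + 1)"
    using shift_strict_mono(1)[OF q, of "eigenvalue T a (2 * n + 1)" 0] mx
    by (cases "eigenvalue T a (2 * n + 1)" "0 :: real" rule: linorder_cases) auto
qed

end

theorem theorem2p1:
  fixes T :: real and n :: nat
  assumes "T > 0" and "n \<ge> 1"
  shows
    "(\<forall>a\<in>Lambda_set T n. \<forall>u.
        is_periodic_solution T a u \<and> nontrivial_on T u \<and> u 0 = 0 \<and> u T = 0 \<longrightarrow>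
        (\<exists>m x. interlaced_zeros T u m x) \<and>
        (\<forall>m x. interlaced_zeros T u m x \<longrightarrow>
           (\<forall>i<2 * m. x (i + 1) - x i \<le> T / (4 * real n)) \<and>
           (\<exists>i<2 * m. x (i + 1) - x i < T / (4 * real n)) \<and>
           even m \<and> m \<ge> 2 * (n + 1) \<and>
           (\<forall>i<2 * m.
              L1_norm {x i<..<x (i + 1)} (\<lambda>t. a t - eigenvalue0 T (2 * n - 1))
                \<ge> 2 * real n * pi / T * cot (2 * real n * pi / T * (x (i + 1) - x i))))) \<and>
     (\<forall>m. even m \<and> m \<ge> 2 * (n + 1) \<longrightarrow>
        (\<exists>a\<in>Lambda_set T n. \<exists>u x.
           is_periodic_solution T a u \<and> nontrivial_on T u \<and> u 0 = 0 \<and> u T = 0 \<and>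
           interlaced_zeros T u m x)) \<and>
     beta1 T n =
       8 * pi * real n * (real n + 1) / T * cot (real n * pi / (2 * (real n + 1))) \<and>
     (\<nexists>a. a \<in> Lambda_set T n \<and>
        L1_norm {0<..<T} (\<lambda>x. a x - eigenvalue0 T (2 * n - 1)) = beta1 T n) \<and>
     (\<forall>a\<in>L_per T.
        strictly_below T (\<lambda>_. eigenvalue0 T (2 * n - 1)) a \<and>
        L1_norm {0<..<T} a \<le> gamma1 T n \<longrightarrow>
        eigenvalue T a (2 * n) < 0 \<and> 0 < eigenvalue T a (2 * n + 1))"
proof -
  define \<sigma> where "\<sigma> = 2 * real n * pi / T"
  interpret resonance T \<sigma> n
    by unfold_locales (use assms in \<open>auto simp: \<sigma>_def\<close>)
  have spacing: "(\<exists>m x. interlaced_zeros T u m x) \<and>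
        (\<forall>m x. interlaced_zeros T u m x \<longrightarrow>
           (\<forall>i<2 * m. x (i + 1) - x i \<le> T / (4 * real n)) \<and>
           (\<exists>i<2 * m. x (i + 1) - x i < T / (4 * real n)) \<and>
           even m \<and> m \<ge> 2 * (n + 1) \<and>
           (\<forall>i<2 * m. L1_norm {x i<..<x (i + 1)} (\<lambda>t. a t - \<sigma>\<^sup>2) \<ge> \<sigma> * cot (\<sigma> * (x (i + 1) - x i))))"
    if a: "a \<in> Lambda_set T n" and u: "is_periodic_solution T a u" "nontrivial_on T u" "u 0 = 0" for a u
  proof -
    have ab: "above a" using a Lambda_set_iff by blast
    obtain v where v: "periodic_lin a u v" using is_periodic_solution_iff[OF aboveD(1)[OF ab]] u(1) by blast
    obtain l y where y: "interlaced_zeros T u l y" "even l" "l \<ge> 2 * (n + 1)"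
      "\<And>i. i < 2 * l \<Longrightarrow> y (i + 1) - y i \<le> T / (4 * real n)"
      "\<exists>i<2 * l. y (i + 1) - y i < T / (4 * real n)"
      "\<And>i. i < 2 * l \<Longrightarrow> \<sigma> * cot (\<sigma> * (y (i + 1) - y i)) \<le> L1_norm {y i<..<y (i + 1)} (\<lambda>t. a t - \<sigma>\<^sup>2)"
      using zero_spacing[OF ab v u(2,3)] by metis
    show ?thesis
    proof (intro conjI allI impI)
      show "\<exists>m x. interlaced_zeros T u m x" using y(1) by blast
      fix m x assume x: "interlaced_zeros T u m x"
      have m: "m = l" and eq: "x i = y i" if "i \<le> 2 * l" for i
        using interlaced_zeros_unique[OF x y(1)] that by auto
      have ml: "m = l" using m[of 0] by simp
      have xy: "x i = y i" "x (i + 1) = y (i + 1)" if "i < 2 * m" for i using eq[of i] eq[of "i + 1"] that ml by auto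
      show "x (i + 1) - x i \<le> T / (4 * real n)" if "i < 2 * m" for i using xy[OF that] y(4)[of i] that ml by simp
      show "\<exists>i<2 * m. x (i + 1) - x i < T / (4 * real n)" using xy y(5) ml by metis
      show "even m" "m \<ge> 2 * (n + 1)" using ml y by auto
      show "L1_norm {x i<..<x (i + 1)} (\<lambda>t. a t - \<sigma>\<^sup>2) \<ge> \<sigma> * cot (\<sigma> * (x (i + 1) - x i))" if "i < 2 * m" for i
        using xy[OF that] y(6)[of i] that ml by simp
    qed
  qed
  have not_attained: "\<nexists>a. a \<in> Lambda_set T n \<and> L1_norm {0<..<T} (\<lambda>x. a x - \<sigma>\<^sup>2) = beta1 T n"
    using Lambda_set_lower_bound unfolding beta1_eq by (metis less_irrefl)
  have enclose: "eigenvalue T a (2 * n) < 0 \<and> 0 < eigenvalue T a (2 * n + 1)"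
    if "a \<in> L_per T" "strictly_below T (\<lambda>_. \<sigma>\<^sup>2) a" "L1_norm {0<..<T} a \<le> gamma1 T n" for a
    using eigenvalues_enclose_zero[of a] that by (simp add: above_def)
  show ?thesis
    unfolding eigenvalue0_eq \<sigma>_def[symmetric]
  proof (rule conjI[OF _ conjI[OF _ conjI[OF beta1_eq conjI[OF not_attained]]]], goal_cases)
    case 1
    show ?case by (rule ballI, rule allI, rule impI, rule spacing; (elim conjE)?; assumption)
  next
    case 2
    show ?case by (rule allI, rule impI, rule constant_potential_example; (elim conjE)?; assumption)
  next
    case 3
    show ?case by (rule ballI, rule impI, rule enclose; (elim conjE)?; assumption)
  qed
qed

end
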